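(* For an integer $m\ge 1$ and odd integers $\ell,\ell'$, put $\alpha=1+2^m\ell$ and $\alpha'=1+2^m\ell'$, and let $H_2(\cdot)$ be the group defined in the context. Then $H_2(1+2\ell)\cong H_2(3)$, $H_2(1+4\ell)\cong H_2(5)$, $H_2(1+8\ell)\cong H_2(9)$ for every odd $\ell$, and for $m>2$, $H_2(\alpha')\cong H_2(\alpha)$ if and only if $\alpha'\equiv\alpha\bmod 2^{2m-2}$. In particular, for fixed $m>2$, there are exactly $\varphi(2^{m-2})$ isomorphism classes of groups $H_2(1+2^m\ell)$ ($\ell$ odd), where $\varphi$ is Euler's function.
   Context: Conventions: $[a,b]=a^{-1}b^{-1}ab$ and $b^a=a^{-1}ba$. For $m\ge1$, $\ell$ odd and $\alpha=1+2^m\ell$ (note that $m$ is determined by $\alpha$), $$J_2(\alpha)=\langle x,y\mid x^{[x,y]}=x^{\alpha},\ y^{[y,x]}=y^{\alpha},\ x^{2^{3m-1}}=y^{2^{3m-1}}=1\rangle,$$ and $H_2(\alpha)=J_2(\alpha)/Z(J_2(\alpha))$, the quotient by the center. *)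

theory Defs
  imports "HOL-Algebra.Coset" "HOL-Number_Theory.Number_Theory"
begin

section \<open>The free group on a type of generators\<close>

text \<open>A word is a list of letters \<open>(g, b)\<close>, standing for \<open>g\<close> if \<open>b\<close> holds and for the inverse of
  \<open>g\<close> otherwise.  Elements of the free group are the classes of words modulo free cancellation.\<close>

inductive free_eq :: "('g \<times> bool) list \<Rightarrow> ('g \<times> bool) list \<Rightarrow> bool" where
  free_eq_refl: "free_eq u u"
| free_eq_sym: "free_eq u v \<Longrightarrow> free_eq v u"
| free_eq_trans: "free_eq u v \<Longrightarrow> free_eq v w \<Longrightarrow> free_eq u w"
| free_eq_cancel: "free_eq (u @ [(g, b), (g, \<not> b)] @ v) (u @ v)"

definition word_class :: "('g \<times> bool) list \<Rightarrow> ('g \<times> bool) list set" where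
  "word_class u = {v. free_eq u v}"

definition free_group :: "('g \<times> bool) list set monoid" where
  "free_group = \<lparr>carrier = range word_class,
     monoid.mult = (\<lambda>A B. \<Union>u\<in>A. \<Union>v\<in>B. word_class (u @ v)),
     one = word_class []\<rparr>"

definition free_gen :: "'g \<Rightarrow> ('g \<times> bool) list set" where
  "free_gen g = word_class [(g, True)]"

lemma word_class_eq_iff: "word_class u = word_class v \<longleftrightarrow> free_eq u v"
  unfolding word_class_def by (auto intro: free_eq.intros)

lemma free_eq_append_left: "free_eq u v \<Longrightarrow> free_eq (w @ u) (w @ v)"
proof (induction rule: free_eq.induct)
  case (free_eq_cancel u g b v)
  then show ?case using free_eq.free_eq_cancel[of "w @ u" g b v] by simp
qed (blast intro: free_eq.intros)+

lemma free_eq_append_right: "free_eq u v \<Longrightarrow> free_eq (u @ w) (v @ w)"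
proof (induction rule: free_eq.induct)
  case (free_eq_cancel u g b v)
  then show ?case using free_eq.free_eq_cancel[of u g b "v @ w"] by simp
qed (blast intro: free_eq.intros)+

lemma free_eq_append: "free_eq u u' \<Longrightarrow> free_eq v v' \<Longrightarrow> free_eq (u @ v) (u' @ v')"
  by (meson free_eq_append_left free_eq_append_right free_eq_trans)

lemma free_group_mult:
  fixes u v :: "('g \<times> bool) list"
  shows "word_class u \<otimes>\<^bsub>free_group\<^esub> word_class v = word_class (u @ v)"
proof -
  have eq: "word_class (u' @ v') = word_class (u @ v)"
    if "u' \<in> word_class u" "v' \<in> word_class v" for u' v'
  proof -
    have "free_eq (u @ v) (u' @ v')"
      using that by (auto simp: word_class_def intro: free_eq_append)
    then show ?thesis
      unfolding word_class_eq_iff by (rule free_eq_sym)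
  qed
  have ne: "word_class w \<noteq> {}" for w :: "('g \<times> bool) list"
    by (auto simp: word_class_def intro: free_eq_refl)
  have "(\<Union>u'\<in>word_class u. \<Union>v'\<in>word_class v. word_class (u' @ v'))
      = (\<Union>u'\<in>word_class u. \<Union>v'\<in>word_class v. word_class (u @ v))"
    using eq by (intro SUP_cong refl) auto
  then show ?thesis
    using ne by (simp add: free_group_def)
qed

lemma carrier_free_group: "carrier free_group = range word_class"
  by (simp add: free_group_def)

lemma one_free_group: "\<one>\<^bsub>free_group\<^esub> = word_class []"
  by (simp add: free_group_def)

lemma free_gen_closed: "free_gen g \<in> carrier free_group"
  by (simp add: free_gen_def carrier_free_group)

lemma free_eq_inverse_append:
  "free_eq (map (\<lambda>(g, b). (g, \<not> b)) (rev u) @ u) []"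
proof (induction u)
  case Nil
  then show ?case by (simp add: free_eq_refl)
next
  case (Cons a u)
  obtain g b where a: "a = (g, b)" by (cases a)
  have "free_eq (map (\<lambda>(g, b). (g, \<not> b)) (rev u) @ [(g, \<not> b), (g, \<not> \<not> b)] @ u)
          (map (\<lambda>(g, b). (g, \<not> b)) (rev u) @ u)"
    by (rule free_eq_cancel)
  then show ?case using Cons free_eq_trans by (fastforce simp: a)
qed

lemma group_free_group: "group free_group"
proof (rule groupI)
  fix x y z :: "('g \<times> bool) list set"
  assume "x \<in> carrier free_group" "y \<in> carrier free_group" "z \<in> carrier free_group"
  then show "x \<otimes>\<^bsub>free_group\<^esub> y \<otimes>\<^bsub>free_group\<^esub> z
      = x \<otimes>\<^bsub>free_group\<^esub> (y \<otimes>\<^bsub>free_group\<^esub> z)"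
    by (auto simp: carrier_free_group free_group_mult)
next
  fix x :: "('g \<times> bool) list set"
  assume "x \<in> carrier free_group"
  then obtain u where "x = word_class u" by (auto simp: carrier_free_group)
  then have "word_class (map (\<lambda>(g, b). (g, \<not> b)) (rev u)) \<otimes>\<^bsub>free_group\<^esub> x = \<one>\<^bsub>free_group\<^esub>"
    by (simp add: free_group_mult one_free_group word_class_eq_iff free_eq_inverse_append)
  then show "\<exists>y\<in>carrier free_group. y \<otimes>\<^bsub>free_group\<^esub> x = \<one>\<^bsub>free_group\<^esub>"
    by (auto simp: carrier_free_group)
qed (auto simp: carrier_free_group free_group_mult one_free_group)

lemma inv_free_gen: "inv\<^bsub>free_group\<^esub> (free_gen g) = word_class [(g, False)]"
proof (rule group.inv_equality[OF group_free_group])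
  show "word_class [(g, False)] \<otimes>\<^bsub>free_group\<^esub> free_gen g = \<one>\<^bsub>free_group\<^esub>"
    using free_eq_cancel[of "[]" g False "[]"]
    by (simp add: free_gen_def free_group_mult one_free_group word_class_eq_iff)
qed (auto simp: free_gen_def carrier_free_group)

text \<open>The universal property of the free group.\<close>

primrec word_value :: "('a, 'b) monoid_scheme \<Rightarrow> ('g \<Rightarrow> 'a) \<Rightarrow> ('g \<times> bool) list \<Rightarrow> 'a" where
  "word_value G f [] = \<one>\<^bsub>G\<^esub>"
| "word_value G f (a # u) =
     (if snd a then f (fst a) else inv\<^bsub>G\<^esub> (f (fst a))) \<otimes>\<^bsub>G\<^esub> word_value G f u"

lemma (in group) word_value_closed:
  "range f \<subseteq> carrier G \<Longrightarrow> word_value G f u \<in> carrier G"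
  by (induction u) auto

lemma (in group) word_value_append:
  "range f \<subseteq> carrier G \<Longrightarrow> word_value G f (u @ v) = word_value G f u \<otimes> word_value G f v"
  by (induction u) (auto simp: word_value_closed m_assoc image_subset_iff)

lemma (in group) word_value_cong:
  assumes f: "range f \<subseteq> carrier G" and "free_eq u v"
  shows "word_value G f u = word_value G f v"
  using assms(2)
proof (induction rule: free_eq.induct)
  case (free_eq_cancel u g b v)
  have "f g \<in> carrier G" "word_value G f v \<in> carrier G"
    using f word_value_closed[OF f] by auto
  then show ?case
    by (auto simp: word_value_append[OF f] m_assoc[symmetric])
qed auto

lemma (in group) free_group_universal:
  assumes f: "range f \<subseteq> carrier G"
  shows "\<exists>h. h \<in> hom free_group G \<and> (\<forall>g. h (free_gen g) = f g)"
proof -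
  define h where "h A = word_value G f (SOME u. word_class u = A)" for A
  have h: "h (word_class u) = word_value G f u" for u
  proof -
    have "word_class (SOME v. word_class v = word_class u) = word_class u"
      by (rule someI) simp
    then show ?thesis
      unfolding h_def word_class_eq_iff using word_value_cong[OF f] by blast
  qed
  have "h \<in> hom free_group G"
    by (rule homI)
      (auto simp: carrier_free_group h word_value_closed[OF f] free_group_mult
        word_value_append[OF f])
  moreover have "h (free_gen g) = f g" for g
    using f by (simp add: free_gen_def h image_subset_iff)
  ultimately show ?thesis by blast
qed

lemma (in group) free_group_hom_unique:
  assumes h: "h \<in> hom free_group G" and k: "k \<in> hom free_group G"
    and eq: "\<And>g. h (free_gen g) = k (free_gen g)"
    and A: "A \<in> carrier free_group"
  shows "h A = k A"
proof -
  interpret h: group_hom free_group G h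
    using h group_free_group by (simp add: group_hom_def group_hom_axioms_def is_group)
  interpret k: group_hom free_group G k
    using k group_free_group by (simp add: group_hom_def group_hom_axioms_def is_group)
  have letter: "h (word_class [a]) = k (word_class [a])" for a
  proof (cases a)
    case (Pair g b)
    show ?thesis
    proof (cases b)
      case True
      then show ?thesis using eq[of g] by (simp add: Pair free_gen_def)
    next
      case False
      then show ?thesis
        using eq[of g] h.hom_inv[OF free_gen_closed[of g]] k.hom_inv[OF free_gen_closed[of g]]
        by (simp add: Pair inv_free_gen)
    qed
  qed
  have "h (word_class u) = k (word_class u)" for u
  proof (induction u)
    case Nil
    then show ?case using h.hom_one k.hom_one by (simp add: one_free_group)
  next
    case (Cons a u)
    have "word_class (a # u) = word_class [a] \<otimes>\<^bsub>free_group\<^esub> word_class u"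
      by (simp add: free_group_mult)
    moreover have "word_class [a] \<in> carrier free_group" "word_class u \<in> carrier free_group"
      by (auto simp: carrier_free_group)
    ultimately show ?case using Cons letter by (simp add: h.hom_mult k.hom_mult)
  qed
  then show ?thesis using A by (auto simp: carrier_free_group)
qed


section \<open>Groups given by generators and relations\<close>

definition normal_closure :: "('a, 'b) monoid_scheme \<Rightarrow> 'a set \<Rightarrow> 'a set" where
  "normal_closure G S = \<Inter>{N. N \<lhd> G \<and> S \<subseteq> N}"

text \<open>A pair \<open>(r, s)\<close> stands for the relation \<open>r = s\<close> between elements of the free group.\<close>

definition presented_group ::
  "(('g \<times> bool) list set \<times> ('g \<times> bool) list set) set \<Rightarrow> ('g \<times> bool) list set set monoid" where
  "presented_group R =
     free_group Mod normal_closure free_group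
       ((\<lambda>(r, s). r \<otimes>\<^bsub>free_group\<^esub> inv\<^bsub>free_group\<^esub> s) ` R)"

lemma (in group) normal_closure_normal:
  assumes "S \<subseteq> carrier G"
  shows "normal_closure G S \<lhd> G"
proof -
  have c: "carrier G \<lhd> G"
    by (simp add: normal_inv_iff subgroup_self)
  have "subgroup (normal_closure G S) G"
    unfolding normal_closure_def
    by (rule subgroups_Inter) (use c assms in \<open>auto simp: normal_inv_iff\<close>)
  then show ?thesis
    by (auto simp: normal_inv_iff normal_closure_def)
qed

lemma presented_relators_closed:
  assumes "R \<subseteq> carrier free_group \<times> carrier free_group"
  shows "(\<lambda>(r, s). r \<otimes>\<^bsub>free_group\<^esub> inv\<^bsub>free_group\<^esub> s) ` R \<subseteq> carrier free_group"
proof -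
  interpret group free_group by (rule group_free_group)
  show ?thesis using assms by auto
qed

lemma group_presented_group:
  assumes "R \<subseteq> carrier free_group \<times> carrier free_group"
  shows "group (presented_group R)"
  unfolding presented_group_def
  by (intro normal.factorgroup_is_group group.normal_closure_normal group_free_group
      presented_relators_closed assms)


section \<open>Commutators, conjugates, centre\<close>

definition commutator :: "('a, 'b) monoid_scheme \<Rightarrow> 'a \<Rightarrow> 'a \<Rightarrow> 'a" where
  "commutator G a b = inv\<^bsub>G\<^esub> a \<otimes>\<^bsub>G\<^esub> inv\<^bsub>G\<^esub> b \<otimes>\<^bsub>G\<^esub> a \<otimes>\<^bsub>G\<^esub> b"

text \<open>\<open>conjugate G b a\<close> is \<open>b\<^sup>a\<close>, with the conjugating element on the right.\<close>

definition conjugate :: "('a, 'b) monoid_scheme \<Rightarrow> 'a \<Rightarrow> 'a \<Rightarrow> 'a" where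
  "conjugate G b a = inv\<^bsub>G\<^esub> a \<otimes>\<^bsub>G\<^esub> b \<otimes>\<^bsub>G\<^esub> a"

definition center :: "('a, 'b) monoid_scheme \<Rightarrow> 'a set" where
  "center G = {z \<in> carrier G. \<forall>g\<in>carrier G. z \<otimes>\<^bsub>G\<^esub> g = g \<otimes>\<^bsub>G\<^esub> z}"

lemma (in group) center_normal: "center G \<lhd> G"
proof -
  have "subgroup (center G) G"
  proof (rule subgroupI)
    show "center G \<noteq> {}"
      using one_closed by (force simp: center_def)
  next
    fix a assume a: "a \<in> center G"
    then have ac: "a \<in> carrier G" by (simp add: center_def)
    have "inv a \<otimes> g = g \<otimes> inv a" if g: "g \<in> carrier G" for g
    proof -
      have "inv a \<otimes> g = inv a \<otimes> (g \<otimes> a) \<otimes> inv a"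
        using ac g by (simp add: m_assoc)
      also have "g \<otimes> a = a \<otimes> g"
        using a g by (simp add: center_def)
      also have "inv a \<otimes> (a \<otimes> g) \<otimes> inv a = g \<otimes> inv a"
        using ac g by (simp add: m_assoc[symmetric])
      finally show ?thesis .
    qed
    then show "inv a \<in> center G" using ac by (simp add: center_def)
  next
    fix a b assume a: "a \<in> center G" and b: "b \<in> center G"
    then have c: "a \<in> carrier G" "b \<in> carrier G" by (simp_all add: center_def)
    have "a \<otimes> b \<otimes> g = g \<otimes> (a \<otimes> b)" if g: "g \<in> carrier G" for g
    proof -
      have "a \<otimes> b \<otimes> g = a \<otimes> (b \<otimes> g)" using c g by (simp add: m_assoc)
      also have "b \<otimes> g = g \<otimes> b" using b g by (simp add: center_def)
      also have "a \<otimes> (g \<otimes> b) = a \<otimes> g \<otimes> b" using c g by (simp add: m_assoc)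
      also have "a \<otimes> g = g \<otimes> a" using a g by (simp add: center_def)
      finally show ?thesis using c g by (simp add: m_assoc)
    qed
    then show "a \<otimes> b \<in> center G" using c by (simp add: center_def)
  qed (auto simp: center_def)
  moreover have "x \<otimes> h \<otimes> inv x \<in> center G" if x: "x \<in> carrier G" and h: "h \<in> center G" for x h
  proof -
    have "x \<otimes> h = h \<otimes> x" "h \<in> carrier G" using x h by (simp_all add: center_def)
    then show ?thesis using x h by (simp add: m_assoc)
  qed
  ultimately show ?thesis by (simp add: normal_inv_iff)
qed


section \<open>The groups $J_2(\alpha)$ and $H_2(\alpha)$\<close>

datatype generator = Gen_x | Gen_y

text \<open>For $\alpha = 1 + 2^m \ell$ with $\ell$ odd, \<open>level \<alpha>\<close> is the exponent $m$, which is
  determined by $\alpha$.\<close>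

definition level :: "int \<Rightarrow> nat" where
  "level \<alpha> = multiplicity 2 (\<alpha> - 1)"

lemma level_eq:
  assumes "odd l"
  shows "level (1 + 2 ^ m * l) = m"
  using assms unfolding level_def by (intro multiplicity_eqI) (auto simp: mult.commute)

definition J2_relations ::
  "int \<Rightarrow> ((generator \<times> bool) list set \<times> (generator \<times> bool) list set) set" where
  "J2_relations \<alpha> =
    (let F = free_group; x = free_gen Gen_x; y = free_gen Gen_y; n = 2 ^ (3 * level \<alpha> - 1) :: nat in
      {(conjugate F x (commutator F x y), x [^]\<^bsub>F\<^esub> \<alpha>),
       (conjugate F y (commutator F y x), y [^]\<^bsub>F\<^esub> \<alpha>),
       (x [^]\<^bsub>F\<^esub> n, \<one>\<^bsub>F\<^esub>),
       (y [^]\<^bsub>F\<^esub> n, \<one>\<^bsub>F\<^esub>)})"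

definition J2 :: "int \<Rightarrow> (generator \<times> bool) list set set monoid" where
  "J2 \<alpha> = presented_group (J2_relations \<alpha>)"

definition H2 :: "int \<Rightarrow> (generator \<times> bool) list set set set monoid" where
  "H2 \<alpha> = J2 \<alpha> Mod center (J2 \<alpha>)"

lemma group_J2: "group (J2 \<alpha>)"
proof -
  interpret group "free_group :: (generator \<times> bool) list set monoid" by (rule group_free_group)
  show ?thesis
    unfolding J2_def
    by (rule group_presented_group)
      (auto simp: J2_relations_def Let_def conjugate_def commutator_def free_gen_closed)
qed

lemma group_H2: "group (H2 \<alpha>)"
  unfolding H2_def by (intro normal.factorgroup_is_group group.center_normal group_J2)


section \<open>Isomorphism classes\<close>

definition iso_classes :: "('a, 'b) monoid_scheme set \<Rightarrow> ('a, 'b) monoid_scheme set set" where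
  "iso_classes \<G> = \<G> // {(G, H). G \<in> \<G> \<and> H \<in> \<G> \<and> G \<cong> H}"

end

theory Submission
  imports Defs
begin

text \<open>
  Put \<open>\<alpha> = 1 + 2^m l\<close> and \<open>z = [x, y]\<close>.  Conjugating \<open>x^z = x^\<alpha>\<close> by \<open>y\<close> expresses a power of \<open>x\<close>
  with exponent of 2-adic valuation \<open>2m - 1\<close> as a power of \<open>y\<close>, so \<open>x^(2^(2m-1))\<close> is central in
  \<open>J = J_2(\<alpha>)\<close>.  Adjoining \<open>X = x^(2^m)\<close>, \<open>Y = y^(2^m)\<close>, \<open>z\<close>, \<open>y\<close> and \<open>x\<close> one after the other by
  cyclic extensions yields a model of \<open>J\<close> that is large enough to show that this power generates
  the centre.  Hence in \<open>H = J/Z(J)\<close> every element is \<open>x^i y^j z^k\<close> with exponents unique modulo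
  \<open>2^(2m-1)\<close>, and these exponents multiply by an explicit formula.

  If \<open>u = x^a y^b z^e\<close> and \<open>v = x^c y^d z^f\<close> generate \<open>H\<close> and satisfy the relations for
  \<open>\<alpha>' = 1 + 2^m l'\<close>, then, after swapping \<open>u\<close> and \<open>v\<close> if necessary, the \<open>x\<close>- and \<open>y\<close>-exponents of
  these relations give \<open>b \<equiv> c \<equiv> 0\<close> and \<open>l' \<equiv> a d l\<close> modulo \<open>2^(m-2)\<close>.  The scaling by \<open>a d\<close> is ruled
  out by the \<open>z\<close>-exponents: they make the triangular numbers of \<open>a\<close> and \<open>d\<close> vanish modulo
  \<open>2^(m-3)\<close>, so \<open>a \<equiv> d \<equiv> 1\<close> and \<open>l' \<equiv> l\<close> modulo \<open>2^(m-2)\<close>.  Conversely \<open>u = x^(1 + 2^(m-2))\<close>,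
  \<open>v = x^(2^(m-2)) y\<close> satisfy the relations for \<open>\<alpha> + 2^(2m-2)\<close>.
\<close>

section \<open>Geometric sums and power calculus\<close>

text \<open>The relations of \<open>J\<close> only show that certain powers are central. That
  nothing else is central, and that exponents in \<open>H\<close> are unique, requires a group in
  which the relations hold and no power collapses unexpectedly; this is the obstacle that forces an
  explicit model. In the tower each new generator acts on the group below by an endomorphism. Such
  an endomorphism exists because every stage is universal for a short list of relations and the
  proposed images satisfy the same list again; what then has to fit exactly is that its
  \<open>n\<close>-th iterate is conjugation by the prescribed \<open>n\<close>-th power. With
  \<open>p = 2^(m-1)\<close> this works for \<open>Y^p = X^-p\<close> and
  \<open>z^(2 p p) = X^(p p)\<close>.

  In \<open>H\<close> exponents count modulo \<open>N = 2^(2m-1)\<close> and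
  \<open>q = 2^m l\<close> satisfies \<open>q^2 = 0\<close> there, so every collection formula is
  linear in \<open>q\<close>. The nonlinear terms are triangular numbers, the first correction to a
  geometric sum. They lose one factor 2, which explains the moduli \<open>2m - 1\<close> and
  \<open>m - 3\<close>.

  Bijectivity is never computed: surjections in both directions between finite groups suffice. The
  2-adic estimates start at \<open>m = 2\<close>; for \<open>m = 1\<close> the groups
  \<open>J\<close> themselves coincide.\<close>

definition geo :: "int \<Rightarrow> nat \<Rightarrow> int" where
  "geo e n = (\<Sum>i<n. e ^ i)"

lemma geo_0 [simp]: "geo e 0 = 0"
  by (simp add: geo_def)

lemma geo_Suc: "geo e (Suc n) = geo e n + e ^ n"
  by (simp add: geo_def)

lemma geo_power: "e ^ n = 1 + (e - 1) * geo e n"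
proof (induction n)
  case (Suc n)
  show ?case unfolding geo_Suc power_Suc Suc by (simp add: algebra_simps)
qed simp

lemma geo_Suc': "geo e (Suc n) = 1 + e * geo e n"
  using geo_power[of e n] by (simp add: geo_Suc algebra_simps)

lemma geo_add: "geo e (m + n) = geo e m + e ^ m * geo e n"
  by (induction n) (simp_all add: geo_Suc algebra_simps power_add)

lemma geo_double: "geo e (2 * n) = 2 * geo e n + (e - 1) * (geo e n)\<^sup>2"
proof -
  have "geo e (2 * n) = geo e n + e ^ n * geo e n"
    using geo_add[of e n n] by (simp add: mult_2)
  then show ?thesis unfolding geo_power[of e n] by (simp add: algebra_simps power2_eq_square)
qed

text \<open>The binomial coefficient \<open>i\<close> over 2, on all integers because exponents may
  be negative. It is the coefficient of \<open>c\<close> in \<open>geo (1 + c) i\<close>.\<close>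

definition tri :: "int \<Rightarrow> int" where
  "tri i = i * (i - 1) div 2"

lemma two_tri: "2 * tri i = i * (i - 1)"
proof -
  have "even (i * (i - 1))" by simp
  then show ?thesis unfolding tri_def by simp
qed

lemma triI: "2 * t = i * (i - 1) \<Longrightarrow> tri i = t"
  using two_tri[of i] by linarith

lemma tri_simps [simp]: "tri 0 = 0" "tri 1 = 0"
  by (simp_all add: tri_def)

lemma tri_add: "tri (i + j) = tri i + tri j + i * j"
proof (rule triI)
  show "2 * (tri i + tri j + i * j) = (i + j) * (i + j - 1)"
    using two_tri[of i] two_tri[of j] by (simp add: algebra_simps)
qed

text \<open>The division by 2 costs one factor; for \<open>s = 0\<close> the truncated
  \<open>s - 1\<close> claims divisibility by 1 only.\<close>

lemma dvd_tri: "2 ^ s dvd i \<Longrightarrow> 2 ^ (s - 1) dvd tri i"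
proof (cases s)
  case (Suc r)
  assume "2 ^ s dvd i"
  then obtain k where k: "i = 2 ^ s * k" by blast
  have "tri i = 2 ^ r * k * (i - 1)"
    by (rule triI) (simp add: k Suc)
  then show ?thesis by (simp add: Suc)
qed simp

lemma pow2_dvd_mult:
  assumes "2 ^ a dvd (i::int)" "2 ^ b dvd j" "c \<le> a + b"
  shows "2 ^ c dvd i * j"
  using mult_dvd_mono[OF assms(1,2)] le_imp_power_dvd[OF assms(3), of "2::int"]
  by (metis dvd_trans power_add)

lemma pow2_dvd_weaken: "2 ^ a dvd (i::int) \<Longrightarrow> c \<le> a \<Longrightarrow> 2 ^ c dvd i"
  using le_imp_power_dvd dvd_trans by blast

text \<open>Writing the moduli through \<open>p = 2^(m-1)\<close> removes truncated subtraction and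
  reduces divisibility claims to polynomial identities.\<close>

lemma pow2_split:
  assumes "m \<ge> 2"
  obtains p :: int where "p = 2 ^ (m - 1)" "even p" "2 ^ m = 2 * p" "2 ^ (2 * m - 1) = 2 * p * p"
    "2 ^ (3 * m - 1) = 4 * p * p * p"
proof -
  obtain n where m: "m = Suc (Suc n)" using assms by (metis Suc_le_D numeral_2_eq_2 Suc_le_mono)
  have e: "2 * m - 1 = Suc ((m - 1) + (m - 1))" "3 * m - 1 = Suc (Suc ((m - 1) + (m - 1) + (m - 1)))"
    by (simp_all add: m)
  show thesis
  proof (rule that[OF refl])
    show "(2::int) ^ m = 2 * 2 ^ (m - 1)" by (simp add: m)
    show "(2::int) ^ (2 * m - 1) = 2 * 2 ^ (m - 1) * 2 ^ (m - 1)"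
      unfolding e power_Suc power_add by simp
    show "(2::int) ^ (3 * m - 1) = 4 * 2 ^ (m - 1) * 2 ^ (m - 1) * 2 ^ (m - 1)"
      unfolding e power_Suc power_add by simp
  qed (simp add: m)
qed

lemma power_linear_cong: "c * c dvd (1 + c) ^ n - 1 - int n * (c::int)"
proof (induction n)
  case (Suc k)
  have "(1 + c) ^ Suc k - 1 - int (Suc k) * c = (1 + c) * ((1 + c) ^ k - 1 - int k * c) + c * c * int k"
    by (simp add: algebra_simps)
  then show ?case using Suc by (metis dvd_add dvd_mult dvd_triv_left)
qed simp

text \<open>The expansion of \<open>((1 + c)^n - 1) / c\<close> in binomial coefficients, cut off
  after the linear term in \<open>c\<close>. Induction on \<open>s\<close> through
  \<open>geo_double\<close> keeps the factor \<open>2^s\<close> of \<open>n\<close> in the error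
  without estimating higher binomial coefficients.\<close>

lemma geo_cong:
  assumes m: "m \<ge> 2" and c: "2 ^ m dvd c" and n: "2 ^ s dvd int n"
  shows "2 ^ (2 * m + s - 1) dvd geo (1 + c) n - int n - c * tri (int n)"
  using n
proof (induction s arbitrary: n)
  case 0
  have "c * c dvd geo (1 + c) n - int n - c * tri (int n)"
  proof (induction n)
    case (Suc n)
    have "geo (1 + c) (Suc n) - int (Suc n) - c * tri (int (Suc n))
      = (geo (1 + c) n - int n - c * tri (int n)) + ((1 + c) ^ n - 1 - int n * c)"
      using tri_add[of "int n" 1] by (simp add: geo_Suc algebra_simps)
    moreover have "c * c dvd (1 + c) ^ n - 1 - int n * c" by (rule power_linear_cong)
    ultimately show ?case using Suc by (metis dvd_add)
  qed simp
  moreover have "2 ^ (2 * m - 1) dvd c * c"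
    by (rule pow2_dvd_mult[OF c c]) simp
  ultimately show ?case using dvd_trans by auto
next
  case (Suc s)
  then obtain k where k: "n = 2 * k"
    by (metis dvd_mult_left int_dvd_int_iff of_nat_numeral power_Suc dvd_def)
  have ks: "2 ^ s dvd int k"
    using Suc.prems k by simp
  define E where "E = geo (1 + c) k - int k - c * tri (int k)"
  have E: "2 ^ (2 * m + s - 1) dvd E"
    unfolding E_def by (rule Suc.IH[OF ks])
  \<comment> \<open>\<open>D\<close> is the full deviation of \<open>geo (1 + c) k\<close> from
    \<open>k\<close>. Its divisibility by \<open>2^(m+s-1)\<close> makes the terms
    \<open>2 k c D\<close> and \<open>c D^2\<close> of the doubling formula negligible, so that only
    the doubled error \<open>E\<close> remains.\<close>
  define D where "D = c * tri (int k) + E"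
  have "2 ^ (m + s - 1) dvd c * tri (int k)"
    by (rule pow2_dvd_mult[OF c dvd_tri[OF ks]]) (use m in simp)
  then have D: "2 ^ (m + s - 1) dvd D"
    unfolding D_def using pow2_dvd_weaken[OF E, of "m + s - 1"] by (simp add: dvd_add)
  have T: "geo (1 + c) k = int k + D" unfolding D_def E_def by simp
  have tri: "tri (int n) = int k * (2 * int k - 1)"
    by (rule triI) (simp add: k)
  have h: "2 * D = c * (int k * (int k - 1)) + 2 * E"
    unfolding D_def two_tri[symmetric] by (simp add: algebra_simps)
  have "geo (1 + c) n = 2 * (int k + D) + c * (int k + D)\<^sup>2"
    using geo_double[of "1 + c" k] by (simp add: k T)
  also have "\<dots> = 2 * int k + (c * (int k * (int k - 1)) + 2 * E) + c * (int k + D)\<^sup>2"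
    using h by (simp add: algebra_simps)
  finally have "geo (1 + c) n - int n - c * tri (int n) = 2 * E + (2 * int k) * c * D + c * (D * D)"
    unfolding tri by (simp add: k algebra_simps power2_eq_square)
  moreover have "2 ^ (2 * m + Suc s - 1) dvd 2 * E"
  proof -
    have "2 * m + Suc s - 1 = Suc (2 * m + s - 1)" using m by simp
    then show ?thesis using E by (metis dvd_refl mult_dvd_mono power_Suc)
  qed
  moreover have "2 ^ (2 * m + Suc s - 1) dvd (2 * int k) * c * D"
  proof (rule pow2_dvd_mult[OF _ D])
    have "2 ^ (Suc s) dvd 2 * int k" using ks by simp
    then show "2 ^ (m + Suc s) dvd (2 * int k) * c"
      by (rule pow2_dvd_mult[OF _ c]) simp
  qed (use m in simp)
  moreover have "2 ^ (2 * m + Suc s - 1) dvd c * (D * D)"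
  proof (rule pow2_dvd_mult[OF c])
    show "2 ^ (2 * (m + s - 1)) dvd D * D"
      by (rule pow2_dvd_mult[OF D D]) simp
  qed (use m in simp)
  ultimately show ?case by (simp add: dvd_add)
qed

lemma dvd_geo:
  assumes m: "m \<ge> 2" and c: "2 ^ m dvd c" and n: "2 ^ s dvd int n"
  shows "2 ^ s dvd geo (1 + c) n"
proof -
  have "2 ^ s dvd geo (1 + c) n - int n - c * tri (int n)"
    by (rule pow2_dvd_weaken[OF geo_cong[OF assms]]) (use m in simp)
  moreover have "2 ^ s dvd c * tri (int n)"
    by (rule pow2_dvd_mult[OF c dvd_tri[OF n]]) (use m in simp)
  ultimately show ?thesis using n by (metis dvd_add diff_add_cancel)
qed

lemma odd_pow2_decomp:
  assumes "k \<noteq> (0::int)"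
  obtains r u where "k = 2 ^ r * u" "odd u"
proof -
  obtain u where u: "k = 2 ^ multiplicity 2 k * u" "\<not> 2 dvd u"
    using multiplicity_decompose'[of k 2] assms by auto
  then show ?thesis using that by blast
qed

text \<open>\<open>geo (1 + c) n\<close> has the same 2-adic valuation as \<open>n\<close>: if
  \<open>n = 2^r u\<close> with \<open>u\<close> odd, all corrections are divisible by
  \<open>2^(r+1)\<close>.\<close>

lemma dvd_geoD:
  assumes m: "m \<ge> 2" and c: "2 ^ m dvd c" and s: "2 ^ s dvd geo (1 + c) n"
  shows "2 ^ s dvd int n"
proof (cases "n = 0")
  case False
  then obtain r u where n: "int n = 2 ^ r * u" and u: "odd u"
    by (metis odd_pow2_decomp of_nat_eq_0_iff)
  have nr: "2 ^ r dvd int n" using n by simp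
  have "2 ^ (r + 1) dvd geo (1 + c) n - int n - c * tri (int n)"
    by (rule pow2_dvd_weaken[OF geo_cong[OF m c nr]]) (use m in simp)
  moreover have "2 ^ (r + 1) dvd c * tri (int n)"
    by (rule pow2_dvd_mult[OF c dvd_tri[OF nr]]) (use m in simp)
  ultimately have "2 ^ (r + 1) dvd geo (1 + c) n - int n"
    by (metis dvd_add diff_add_cancel)
  then obtain w where "geo (1 + c) n = int n + 2 ^ (r + 1) * w"
    by (metis dvd_def add.commute diff_add_cancel)
  then have geo: "geo (1 + c) n = 2 ^ r * (u + 2 * w)"
    by (simp add: n algebra_simps)
  have "s \<le> r"
  proof (rule ccontr)
    assume "\<not> s \<le> r"
    then have "2 ^ (r + 1) dvd 2 ^ r * (u + 2 * w)"
      using pow2_dvd_weaken[OF s, of "r + 1"] geo by simp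
    then show False using u by simp
  qed
  then show ?thesis using pow2_dvd_weaken[OF nr] by blast
qed simp

lemma odd_inverse_mod_pow2:
  assumes "odd (u::int)"
  obtains r where "2 ^ s dvd u * r - 1"
proof -
  have "coprime u (2 ^ s)" using assms by simp
  then obtain r where "[u * r = 1] (mod 2 ^ s)"
    using cong_solve_coprime_int by blast
  then show thesis using that by (simp add: cong_iff_dvd_diff)
qed

section \<open>Moving powers past each other in an arbitrary group\<close>

context group
begin

lemma int_pow_cong:
  assumes "x \<in> carrier G" "x [^] (N::int) = \<one>" "N dvd i - j"
  shows "x [^] i = x [^] j"
proof -
  obtain k where k: "i = j + N * k" using assms(3) by (metis dvd_def add.commute diff_add_cancel)
  show ?thesis
    using assms(1,2) by (simp add: k int_pow_mult flip: int_pow_pow)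
qed

lemma mult_nat_pow_left_commute:
  assumes "a \<in> carrier G" "b \<in> carrier G"
  shows "a \<otimes> (a [^] (n::nat) \<otimes> b) = a [^] n \<otimes> (a \<otimes> b)"
  using assms by (simp add: nat_pow_Suc2[symmetric] m_assoc[symmetric])

lemma int_pow_comm_add:
  assumes "x \<in> carrier G"
  shows "x [^] (i::int) \<otimes> x [^] (j::int) = x [^] j \<otimes> x [^] i"
  using assms by (simp add: add.commute flip: int_pow_mult)

lemma swap_int_pow:
  assumes "a \<in> carrier G" "b \<in> carrier G" "c \<in> carrier G" "a \<otimes> b = b \<otimes> c"
  shows "a [^] (i::int) \<otimes> b = b \<otimes> c [^] i"
proof -
  have nat: "a [^] (n::nat) \<otimes> b = b \<otimes> c [^] n" for n
  proof (induction n)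
    case (Suc n)
    have "a [^] Suc n \<otimes> b = a [^] n \<otimes> (a \<otimes> b)" using assms by (simp add: m_assoc)
    also have "\<dots> = (a [^] n \<otimes> b) \<otimes> c" using assms by (simp add: m_assoc)
    also have "\<dots> = b \<otimes> c [^] Suc n" using assms Suc by (simp add: m_assoc)
    finally show ?case .
  qed (use assms in simp)
  show ?thesis
  proof (cases i rule: int_cases2)
    case (nonneg n)
    then show ?thesis using nat by (simp add: int_pow_int)
  next
    case (nonpos n)
    have "a [^] n \<otimes> (b \<otimes> inv (c [^] n)) = (a [^] n \<otimes> b) \<otimes> inv (c [^] n)"
      using assms by (simp add: m_assoc)
    also have "\<dots> = b" unfolding nat using assms by (simp add: m_assoc)
    finally have "b \<otimes> inv (c [^] n) = inv (a [^] n) \<otimes> b"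
      using assms by (metis inv_closed inv_solve_left m_closed nat_pow_closed)
    then show ?thesis using assms by (simp add: nonpos int_pow_neg int_pow_int)
  qed
qed

lemma swap_pow:
  assumes "a \<in> carrier G" "b \<in> carrier G" "a \<otimes> b = b \<otimes> a [^] (e::int)"
  shows "a [^] (i::int) \<otimes> b [^] (k::nat) = b [^] k \<otimes> a [^] (i * e ^ k)"
proof (induction k arbitrary: i)
  case (Suc k)
  have "a [^] i \<otimes> b [^] Suc k = (a [^] i \<otimes> b [^] k) \<otimes> b" using assms by (simp add: m_assoc)
  also have "\<dots> = b [^] k \<otimes> (a [^] (i * e ^ k) \<otimes> b)" using assms Suc by (simp add: m_assoc)
  also have "a [^] (i * e ^ k) \<otimes> b = b \<otimes> (a [^] e) [^] (i * e ^ k)"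
    by (rule swap_int_pow) (use assms in auto)
  also have "b [^] k \<otimes> (b \<otimes> (a [^] e) [^] (i * e ^ k)) = b [^] Suc k \<otimes> a [^] (i * e ^ Suc k)"
    using assms by (simp add: int_pow_pow m_assoc mult_ac)
  finally show ?case .
qed (use assms in simp)

lemma swap_pow_left:
  assumes "a \<in> carrier G" "b \<in> carrier G" "b \<otimes> a = a [^] (e::int) \<otimes> b"
  shows "b [^] (k::nat) \<otimes> a [^] (i::int) = a [^] (i * e ^ k) \<otimes> b [^] k"
proof (induction k arbitrary: i)
  case (Suc k)
  have "b [^] Suc k \<otimes> a [^] i = b [^] k \<otimes> (b \<otimes> a [^] i)" using assms by (simp add: m_assoc)
  also have "b \<otimes> a [^] i = (a [^] e) [^] i \<otimes> b"
    using swap_int_pow[of "a [^] e" b a i] assms by simp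
  also have "b [^] k \<otimes> ((a [^] e) [^] i \<otimes> b) = (b [^] k \<otimes> a [^] (e * i)) \<otimes> b"
    using assms by (simp add: int_pow_pow m_assoc)
  also have "\<dots> = a [^] (i * e ^ Suc k) \<otimes> b [^] Suc k"
    using assms Suc by (simp add: m_assoc mult_ac)
  finally show ?case .
qed (use assms in simp)

text \<open>When the \<open>b\<close>s are collected on the right, the \<open>i\<close>-th
  \<open>a\<close>, counted from 0, is passed by \<open>i\<close> copies of \<open>b\<close> and
  becomes \<open>a^(e^i)\<close>. This is where geometric sums enter.\<close>

lemma mult_pow_geo:
  assumes "a \<in> carrier G" "b \<in> carrier G" "b \<otimes> a = a [^] (e::int) \<otimes> b"
  shows "(a \<otimes> b) [^] (n::nat) = a [^] geo e n \<otimes> b [^] n"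
proof (induction n)
  case (Suc n)
  have "(a \<otimes> b) [^] Suc n = (a [^] geo e n \<otimes> b [^] n) \<otimes> (a \<otimes> b)" using Suc by simp
  also have "\<dots> = a [^] geo e n \<otimes> (b [^] n \<otimes> a [^] (1::int)) \<otimes> b"
    using assms by (simp add: m_assoc)
  also have "b [^] n \<otimes> a [^] (1::int) = a [^] (1 * e ^ n) \<otimes> b [^] n"
    by (rule swap_pow_left[OF assms])
  also have "a [^] geo e n \<otimes> (a [^] (1 * e ^ n) \<otimes> b [^] n) \<otimes> b
      = a [^] geo e (Suc n) \<otimes> b [^] Suc n"
    using assms by (simp add: geo_Suc int_pow_mult m_assoc)
  finally show ?case .
qed (use assms in simp)

end

section \<open>Consequences of the Macdonald relations\<close>

text \<open>Here \<open>M\<close> annihilates \<open>x\<close> and \<open>y\<close>, and \<open>g\<close> inverts \<open>\<alpha>\<close> modulo \<open>M\<close>.\<close>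

locale macdonald_pair = group G for G (structure) +
  fixes x y :: 'a and \<alpha> g M :: int
  assumes x [simp]: "x \<in> carrier G" and y [simp]: "y \<in> carrier G"
    and conj_x: "conjugate G x (commutator G x y) = x [^] \<alpha>"
    and conj_y: "conjugate G y (commutator G y x) = y [^] \<alpha>"
    and pow_x: "x [^] M = \<one>" and pow_y: "y [^] M = \<one>"
    and g: "M dvd g * \<alpha> - 1"
begin

definition z :: 'a where "z = commutator G x y"

lemma z [simp]: "z \<in> carrier G"
  by (simp add: z_def commutator_def)

lemma xy: "x \<otimes> y = y \<otimes> x \<otimes> z"
  by (simp add: z_def commutator_def m_assoc[symmetric])
    (simp add: m_assoc)

lemma commutator_yx: "commutator G y x = inv z"
  by (simp add: z_def commutator_def inv_mult_group m_assoc)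

lemma x_z: "x \<otimes> z = z \<otimes> x [^] \<alpha>"
proof -
  have "inv z \<otimes> x \<otimes> z = x [^] \<alpha>"
    using conj_x by (simp add: conjugate_def z_def)
  then have "z \<otimes> (inv z \<otimes> x \<otimes> z) = z \<otimes> x [^] \<alpha>" by simp
  then show ?thesis by (simp add: m_assoc[symmetric])
qed

lemma z_y: "z \<otimes> y = y [^] \<alpha> \<otimes> z"
proof -
  have "z \<otimes> y \<otimes> inv z = y [^] \<alpha>"
    using conj_y by (simp add: conjugate_def commutator_yx)
  then have "(z \<otimes> y \<otimes> inv z) \<otimes> z = y [^] \<alpha> \<otimes> z" by simp
  then show ?thesis by (simp add: m_assoc)
qed

lemma g': "M dvd \<alpha> * g - 1"
  using g by (simp add: mult.commute)

lemma zx: "z \<otimes> x = x [^] g \<otimes> z"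
proof -
  have "x [^] g \<otimes> z = z \<otimes> (x [^] \<alpha>) [^] g"
    by (rule swap_int_pow) (simp_all add: x_z)
  also have "(x [^] \<alpha>) [^] g = x [^] (1::int)"
    by (simp add: int_pow_pow del: int_pow_1) (rule int_pow_cong[OF x pow_x g'])
  finally show ?thesis by simp
qed

lemma yz: "y \<otimes> z = z \<otimes> y [^] g"
proof -
  have "(y [^] \<alpha>) [^] g \<otimes> z = z \<otimes> y [^] g"
    by (rule swap_int_pow) (simp_all add: z_y)
  moreover have "(y [^] \<alpha>) [^] g = y [^] (1::int)"
    by (simp add: int_pow_pow del: int_pow_1) (rule int_pow_cong[OF y pow_y g'])
  ultimately show ?thesis by simp
qed

lemma xz_pow: "(x \<otimes> z) [^] (n::nat) = x [^] geo g n \<otimes> z [^] n"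
  by (rule mult_pow_geo) (simp_all add: zx)

lemma yz_pow: "(y \<otimes> inv z) [^] (n::nat) = y [^] geo g n \<otimes> inv z [^] n"
proof (rule mult_pow_geo)
  have "inv z \<otimes> y = inv z \<otimes> (y \<otimes> z) \<otimes> inv z" by (simp add: m_assoc)
  also have "\<dots> = y [^] g \<otimes> inv z" unfolding yz by (simp add: m_assoc[symmetric])
  finally show "inv z \<otimes> y = y [^] g \<otimes> inv z" .
qed simp_all

lemma yx: "y \<otimes> x = x \<otimes> (y \<otimes> inv z)"
  using xy by (metis inv_closed inv_solve_right m_assoc m_closed x y z)

text \<open>Conjugation by \<open>x\<close> takes \<open>y\<close> to \<open>y z^-1\<close>, hence
  \<open>y^n\<close> to \<open>(y z^-1)^n\<close>, which \<open>yz_pow\<close> collects.\<close>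

lemma y_pow_x: "y [^] (n::nat) \<otimes> x = x \<otimes> y [^] geo g n \<otimes> inv (z [^] n)"
proof -
  have "y [^] int n \<otimes> x = x \<otimes> (y \<otimes> inv z) [^] int n"
    by (rule swap_int_pow) (simp_all add: yx)
  then show ?thesis by (simp add: int_pow_int yz_pow nat_pow_inv m_assoc)
qed

lemma x_pow_y: "x [^] (n::nat) \<otimes> y = y \<otimes> x [^] geo g n \<otimes> z [^] n"
proof -
  have "x [^] int n \<otimes> y = y \<otimes> (x \<otimes> z) [^] int n"
    by (rule swap_int_pow) (simp_all add: xy m_assoc)
  then show ?thesis by (simp add: int_pow_int xz_pow m_assoc)
qed

end

text \<open>Positivity of \<open>l\<close> makes \<alpha> a natural number, called \<open>a\<close>
  below, so that it can be the number of terms in \<open>geo\<close>. Since only \<alpha> modulo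
  \<open>2^(3m-1)\<close> is visible in the group, a positive representative of \<open>l\<close> can
  always be chosen.\<close>

locale macdonald = macdonald_pair G x y "1 + 2 ^ m * l" g "2 ^ (3 * m - 1)"
  for G (structure) and x y :: 'a and m :: nat and l g :: int +
  assumes m: "m \<ge> 2" and l: "odd l" and l_pos: "l > 0"
begin

definition q :: int where "q = 2 ^ m * l"

lemma q_dvd: "2 ^ m dvd q"
  by (simp add: q_def)

lemma xz: "x \<otimes> z = z \<otimes> x [^] (1 + q)"
  using x_z by (simp add: q_def)

lemma zy: "z \<otimes> y = y [^] (1 + q) \<otimes> z"
  using z_y by (simp add: q_def)

lemma g_dvd: "2 ^ (3 * m - 1) dvd (1 + q) * g - 1"
  using g' by (simp add: q_def)

lemma gm: "2 ^ m dvd g - 1"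
proof -
  have "2 ^ m dvd (1 + q) * g - 1"
    by (rule pow2_dvd_weaken[OF g_dvd]) (use m in simp)
  moreover have "2 ^ m dvd q * g" using q_dvd by simp
  moreover have "g - 1 = (1 + q) * g - 1 - q * g" by (simp add: algebra_simps)
  ultimately show ?thesis by (metis dvd_diff)
qed

definition a :: nat where "a = nat (1 + q)"

lemma a: "int a = 1 + q"
  unfolding a_def using l_pos by (simp add: q_def)

text \<open>The word \<open>x z y\<close> equals both \<open>z x^a y\<close> and
  \<open>x y^a z\<close>. Both normalise to words with left factor \<open>z y\<close> and right
  factor \<open>z^a\<close>; cancelling these leaves a relation between a power of \<open>x\<close>
  and a power of \<open>y\<close>.\<close>

lemma xy_power_relation: "x [^] (geo g a - a) = y [^] ((1 + q) ^ a * (g * (a - geo g a)))"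
proof -
  let ?T = "geo g a"
  \<comment> \<open>Passing \<open>x\<close> through \<open>y^a\<close> changes the exponent of
    \<open>y\<close> to \<open>?T\<close>; the last factor makes up the difference.\<close>
  have ya: "x \<otimes> y [^] a = y [^] a \<otimes> x \<otimes> z [^] a \<otimes> y [^] (int a - ?T)"
  proof -
    have "y [^] a \<otimes> x \<otimes> z [^] a = x \<otimes> y [^] ?T"
      by (simp add: y_pow_x m_assoc)
    then have "y [^] a \<otimes> x \<otimes> z [^] a \<otimes> y [^] (int a - ?T) = x \<otimes> (y [^] ?T \<otimes> y [^] (int a - ?T))"
      by (simp add: m_assoc)
    also have "y [^] ?T \<otimes> y [^] (int a - ?T) = y [^] a"
      by (simp flip: int_pow_mult int_pow_int)
    finally show ?thesis by simp
  qed
  have zy': "z \<otimes> y = y [^] a \<otimes> z" using zy by (simp flip: a add: int_pow_int)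
  have xz': "x \<otimes> z = z \<otimes> x [^] a" using xz by (simp flip: a add: int_pow_int)
  have "z \<otimes> (y \<otimes> (x [^] ?T \<otimes> z [^] a)) = z \<otimes> (x [^] a \<otimes> y)"
    by (simp add: x_pow_y m_assoc)
  also have "\<dots> = x \<otimes> (z \<otimes> y)"
    by (simp add: m_assoc[symmetric] xz')
  also have "\<dots> = (x \<otimes> y [^] a) \<otimes> z"
    by (simp add: m_assoc zy')
  also have "\<dots> = y [^] a \<otimes> x \<otimes> z [^] a \<otimes> (y [^] (int a - ?T) \<otimes> z)"
    by (simp add: ya m_assoc)
  also have "y [^] (int a - ?T) \<otimes> z = z \<otimes> y [^] (g * (int a - ?T))"
    using swap_pow[of y z g "int a - ?T" 1] by (simp add: yz mult.commute)
  also have "y [^] a \<otimes> x \<otimes> z [^] a \<otimes> (z \<otimes> y [^] (g * (int a - ?T)))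
      = y [^] a \<otimes> x \<otimes> (z [^] a \<otimes> z) \<otimes> y [^] (g * (int a - ?T))"
    by (simp add: m_assoc)
  also have "z [^] a \<otimes> z = z \<otimes> z [^] a"
    by (metis nat_pow_Suc nat_pow_Suc2 z)
  also have "y [^] a \<otimes> x \<otimes> (z \<otimes> z [^] a) \<otimes> y [^] (g * (int a - ?T))
      = y [^] a \<otimes> (x \<otimes> z) \<otimes> (z [^] a \<otimes> y [^] (g * (int a - ?T)))"
    by (simp add: m_assoc)
  also have "y [^] a \<otimes> (x \<otimes> z) = z \<otimes> y \<otimes> x [^] a"
    by (simp add: xz' zy' m_assoc[symmetric])
  also have "z [^] a \<otimes> y [^] (g * (int a - ?T))
      = y [^] (g * (int a - ?T) * (1 + q) ^ a) \<otimes> z [^] a"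
    by (rule swap_pow_left) (simp_all add: zy)
  finally have "x [^] ?T \<otimes> z [^] a = x [^] a \<otimes> y [^] (g * (int a - ?T) * (1 + q) ^ a) \<otimes> z [^] a"
    by (simp add: m_assoc)
  then have "x [^] ?T = x [^] a \<otimes> y [^] (g * (int a - ?T) * (1 + q) ^ a)"
    by simp
  then have "inv (x [^] a) \<otimes> x [^] ?T = y [^] (g * (int a - ?T) * (1 + q) ^ a)"
    by (simp add: m_assoc[symmetric])
  moreover have "x [^] (?T - int a) = inv (x [^] a) \<otimes> x [^] ?T"
    using int_pow_mult[OF x, of "- int a" ?T] by (simp add: int_pow_neg_int)
  ultimately show ?thesis by (simp add: mult_ac)
qed

lemma g_odd: "odd g"
proof -
  have "even (g - 1)" using pow2_dvd_weaken[OF gm, of 1] m by simp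
  then show ?thesis by simp
qed

text \<open>Modulo \<open>2^(3m-1)\<close> the difference is \<open>- q^2 g - q tri(q) g^2\<close>,
  because \<open>g - 1 = - q g\<close> there. The first term has valuation \<open>2m\<close>, while
  \<open>q tri(q) = q^2 (q - 1) / 2\<close> has valuation exactly \<open>2m - 1\<close>.\<close>

lemma geo_diff: "\<exists>u. odd u \<and> geo g a - a = 2 ^ (2 * m - 1) * u"
proof -
  define Q where "Q = (2::int) ^ (3 * m - 1)"
  have a': "a = Suc (nat q)" "int (nat q) = q"
    using l_pos by (simp_all add: a_def q_def nat_add_distrib)
  have "2 ^ (2 * m + m - 1) dvd geo (1 + (g - 1)) (nat q) - int (nat q) - (g - 1) * tri (int (nat q))"
    by (rule geo_cong[OF m gm]) (simp add: a' q_dvd)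
  moreover have "2 * m + m - 1 = 3 * m - 1" by simp
  ultimately have "Q dvd geo g (nat q) - q - (g - 1) * tri q" 
    by (simp only: Q_def a'(2) add_diff_cancel_left' diff_add_cancel add.commute[of 1])
  then obtain E where E: "geo g (nat q) = q + (g - 1) * tri q + Q * E"
    unfolding dvd_def by (metis add.commute diff_add_cancel diff_diff_eq2 diff_diff_eq)
  obtain F where F: "(1 + q) * g - 1 = Q * F" using g_dvd unfolding Q_def by blast
  have "geo g a - int a = (g - 1) * q + g * (g - 1) * tri q + g * Q * E"
    using l_pos by (simp only: a'(1) geo_Suc' E) (simp add: q_def algebra_simps)
  also have "g - 1 = Q * F - q * g" using F by (simp add: algebra_simps)
  finally have 1: "geo g a - int a = - (q * q * g) - q * tri q * (g * g) + Q * (F * q + g * F * tri q + g * E)"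
    by (simp add: algebra_simps)
  obtain p :: int where p: "even p" and pm: "2 ^ m = 2 * p" and Np: "2 ^ (2 * m - 1) = 2 * p * p"
    and Q: "2 ^ (3 * m - 1) = 4 * p * p * p"
    by (rule pow2_split[OF m])
  from pm Q have qp: "q = 2 * (p * l)" and Qp: "Q = (2 * p * p) * (2 * p)" by (simp_all add: q_def Q_def)
  have tp: "tri q = p * l * (q - 1)"
    by (rule triI) (simp only: qp mult.assoc)
  have qt: "q * tri q = (2 * p * p) * (l * l * (q - 1))"
    unfolding tp by (subst qp) (simp only: mult_ac)
  have qq: "q * q = (2 * p * p) * (2 * l * l)"
    unfolding qp by (simp only: mult_ac)
  have "geo g a - int a = (2 * p * p) *
     (- (2 * l * l * g) - l * l * (q - 1) * (g * g) + 2 * p * (F * q + g * F * tri q + g * E))"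
    unfolding 1 qt qq Qp by (simp add: algebra_simps)
  moreover have "odd (- (2 * l * l * g) - l * l * (q - 1) * (g * g) + 2 * p * (F * q + g * F * tri q + g * E))"
    using l g_odd p by (simp add: qp)
  ultimately show ?thesis unfolding Np by blast
qed

section \<open>The powers \<open>x^N\<close>, \<open>y^N\<close>, \<open>z^N\<close> and the normal
  form\<close>

definition N :: int where "N = 2 ^ (2 * m - 1)"

lemma N_mult: "N * 2 ^ m = 2 ^ (3 * m - 1)"
proof -
  have "2 * m - 1 + m = 3 * m - 1" using m by simp
  then show ?thesis by (simp add: N_def flip: power_add)
qed

lemma pow_x_N: "2 ^ m dvd i - j \<Longrightarrow> x [^] (N * i) = x [^] (N * j)"
  by (rule int_pow_cong[OF x pow_x])
    (simp only: N_mult[symmetric] right_diff_distrib[symmetric] mult_dvd_mono dvd_refl)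

lemma pow_y_N: "2 ^ m dvd i - j \<Longrightarrow> y [^] (N * i) = y [^] (N * j)"
  by (rule int_pow_cong[OF y pow_y])
    (simp only: N_mult[symmetric] right_diff_distrib[symmetric] mult_dvd_mono dvd_refl)

text \<open>Both exponents in \<open>xy_power_relation\<close> are odd multiples of
  \<open>N\<close>. As \<open>x^N\<close> and \<open>y^N\<close> have order dividing
  \<open>2^m\<close>, the odd factors can be inverted. Each of the two powers therefore commutes
  with both generators.\<close>

lemma x_y_pow_N:
  obtains r s where "x [^] N = y [^] (N * r)" "y [^] N = x [^] (N * s)"
proof -
  obtain u where u: "odd u" "geo g a - a = N * u" using geo_diff unfolding N_def by blast
  define v where "v = - ((1 + q) ^ a * g * u)"
  have "odd v" using u g_odd m by (simp add: v_def q_def)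
  have v: "(1 + q) ^ a * (g * (a - geo g a)) = N * v"
    using u(2) unfolding v_def by (metis mult.assoc mult.left_commute minus_diff_eq mult_minus_right)
  have uv: "x [^] (N * u) = y [^] (N * v)"
    using xy_power_relation by (simp add: u(2) v)
  obtain r where r: "2 ^ m dvd u * r - 1" using odd_inverse_mod_pow2[OF u(1)] .
  obtain s where s: "2 ^ m dvd v * s - 1" using odd_inverse_mod_pow2[OF \<open>odd v\<close>] .
  have "x [^] (N * 1) = x [^] (N * (u * r))"
    by (rule pow_x_N[symmetric, OF r])
  also have "\<dots> = y [^] (N * (v * r))"
    using uv by (simp flip: int_pow_pow mult.assoc)
  finally have 1: "x [^] N = y [^] (N * (v * r))" by simp
  have "y [^] (N * 1) = y [^] (N * (v * s))"
    by (rule pow_y_N[symmetric, OF s])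
  also have "\<dots> = x [^] (N * (u * s))"
    using uv by (simp flip: int_pow_pow mult.assoc)
  finally have 2: "y [^] N = x [^] (N * (u * s))" by simp
  show thesis by (rule that[OF 1 2])
qed

lemma y_pow_N_x: "y [^] N \<otimes> x = x \<otimes> y [^] N"
proof -
  obtain s where "y [^] N = x [^] (N * s)" by (rule x_y_pow_N)
  then show ?thesis using int_pow_comm_add[OF x, of "N * s" 1] by simp
qed

lemma x_pow_N_y: "x [^] N \<otimes> y = y \<otimes> x [^] N"
proof -
  obtain r where "x [^] N = y [^] (N * r)" by (rule x_y_pow_N)
  then show ?thesis using int_pow_comm_add[OF y, of "N * r" 1] by simp
qed

text \<open>Since \<open>y^N\<close> commutes with \<open>x\<close>, \<open>y_pow_x\<close> at
  \<open>n = N\<close> becomes an equation for \<open>z^N\<close> in terms of \<open>y\<close>, and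
  \<open>dvd_geo\<close> makes the exponent a multiple of \<open>N\<close>.\<close>

lemma z_pow_N: obtains r where "z [^] N = x [^] (N * r)"
proof -
  define n :: nat where "n = 2 ^ (2 * m - 1)"
  have n: "int n = N" by (simp add: n_def N_def)
  have "x \<otimes> y [^] n = x \<otimes> (y [^] geo g n \<otimes> inv (z [^] n))"
    using y_pow_x[of n] y_pow_N_x by (simp add: m_assoc flip: int_pow_int n)
  then have "y [^] n = y [^] geo g n \<otimes> inv (z [^] n)" by simp
  then have "y [^] n \<otimes> z [^] n = y [^] geo g n" by (simp add: m_assoc)
  then have "z [^] n = inv (y [^] n) \<otimes> y [^] geo g n"
    by (metis inv_solve_left int_pow_closed nat_pow_closed y z)
  then have zn: "z [^] N = y [^] (geo g n - N)"
    using int_pow_mult[OF y, of "- int n" "geo g n"] by (simp add: int_pow_neg_int int_pow_int flip: n)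
  have "2 ^ (2 * m - 1) dvd geo (1 + (g - 1)) n"
    by (rule dvd_geo[OF m gm]) (simp add: n_def)
  then obtain t where "geo g n - N = N * t"
    by (simp add: N_def) (metis dvd_def dvd_diff dvd_refl)
  moreover obtain s where "y [^] N = x [^] (N * s)" by (rule x_y_pow_N)
  ultimately have "z [^] N = x [^] (N * (s * t))"
    by (simp add: zn mult.assoc flip: int_pow_pow)
  then show ?thesis by (rule that)
qed

lemma pow_z: "z [^] ((2::int) ^ (3 * m - 1)) = \<one>"
proof -
  obtain r where r: "z [^] N = x [^] (N * r)" by (rule z_pow_N)
  have "z [^] (N * 2 ^ m) = x [^] (N * r * 2 ^ m)"
    using r by (metis int_pow_pow x z)
  also have "N * r * 2 ^ m = 2 ^ (3 * m - 1) * r"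
    unfolding N_mult[symmetric] by (simp only: mult_ac)
  also have "x [^] (2 ^ (3 * m - 1) * r) = (x [^] ((2::int) ^ (3 * m - 1))) [^] r"
    by (simp add: int_pow_pow)
  finally show ?thesis unfolding pow_x N_mult by simp
qed

lemma int_pow_eq_nat_pow:
  assumes "b \<in> carrier G" "b [^] ((2::int) ^ (3 * m - 1)) = \<one>"
  obtains n :: nat where "b [^] (i::int) = b [^] n"
proof -
  define n where "n = nat (i mod 2 ^ (3 * m - 1))"
  have "int n = i mod 2 ^ (3 * m - 1)" by (simp add: n_def)
  then have "(2::int) ^ (3 * m - 1) dvd i - int n"
    by (simp add: mod_eq_dvd_iff[symmetric])
  then have "b [^] i = b [^] n"
    using int_pow_cong[OF assms] by (simp flip: int_pow_int)
  then show thesis by (rule that)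
qed

end

text \<open>Generation is phrased as an induction over right multiplication by \<open>x\<close> and
  \<open>y\<close>; inverses are covered because both generators have finite order.\<close>

locale macdonald_generated = macdonald +
  assumes generated: "\<And>S. \<one> \<in> S \<Longrightarrow> (\<And>h. h \<in> S \<Longrightarrow> h \<in> carrier G \<Longrightarrow> h \<otimes> x \<in> S \<and> h \<otimes> y \<in> S) \<Longrightarrow>
    carrier G \<subseteq> S"
begin

lemma normal_form:
  assumes "h \<in> carrier G"
  obtains i j k :: nat where "h = x [^] i \<otimes> y [^] j \<otimes> z [^] k"
proof -
  \<comment> \<open>The order \<open>x\<close>, \<open>z\<close>, \<open>y\<close> makes right
    multiplication by \<open>y\<close> immediate, and a new \<open>x\<close> only has to pass
    \<open>y\<close> and then \<open>z\<close>. The order \<open>x\<close>, \<open>y\<close>,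
    \<open>z\<close> is restored at the end.\<close>
  define S where "S = {x [^] i \<otimes> z [^] k \<otimes> y [^] j | (i::nat) (k::nat) (j::nat). True}"
  have "carrier G \<subseteq> S"
  proof (rule generated)
    have "\<one> = x [^] (0::nat) \<otimes> z [^] (0::nat) \<otimes> y [^] (0::nat)" by simp
    then show "\<one> \<in> S" unfolding S_def by blast
  next
    fix h assume "h \<in> S"
    then obtain i k j :: nat where h: "h = x [^] i \<otimes> z [^] k \<otimes> y [^] j"
      unfolding S_def by blast
    have "h \<otimes> y = x [^] i \<otimes> z [^] k \<otimes> y [^] Suc j" by (simp add: h m_assoc)
    then have "h \<otimes> y \<in> S" unfolding S_def by blast
    obtain p :: nat where p: "z [^] (- int j) = z [^] p" by (rule int_pow_eq_nat_pow[OF z pow_z])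
    obtain i' :: nat where i': "x [^] (int i + g ^ k) = x [^] i'"
      by (rule int_pow_eq_nat_pow[OF x pow_x])
    obtain j' :: nat where j': "y [^] (geo g j * g ^ p) = y [^] j'"
      by (rule int_pow_eq_nat_pow[OF y pow_y])
    have "h \<otimes> x = x [^] i \<otimes> z [^] k \<otimes> (y [^] j \<otimes> x)" by (simp add: h m_assoc)
    also have "y [^] j \<otimes> x = x \<otimes> (y [^] geo g j \<otimes> z [^] p)"
      by (simp add: y_pow_x m_assoc flip: p) (simp add: int_pow_neg int_pow_int)
    also have "y [^] geo g j \<otimes> z [^] p = z [^] p \<otimes> y [^] (geo g j * g ^ p)"
      by (rule swap_pow) (simp_all add: yz)
    also have "x [^] i \<otimes> z [^] k \<otimes> (x \<otimes> (z [^] p \<otimes> y [^] (geo g j * g ^ p)))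
        = x [^] i \<otimes> (z [^] k \<otimes> x [^] (1::int)) \<otimes> z [^] p \<otimes> y [^] j'"
      by (simp add: m_assoc j')
    also have "z [^] k \<otimes> x [^] (1::int) = x [^] (1 * g ^ k) \<otimes> z [^] k"
      by (rule swap_pow_left) (simp_all add: zx)
    also have "x [^] i \<otimes> (x [^] (1 * g ^ k) \<otimes> z [^] k) \<otimes> z [^] p \<otimes> y [^] j'
      = x [^] (int i + g ^ k) \<otimes> (z [^] k \<otimes> z [^] p) \<otimes> y [^] j'"
      by (simp add: int_pow_mult int_pow_int m_assoc)
    finally have "h \<otimes> x = x [^] i' \<otimes> z [^] (k + p) \<otimes> y [^] j'" by (simp add: i' nat_pow_mult)
    then have "h \<otimes> x \<in> S" unfolding S_def by blast
    with \<open>h \<otimes> y \<in> S\<close> show "h \<otimes> x \<in> S \<and> h \<otimes> y \<in> S" by simp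
  qed
  then obtain i k j :: nat where h: "h = x [^] i \<otimes> z [^] k \<otimes> y [^] j"
    using assms unfolding S_def by blast
  obtain j' :: nat where j': "y [^] (int j * (1 + q) ^ k) = y [^] j'"
    by (rule int_pow_eq_nat_pow[OF y pow_y])
  have "z [^] k \<otimes> y [^] int j = y [^] (int j * (1 + q) ^ k) \<otimes> z [^] k"
    by (rule swap_pow_left) (simp_all add: zy)
  then have "h = x [^] i \<otimes> y [^] j' \<otimes> z [^] k"
    by (simp add: h m_assoc int_pow_int j')
  then show thesis by (rule that)
qed

lemma centerI:
  assumes "w \<in> carrier G" "w \<otimes> x = x \<otimes> w" "w \<otimes> y = y \<otimes> w"
  shows "w \<in> center G"
proof -
  have "carrier G \<subseteq> {h \<in> carrier G. w \<otimes> h = h \<otimes> w}"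
  proof (rule generated)
    fix h assume h: "h \<in> {h \<in> carrier G. w \<otimes> h = h \<otimes> w}"
    then have "w \<otimes> (h \<otimes> b) = h \<otimes> b \<otimes> w" if "b \<in> {x, y}" for b
      using assms that by (auto simp: m_assoc) (simp_all add: assms m_assoc flip: m_assoc[of w h])
    then show "h \<otimes> x \<in> {h \<in> carrier G. w \<otimes> h = h \<otimes> w} \<and> h \<otimes> y \<in> {h \<in> carrier G. w \<otimes> h = h \<otimes> w}"
      using h by simp
  qed (use assms in simp)
  then show ?thesis using assms(1) by (auto simp: center_def)
qed

lemma x_pow_N_center: "x [^] (N * i) \<in> center G"
proof -
  have "x [^] N \<in> center G"
    by (rule centerI) (use int_pow_comm_add[OF x, of N 1] in \<open>simp_all add: x_pow_N_y\<close>)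
  then show ?thesis
    using group.subgroup_int_pow_closed[OF is_group normal_imp_subgroup[OF center_normal]]
    by (simp flip: int_pow_pow)
qed

lemma center_commute: "w \<in> center G \<Longrightarrow> h \<in> carrier G \<Longrightarrow> w \<otimes> h = h \<otimes> w"
  by (simp add: center_def)

text \<open>\<open>U1\<close> and \<open>U2\<close> are the lower bounds that only a model can
  provide. Commuting with \<open>x\<close> gives an equation whose \<open>z\<close> exponent is
  \<open>j\<close>, commuting with \<open>y\<close> one whose \<open>z\<close> exponent is
  \<open>i\<close>, so \<open>U1\<close> makes both multiples of \<open>N\<close>. Then
  \<open>w\<close> is a power of \<open>x^N\<close> times \<open>z^k\<close>; commuting with
  \<open>x\<close> once more means \<open>x^(g^k) = x\<close>, and \<open>U2\<close> bounds
  \<open>k\<close>.\<close>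

theorem center_eq:
  assumes U1: "\<And>i j k :: int. x [^] i \<otimes> y [^] j \<otimes> z [^] k = \<one> \<Longrightarrow> N dvd i \<and> N dvd j \<and> N dvd k"
    and U2: "\<And>i :: int. x [^] i = \<one> \<Longrightarrow> 2 ^ (3 * m - 1) dvd i"
  shows "center G = {x [^] (N * i) | i. True}"
proof (intro equalityI subsetI)
  fix w assume w: "w \<in> center G"
  then have wc: "w \<in> carrier G" by (simp add: center_def)
  obtain i j k :: nat where w_eq: "w = x [^] i \<otimes> y [^] j \<otimes> z [^] k"
    using normal_form[OF wc] .
  have zk_x: "z [^] k \<otimes> x = x [^] (g ^ k) \<otimes> z [^] k"
    using swap_pow_left[of x z g k 1] by (simp add: zx)
  have zk_y: "z [^] k \<otimes> y = y [^] ((1 + q) ^ k) \<otimes> z [^] k"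
    using swap_pow_left[of y z "1 + q" k 1] by (simp add: zy)
  have "N dvd int j"
  proof -
    have "x [^] i \<otimes> (y [^] j \<otimes> (z [^] k \<otimes> x)) = w \<otimes> x"
      by (simp add: w_eq m_assoc)
    also have "\<dots> = x \<otimes> w" by (rule center_commute[OF w x])
    also have "\<dots> = x [^] i \<otimes> (x \<otimes> (y [^] j \<otimes> z [^] k))"
      by (simp add: w_eq m_assoc mult_nat_pow_left_commute)
    finally have "y [^] j \<otimes> (z [^] k \<otimes> x) = x \<otimes> (y [^] j \<otimes> z [^] k)" by simp
    then have "(y [^] j \<otimes> x [^] (g ^ k)) \<otimes> z [^] k = (x \<otimes> y [^] j) \<otimes> z [^] k"
      by (simp add: zk_x m_assoc)
    then have "x \<otimes> y [^] j = y [^] j \<otimes> x [^] (1 + (g ^ k - 1))" by simp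
    also have "\<dots> = (y [^] j \<otimes> x) \<otimes> x [^] (g ^ k - 1)"
      by (simp only: int_pow_mult x) (simp add: m_assoc)
    also have "\<dots> = x \<otimes> (y [^] geo g j \<otimes> inv (z [^] j) \<otimes> x [^] (g ^ k - 1))"
      by (simp add: y_pow_x m_assoc)
    finally have "y [^] j = y [^] geo g j \<otimes> (inv (z [^] j) \<otimes> x [^] (g ^ k - 1))"
      by (simp add: m_assoc)
    then have "y [^] int j = y [^] geo g j \<otimes> (inv (z [^] j) \<otimes> x [^] (g ^ k - 1))"
      by (simp add: int_pow_int)
    then have "y [^] (int j - geo g j) = inv (z [^] j) \<otimes> x [^] (g ^ k - 1)"
      using int_pow_mult[OF y, of "- geo g j" "int j"]
      by (simp add: int_pow_neg m_assoc[symmetric])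
    then have "z [^] j \<otimes> y [^] (int j - geo g j) = x [^] (g ^ k - 1)"
      by (simp add: m_assoc[symmetric])
    moreover have "z [^] j \<otimes> y [^] (int j - geo g j) = y [^] ((int j - geo g j) * (1 + q) ^ j) \<otimes> z [^] j"
      by (rule swap_pow_left) (simp_all add: zy)
    ultimately have "x [^] (- (g ^ k - 1)) \<otimes> (y [^] ((int j - geo g j) * (1 + q) ^ j) \<otimes> z [^] j) = \<one>"
      by (simp only: int_pow_neg x) simp
    then show ?thesis using U1[of _ _ "int j"] by (simp add: int_pow_int m_assoc)
  qed
  have "N dvd int i"
  proof -
    have "(x [^] i \<otimes> y [^] j \<otimes> y [^] ((1 + q) ^ k)) \<otimes> z [^] k = w \<otimes> y"
      by (simp add: w_eq m_assoc zk_y)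
    also have "\<dots> = (y \<otimes> x [^] i \<otimes> y [^] j) \<otimes> z [^] k"
      using center_commute[OF w y] by (simp add: w_eq m_assoc)
    finally have "y \<otimes> x [^] i \<otimes> y [^] j = x [^] i \<otimes> y [^] j \<otimes> y [^] ((1 + q) ^ k)" by simp
    also have "\<dots> = x [^] i \<otimes> y [^] (1 + (int j - 1 + (1 + q) ^ k))"
      by (simp add: m_assoc flip: int_pow_int int_pow_mult)
    also have "\<dots> = x [^] i \<otimes> y \<otimes> y [^] (int j - 1 + (1 + q) ^ k)"
      by (simp only: int_pow_mult y) (simp add: m_assoc)
    also have "\<dots> = y \<otimes> (x [^] geo g i \<otimes> z [^] i \<otimes> y [^] (int j - 1 + (1 + q) ^ k))"
      by (simp add: x_pow_y m_assoc)
    finally have 1: "x [^] int i \<otimes> y [^] int j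
      = x [^] geo g i \<otimes> (z [^] i \<otimes> y [^] (int j - 1 + (1 + q) ^ k))"
      by (simp add: m_assoc int_pow_int)
    have "z [^] i \<otimes> y [^] (int j - 1 + (1 + q) ^ k)
        = z [^] i \<otimes> y [^] ((1 + q) ^ k - 1) \<otimes> y [^] int j"
      by (simp add: m_assoc algebra_simps flip: int_pow_mult)
    with 1 have "x [^] int i \<otimes> y [^] int j
      = (x [^] geo g i \<otimes> (z [^] i \<otimes> y [^] ((1 + q) ^ k - 1))) \<otimes> y [^] int j"
      by (simp add: m_assoc)
    then have 2: "x [^] int i = x [^] geo g i \<otimes> (z [^] i \<otimes> y [^] ((1 + q) ^ k - 1))"
      by simp
    have "z [^] i \<otimes> y [^] ((1 + q) ^ k - 1) = y [^] (((1 + q) ^ k - 1) * (1 + q) ^ i) \<otimes> z [^] i"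
      by (rule swap_pow_left) (simp_all add: zy)
    with 2 have "x [^] (- int i) \<otimes> x [^] geo g i \<otimes> (y [^] (((1 + q) ^ k - 1) * (1 + q) ^ i) \<otimes> z [^] i)
        = x [^] (- int i) \<otimes> x [^] int i"
      by (simp add: m_assoc)
    also have "\<dots> = \<one>" by (simp flip: int_pow_mult)
    finally have "x [^] (- int i + geo g i) \<otimes> y [^] (((1 + q) ^ k - 1) * (1 + q) ^ i) \<otimes> z [^] int i = \<one>"
      by (simp add: m_assoc int_pow_int flip: int_pow_mult)
    then show ?thesis using U1 by blast
  qed
  obtain i' where i': "int i = N * i'" using \<open>N dvd int i\<close> by blast
  obtain j' where j': "int j = N * j'" using \<open>N dvd int j\<close> by blast
  obtain r s where rs: "x [^] N = y [^] (N * r)" "y [^] N = x [^] (N * s)" by (rule x_y_pow_N)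
  have "x [^] i \<otimes> y [^] j = x [^] (N * i') \<otimes> (y [^] N) [^] j'"
    by (simp add: int_pow_pow flip: int_pow_int i' j')
  also have "\<dots> = x [^] (N * (i' + s * j'))"
    by (simp add: rs int_pow_pow int_pow_mult[symmetric] algebra_simps)
  finally have w_eq': "w = x [^] (N * (i' + s * j')) \<otimes> z [^] k" by (simp add: w_eq)
  have "x [^] (N * (i' + s * j')) \<otimes> (z [^] k \<otimes> x) = w \<otimes> x" by (simp add: w_eq' m_assoc)
  also have "\<dots> = x \<otimes> w" by (rule center_commute[OF w x])
  also have "\<dots> = x [^] (N * (i' + s * j')) \<otimes> (x \<otimes> z [^] k)"
    by (simp add: w_eq' m_assoc[symmetric] center_commute[OF x_pow_N_center x])
  finally have "x [^] (g ^ k) = x [^] (1::int)" by (simp add: zk_x)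
  then have "x [^] (g ^ k - 1) = \<one>" by (simp add: int_pow_diff)
  then have "2 ^ (3 * m - 1) dvd g ^ k - 1" by (rule U2)
  then have "2 ^ m * N dvd (g - 1) * geo g k"
    using geo_power[of g k] N_mult by (simp add: mult.commute)
  \<comment> \<open>As an inverse of \<open>1 + q\<close>, \<open>g\<close> differs from 1 by
    exactly the factor \<open>2^m\<close>. Cancelling it leaves \<open>N dvd geo g k\<close>, which
    \<open>dvd_geoD\<close> transfers to \<open>k\<close>.\<close>
  moreover have "\<exists>u. odd u \<and> g - 1 = 2 ^ m * u"
  proof -
    obtain F where "(1 + q) * g - 1 = N * 2 ^ m * F" using g_dvd unfolding N_mult by blast
    then have "g - 1 = 2 ^ m * (N * F - l * g)" by (simp add: q_def algebra_simps)
    moreover have "odd (N * F - l * g)" using l g_odd m by (simp add: N_def)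
    ultimately show ?thesis by blast
  qed
  ultimately obtain u where u: "odd u" "2 ^ m * N dvd 2 ^ m * (u * geo g k)"
    by (metis mult.assoc)
  then have "N dvd geo g k"
    by (simp add: N_def coprime_dvd_mult_right_iff)
  then have "N dvd int k"
    using dvd_geoD[OF m gm, of "2 * m - 1" k] by (simp add: N_def)
  then obtain k' where "int k = N * k'" by blast
  moreover obtain r' where "z [^] N = x [^] (N * r')" by (rule z_pow_N)
  ultimately have "z [^] k = x [^] (N * (r' * k'))"
    by (simp add: mult.assoc flip: int_pow_int int_pow_pow)
  then have "w = x [^] (N * (i' + s * j' + r' * k'))"
    by (simp add: w_eq' int_pow_mult[symmetric] algebra_simps)
  then show "w \<in> {x [^] (N * i) | i. True}" by blast
next
  fix w assume "w \<in> {x [^] (N * i) | i. True}"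
  then show "w \<in> center G" using x_pow_N_center by blast
qed

end

section \<open>Cyclic extensions\<close>

text \<open>The pair \<open>(i, a)\<close> stands for \<open>t^i a\<close>, where the adjoined element \<open>t\<close> satisfies \<open>t^n = u\<close> and
  \<open>a t = t s(a)\<close>.\<close>

definition cyc_ext :: "('a, 'b) monoid_scheme \<Rightarrow> ('a \<Rightarrow> 'a) \<Rightarrow> nat \<Rightarrow> 'a \<Rightarrow> (nat \<times> 'a) monoid" where
  "cyc_ext K s n u = \<lparr>carrier = {..<n} \<times> carrier K,
     monoid.mult = (\<lambda>(i, a) (j, b). ((i + j) mod n,
       u [^]\<^bsub>K\<^esub> ((i + j) div n) \<otimes>\<^bsub>K\<^esub> ((s ^^ j) a \<otimes>\<^bsub>K\<^esub> b))),
     one = (0, \<one>\<^bsub>K\<^esub>)\<rparr>"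

definition cyc_emb :: "'a \<Rightarrow> nat \<times> 'a" where
  "cyc_emb a = (0, a)"

definition cyc_gen :: "('a, 'b) monoid_scheme \<Rightarrow> nat \<times> 'a" where
  "cyc_gen K = (1, \<one>\<^bsub>K\<^esub>)"

text \<open>The elements \<open>a\<close> for which the equation holds are closed under products and
  inverses, so it may be checked on generators. With \<open>f\<close> the identity this verifies the
  axioms of an extension, with general \<open>f\<close> it builds homomorphisms out of one.\<close>

lemma (in group) hom_conj_generate:
  assumes H: "group H" and f: "f \<in> hom G H" and s: "s \<in> hom G G" and t: "t \<in> carrier H"
    and S: "S \<subseteq> carrier G" and eq: "\<And>a. a \<in> S \<Longrightarrow> f a \<otimes>\<^bsub>H\<^esub> t = t \<otimes>\<^bsub>H\<^esub> f (s a)"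
    and a: "a \<in> generate G S"
  shows "f a \<otimes>\<^bsub>H\<^esub> t = t \<otimes>\<^bsub>H\<^esub> f (s a)"
proof -
  interpret H: group H by (rule H)
  interpret f: group_hom G H f by unfold_locales (rule f)
  interpret s: group_hom G G s by unfold_locales (rule s)
  show ?thesis
    using a
  proof (induction rule: generate.induct)
    case (inv h)
    then have h: "h \<in> carrier G" using S by blast
    have "f h \<otimes>\<^bsub>H\<^esub> t = t \<otimes>\<^bsub>H\<^esub> f (s h)" by (rule eq[OF inv])
    then have "(f h) [^]\<^bsub>H\<^esub> (-1::int) \<otimes>\<^bsub>H\<^esub> t = t \<otimes>\<^bsub>H\<^esub> (f (s h)) [^]\<^bsub>H\<^esub> (-1::int)"
      by (intro H.swap_int_pow) (use h t in auto)
    then show ?case using h by (simp add: H.int_pow_neg)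
  next
    case (eng h1 h2)
    then have h: "h1 \<in> carrier G" "h2 \<in> carrier G"
      using generate_in_carrier[OF S] by auto
    have "f (h1 \<otimes> h2) \<otimes>\<^bsub>H\<^esub> t = f h1 \<otimes>\<^bsub>H\<^esub> (f h2 \<otimes>\<^bsub>H\<^esub> t)"
      using h t by (simp add: H.m_assoc)
    also have "\<dots> = (f h1 \<otimes>\<^bsub>H\<^esub> t) \<otimes>\<^bsub>H\<^esub> f (s h2)"
      using h t by (simp add: eng.IH(2) H.m_assoc)
    also have "\<dots> = t \<otimes>\<^bsub>H\<^esub> f (s (h1 \<otimes> h2))"
      unfolding eng.IH(1) using h t by (simp add: H.m_assoc)
    finally show ?case .
  qed (use t eq in auto)
qed

text \<open>The carry identity: reducing one summand first splits the number of carries. It gives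
  the cocycle condition behind associativity in \<open>cyc_ext\<close>.\<close>

lemma add_mod_div: "(n::nat) > 0 \<Longrightarrow> (a + b mod n) div n + b div n = (a + b) div n"
proof -
  assume n: "n > 0"
  have "a + b = (a + b mod n) + n * (b div n)" by simp
  also have "\<dots> div n = b div n + (a + b mod n) div n" using n by (intro div_mult_self2) simp
  finally show ?thesis by simp
qed

text \<open>The classical data of a cyclic extension. By \<open>s_n\<close> the iterate
  \<open>s ^^ n\<close> is conjugation by \<open>u\<close>, which makes the endomorphism
  \<open>s\<close> bijective.\<close>

locale cyclic_extension = K: group K for K (structure) +
  fixes s :: "'a \<Rightarrow> 'a" and n :: nat and u :: 'a
  assumes n: "n > 1" and s: "s \<in> hom K K" and u [simp]: "u \<in> carrier K" and s_u: "s u = u"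
    and s_n: "\<And>a. a \<in> carrier K \<Longrightarrow> a \<otimes> u = u \<otimes> (s ^^ n) a"
begin

abbreviation E where "E \<equiv> cyc_ext K s n u"

lemma s_pow_closed [simp]: "a \<in> carrier K \<Longrightarrow> (s ^^ k) a \<in> carrier K"
  using s by (induction k) (auto simp: hom_def)

lemma s_pow_mult: "a \<in> carrier K \<Longrightarrow> b \<in> carrier K \<Longrightarrow> (s ^^ k) (a \<otimes> b) = (s ^^ k) a \<otimes> (s ^^ k) b"
  using s by (induction k) (auto simp: hom_def)

lemma s_pow_one [simp]: "(s ^^ k) \<one> = \<one>"
  using hom_one[OF s K.is_group K.is_group] by (induction k) simp_all

lemma s_pow_u: "(s ^^ k) (u [^] (i::nat)) = u [^] i"
proof -
  have "(s ^^ k) u = u" by (induction k) (simp_all add: s_u)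
  then show ?thesis by (induction i) (simp_all add: s_pow_mult)
qed

lemma pow_u_swap:
  assumes a: "a \<in> carrier K"
  shows "(s ^^ r) a \<otimes> u [^] (k::nat) = u [^] k \<otimes> (s ^^ (r + n * k)) a"
proof (induction k)
  case (Suc k)
  have "(s ^^ r) a \<otimes> u [^] Suc k = (s ^^ r) a \<otimes> u [^] k \<otimes> u"
    using a by (simp add: K.m_assoc)
  also have "\<dots> = u [^] k \<otimes> ((s ^^ (r + n * k)) a \<otimes> u)"
    using a by (simp add: Suc K.m_assoc)
  also have "\<dots> = u [^] k \<otimes> u \<otimes> (s ^^ n) ((s ^^ (r + n * k)) a)"
    using a by (simp add: s_n[of "(s ^^ (r + n * k)) a"] K.m_assoc)
  also have "(s ^^ n) ((s ^^ (r + n * k)) a) = (s ^^ (r + n * Suc k)) a"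
    by (metis add.left_commute comp_apply funpow_add mult_Suc_right)
  finally show ?case by simp
qed (use a in simp)

lemma carrier_E: "carrier E = {..<n} \<times> carrier K"
  by (simp add: cyc_ext_def)

lemma mult_E: "(i, a) \<otimes>\<^bsub>E\<^esub> (j, b) = ((i + j) mod n, u [^] ((i + j) div n) \<otimes> ((s ^^ j) a \<otimes> b))"
  by (simp add: cyc_ext_def)

lemma one_E: "\<one>\<^bsub>E\<^esub> = (0, \<one>)"
  by (simp add: cyc_ext_def)

lemma group_E: "group E"
proof (rule groupI)
  fix p p' p'' assume "p \<in> carrier E" "p' \<in> carrier E" "p'' \<in> carrier E"
  then obtain i a j b k c where p: "p = (i, a)" "p' = (j, b)" "p'' = (k, c)"
    and a [simp]: "a \<in> carrier K" "b \<in> carrier K" "c \<in> carrier K"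
    by (auto simp: carrier_E)
  define d where "d = (j + k) div n"
  define e where "e = (i + (j + k) mod n) div n"
  have ed: "(i + j + k) div n = e + d"
    using add_mod_div[of n i "j + k"] n unfolding d_def e_def by (simp add: add.assoc)
  have ed': "(i + j + k) div n = ((i + j) mod n + k) div n + (i + j) div n"
    using add_mod_div[of n k "i + j"] n by (simp add: add_ac)
  have "p \<otimes>\<^bsub>E\<^esub> p' \<otimes>\<^bsub>E\<^esub> p'' = ((i + j + k) mod n,
      u [^] (((i + j) mod n + k) div n) \<otimes> (u [^] ((i + j) div n) \<otimes> ((s ^^ (k + j)) a \<otimes> (s ^^ k) b) \<otimes> c))"
    by (simp add: p mult_E s_pow_mult s_pow_u funpow_add mod_add_left_eq)
  also have "\<dots> = ((i + j + k) mod n,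
      u [^] ((i + j + k) div n) \<otimes> ((s ^^ (k + j)) a \<otimes> ((s ^^ k) b \<otimes> c)))"
    unfolding ed' by (simp add: K.m_assoc flip: K.nat_pow_mult)
  finally have 1: "p \<otimes>\<^bsub>E\<^esub> p' \<otimes>\<^bsub>E\<^esub> p'' = \<dots>" .
  have "p \<otimes>\<^bsub>E\<^esub> (p' \<otimes>\<^bsub>E\<^esub> p'') = ((i + j + k) mod n,
      u [^] e \<otimes> ((s ^^ ((j + k) mod n)) a \<otimes> (u [^] d \<otimes> ((s ^^ k) b \<otimes> c))))"
    by (simp add: p mult_E d_def e_def mod_add_right_eq add.assoc)
  also have "(s ^^ ((j + k) mod n)) a \<otimes> (u [^] d \<otimes> ((s ^^ k) b \<otimes> c))
      = ((s ^^ ((j + k) mod n)) a \<otimes> u [^] d) \<otimes> ((s ^^ k) b \<otimes> c)"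
    by (simp add: K.m_assoc)
  also have "(s ^^ ((j + k) mod n)) a \<otimes> u [^] d = u [^] d \<otimes> (s ^^ ((j + k) mod n + n * d)) a"
    by (rule pow_u_swap) simp
  also have "(j + k) mod n + n * d = k + j"
    by (simp add: d_def)
  finally have 2: "p \<otimes>\<^bsub>E\<^esub> (p' \<otimes>\<^bsub>E\<^esub> p'') = ((i + j + k) mod n,
      u [^] ((i + j + k) div n) \<otimes> ((s ^^ (k + j)) a \<otimes> ((s ^^ k) b \<otimes> c)))"
    unfolding ed by (simp add: K.m_assoc flip: K.nat_pow_mult)
  show "p \<otimes>\<^bsub>E\<^esub> p' \<otimes>\<^bsub>E\<^esub> p'' = p \<otimes>\<^bsub>E\<^esub> (p' \<otimes>\<^bsub>E\<^esub> p'')"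
    unfolding 1 2 ..
next
  fix p assume "p \<in> carrier E"
  then obtain i a where p: "p = (i, a)" "i < n" and a [simp]: "a \<in> carrier K"
    by (auto simp: carrier_E)
  show "\<exists>p'\<in>carrier E. p' \<otimes>\<^bsub>E\<^esub> p = \<one>\<^bsub>E\<^esub>"
  proof (cases "i = 0")
    case True
    then show ?thesis
      by (intro bexI[of _ "(0, inv a)"]) (use n in \<open>simp_all add: p carrier_E mult_E one_E\<close>)
  next
    case False
    \<comment> \<open>In the product of the witness with \<open>(i, a)\<close> the exponents add up
      to \<open>n\<close>, which contributes one factor \<open>u\<close>; hence the inverse of
      \<open>u a\<close>, pulled back through \<open>s\<close>.\<close>
    let ?c = "inv (u \<otimes> a)"
    have "(s ^^ i) ((s ^^ (n - i)) ?c) = (s ^^ n) ?c"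
      using p(2) by (simp flip: funpow_add[THEN fun_cong, simplified])
    then have "u \<otimes> ((s ^^ i) ((s ^^ (n - i)) ?c) \<otimes> a) = ?c \<otimes> u \<otimes> a"
      using s_n[of ?c] by (simp add: K.m_assoc[symmetric])
    also have "\<dots> = \<one>" by (simp add: K.m_assoc)
    finally show ?thesis
      using False p n by (intro bexI[of _ "(n - i, (s ^^ (n - i)) ?c)"]) (simp_all add: mult_E one_E carrier_E)
  qed
qed (use n in \<open>auto simp: carrier_E mult_E one_E\<close>)

sublocale E: group E by (rule group_E)

lemma emb_hom: "cyc_emb \<in> hom K E"
  by (rule homI) (use n in \<open>auto simp: cyc_emb_def carrier_E mult_E\<close>)

sublocale emb: group_hom K E cyc_emb
  by unfold_locales (rule emb_hom)

lemma emb_eq_iff [simp]: "cyc_emb a = cyc_emb b \<longleftrightarrow> a = b"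
  by (simp add: cyc_emb_def)

lemma gen_closed [simp]: "cyc_gen K \<in> carrier E"
  using n by (simp add: cyc_gen_def carrier_E)

lemma gen_pow: "cyc_gen K [^]\<^bsub>E\<^esub> k = (k mod n, u [^] (k div n))"
proof (induction k)
  case (Suc k)
  have "(k mod n + 1) div n + k div n = Suc k div n"
    using add_mod_div[of n 1 k] n by (simp add: add.commute)
  then show ?case
    using n s_pow_u[of 1] by (simp add: Suc) (simp add: cyc_gen_def mult_E mod_Suc_eq K.nat_pow_mult)
qed (use n in \<open>simp add: one_E\<close>)

lemma gen_pow_n: "cyc_gen K [^]\<^bsub>E\<^esub> n = cyc_emb u"
  using n by (simp add: gen_pow cyc_emb_def)

lemma emb_gen: "a \<in> carrier K \<Longrightarrow> cyc_emb a \<otimes>\<^bsub>E\<^esub> cyc_gen K = cyc_gen K \<otimes>\<^bsub>E\<^esub> cyc_emb (s a)"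
  using n s by (simp add: cyc_emb_def cyc_gen_def mult_E hom_in_carrier)

lemma pair_eq: "i < n \<Longrightarrow> a \<in> carrier K \<Longrightarrow> (i, a) = cyc_gen K [^]\<^bsub>E\<^esub> i \<otimes>\<^bsub>E\<^esub> cyc_emb a"
  by (simp add: gen_pow cyc_emb_def mult_E)

text \<open>Peels off one layer: a trivial word in the extension yields divisibility of the exponent
  of the new generator and a trivial word in the base. Iterated down the tower it proves
  independence of exponents.\<close>

lemma gen_pow_emb_eq_one:
  assumes a: "a \<in> carrier K" and eq: "cyc_gen K [^]\<^bsub>E\<^esub> (i::int) \<otimes>\<^bsub>E\<^esub> cyc_emb a = \<one>\<^bsub>E\<^esub>"
  shows "\<exists>i'. i = int n * i' \<and> u [^] i' \<otimes> a = \<one>"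
proof -
  define r where "r = nat (i mod int n)"
  define i' where "i' = i div int n"
  have r: "r < n" and i: "i = int r + int n * i'"
    using n by (simp_all add: r_def i'_def nat_less_iff)
  have "cyc_gen K [^]\<^bsub>E\<^esub> i = cyc_gen K [^]\<^bsub>E\<^esub> r \<otimes>\<^bsub>E\<^esub> (cyc_gen K [^]\<^bsub>E\<^esub> n) [^]\<^bsub>E\<^esub> i'"
    unfolding i by (simp add: E.int_pow_mult int_pow_int flip: E.int_pow_pow)
  also have "(cyc_gen K [^]\<^bsub>E\<^esub> n) [^]\<^bsub>E\<^esub> i' = cyc_emb (u [^] i')"
    by (simp add: gen_pow_n emb.hom_int_pow)
  finally have "\<one>\<^bsub>E\<^esub> = cyc_gen K [^]\<^bsub>E\<^esub> r \<otimes>\<^bsub>E\<^esub> cyc_emb (u [^] i' \<otimes> a)"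
    using a eq by (simp add: E.m_assoc)
  also have "\<dots> = (r, u [^] i' \<otimes> a)"
    using r a by (simp add: pair_eq)
  finally have "r = 0" "u [^] i' \<otimes> a = \<one>" by (simp_all add: one_E)
  then show ?thesis using i by auto
qed

lemma generate_E:
  assumes S: "S \<subseteq> carrier K" "generate K S = carrier K"
  shows "generate E (insert (cyc_gen K) (cyc_emb ` S)) = carrier E"
proof -
  let ?A = "generate E (insert (cyc_gen K) (cyc_emb ` S))"
  have sub: "insert (cyc_gen K) (cyc_emb ` S) \<subseteq> carrier E"
    using S(1) emb.hom_closed by auto
  then interpret A: subgroup ?A E by (rule E.generate_is_subgroup)
  show ?thesis
  proof (intro equalityI subsetI)
  fix p assume "p \<in> carrier E"
  then obtain i a where p: "p = (i, a)" "i < n" "a \<in> carrier K" by (auto simp: carrier_E)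
  have "cyc_emb ` generate K S = generate E (cyc_emb ` S)"
    by (rule emb.generate_img[OF S(1), symmetric])
  then have "cyc_emb a \<in> ?A"
    using p(3) S(2) E.mono_generate[of "cyc_emb ` S" "insert (cyc_gen K) (cyc_emb ` S)"] by blast
  moreover have "cyc_gen K \<in> ?A" by (rule generate.incl) simp
  then have "cyc_gen K [^]\<^bsub>E\<^esub> int i \<in> ?A"
    by (rule E.subgroup_int_pow_closed[OF A.subgroup_axioms])
  ultimately show "p \<in> ?A"
    using p by (simp add: pair_eq int_pow_int A.m_closed)
next
  fix p assume "p \<in> generate E (insert (cyc_gen K) (cyc_emb ` S))"
  then show "p \<in> carrier E"
    by (rule E.generate_in_carrier[OF sub])
  qed
qed

text \<open>The universal property. Together with that of the base it presents the extension by
  generators and relations, so endomorphisms for the next layer can be given on generators.\<close>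

lemma hom_E:
  assumes H: "group H" and f: "f \<in> hom K H" and t: "t \<in> carrier H"
    and S: "S \<subseteq> carrier K" "generate K S = carrier K"
    and eq: "\<And>a. a \<in> S \<Longrightarrow> f a \<otimes>\<^bsub>H\<^esub> t = t \<otimes>\<^bsub>H\<^esub> f (s a)"
    and tn: "t [^]\<^bsub>H\<^esub> n = f u"
  obtains h where "h \<in> hom E H" "h (cyc_gen K) = t" "\<And>a. a \<in> carrier K \<Longrightarrow> h (cyc_emb a) = f a"
proof -
  interpret H: group H by (rule H)
  interpret f: group_hom K H f by unfold_locales (rule f)
  define h where "h = (\<lambda>(i::nat, a). t [^]\<^bsub>H\<^esub> i \<otimes>\<^bsub>H\<^esub> f a)"
  have eq1: "f a \<otimes>\<^bsub>H\<^esub> t = t \<otimes>\<^bsub>H\<^esub> f (s a)" if "a \<in> carrier K" for a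
    using K.hom_conj_generate[OF H f s t S(1) eq] that S(2) by blast
  have swap: "f a \<otimes>\<^bsub>H\<^esub> t [^]\<^bsub>H\<^esub> j = t [^]\<^bsub>H\<^esub> j \<otimes>\<^bsub>H\<^esub> f ((s ^^ j) a)" if a: "a \<in> carrier K" for a and j :: nat
  proof (induction j)
    case (Suc j)
    have "f a \<otimes>\<^bsub>H\<^esub> t [^]\<^bsub>H\<^esub> Suc j = (f a \<otimes>\<^bsub>H\<^esub> t [^]\<^bsub>H\<^esub> j) \<otimes>\<^bsub>H\<^esub> t"
      using a t by (simp add: H.m_assoc)
    also have "\<dots> = t [^]\<^bsub>H\<^esub> j \<otimes>\<^bsub>H\<^esub> (f ((s ^^ j) a) \<otimes>\<^bsub>H\<^esub> t)"
      unfolding Suc using a t by (simp add: H.m_assoc)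
    finally show ?case using a t s by (simp add: eq1 H.m_assoc hom_in_carrier)
  qed (use a t in simp)
  have "h \<in> hom E H"
  proof (rule homI)
    fix p p' assume "p \<in> carrier E" "p' \<in> carrier E"
    then obtain i a j b where p: "p = (i, a)" "p' = (j, b)" and a [simp]: "a \<in> carrier K" "b \<in> carrier K"
      by (auto simp: carrier_E)
    have "h (p \<otimes>\<^bsub>E\<^esub> p') = t [^]\<^bsub>H\<^esub> ((i + j) mod n) \<otimes>\<^bsub>H\<^esub> (f u [^]\<^bsub>H\<^esub> ((i + j) div n)
        \<otimes>\<^bsub>H\<^esub> (f ((s ^^ j) a) \<otimes>\<^bsub>H\<^esub> f b))"
      by (simp add: p mult_E h_def f.hom_nat_pow)
    also have "\<dots> = t [^]\<^bsub>H\<^esub> ((i + j) mod n + n * ((i + j) div n)) \<otimes>\<^bsub>H\<^esub> (f ((s ^^ j) a) \<otimes>\<^bsub>H\<^esub> f b)"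
    proof -
      have "f u [^]\<^bsub>H\<^esub> ((i + j) div n) = t [^]\<^bsub>H\<^esub> (n * ((i + j) div n))"
        using t by (simp add: H.nat_pow_pow flip: tn)
      then show ?thesis
        using t by (simp add: H.m_assoc[symmetric] H.nat_pow_mult)
    qed
    also have "(i + j) mod n + n * ((i + j) div n) = i + j" by simp
    also have "t [^]\<^bsub>H\<^esub> (i + j) \<otimes>\<^bsub>H\<^esub> (f ((s ^^ j) a) \<otimes>\<^bsub>H\<^esub> f b)
        = t [^]\<^bsub>H\<^esub> i \<otimes>\<^bsub>H\<^esub> (f a \<otimes>\<^bsub>H\<^esub> t [^]\<^bsub>H\<^esub> j) \<otimes>\<^bsub>H\<^esub> f b"
      unfolding swap[OF a(1)] using t by (simp add: H.m_assoc[symmetric] H.nat_pow_mult)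
    also have "\<dots> = h p \<otimes>\<^bsub>H\<^esub> h p'"
      using t by (simp add: p h_def H.m_assoc)
    finally show "h (p \<otimes>\<^bsub>E\<^esub> p') = h p \<otimes>\<^bsub>H\<^esub> h p'" .
  next
    show "h p \<in> carrier H" if "p \<in> carrier E" for p
      using that t by (auto simp: h_def carrier_E)
  qed
  moreover have "h (cyc_gen K) = t"
    using t by (simp add: h_def cyc_gen_def)
  moreover have "h (cyc_emb a) = f a" if "a \<in> carrier K" for a
    using t that by (simp add: h_def cyc_emb_def)
  ultimately show thesis by (rule that[of h])
qed

end

section \<open>Relations between the powers of the generators\<close>

context group
begin

lemma mult_pow_geo_right:
  assumes "a \<in> carrier G" "b \<in> carrier G" "a \<otimes> b = b \<otimes> a [^] (e::int)"
  shows "(b \<otimes> a [^] (i::int)) [^] (n::nat) = b [^] n \<otimes> a [^] (i * geo e n)"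
proof (induction n)
  case (Suc n)
  have "(b \<otimes> a [^] i) [^] Suc n = b [^] n \<otimes> (a [^] (i * geo e n) \<otimes> b) \<otimes> a [^] i"
    using assms Suc by (simp add: m_assoc)
  also have "a [^] (i * geo e n) \<otimes> b = b \<otimes> a [^] (i * geo e n * e)"
    using swap_pow[OF assms, of "i * geo e n" 1] assms by simp
  also have "b [^] n \<otimes> (b \<otimes> a [^] (i * geo e n * e)) \<otimes> a [^] i = b [^] Suc n \<otimes> a [^] (i * geo e (Suc n))"
    using assms by (simp add: m_assoc geo_Suc' int_pow_mult[symmetric] algebra_simps)
  finally show ?case .
qed (use assms in simp)

lemma inv_swap:
  assumes "a \<in> carrier G" "b \<in> carrier G" "c \<in> carrier G" "a \<otimes> b = b \<otimes> c"
  shows "inv b \<otimes> a = c \<otimes> inv b"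
proof -
  have "inv b \<otimes> a = inv b \<otimes> (a \<otimes> b) \<otimes> inv b" using assms(1-3) by (simp add: m_assoc)
  also have "\<dots> = c \<otimes> inv b" unfolding assms(4) using assms(1-3) by (simp add: m_assoc[symmetric])
  finally show ?thesis .
qed

end

text \<open>These relations hold for \<open>X = x^(2P)\<close>, \<open>Y = y^(2P)\<close> and \<open>z = [x, y]\<close> with \<open>P = 2^(m-1)\<close>.  They are
  symmetric under \<open>(X, Y, z) \<mapsto> (Y, X, z\<inverse>)\<close>.\<close>

locale power_relations = group G for G (structure) +
  fixes X Y z :: 'a and P :: nat and l :: int
  assumes X [simp]: "X \<in> carrier G" and Y [simp]: "Y \<in> carrier G" and z [simp]: "z \<in> carrier G"
    and P: "\<exists>m\<ge>2. P = 2 ^ (m - 1)" and l: "odd l"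
    and XY: "X \<otimes> Y = Y \<otimes> X"
    and Xz: "X \<otimes> z = z \<otimes> X [^] (1 + 2 * int P * l)"
    and zY: "z \<otimes> Y = Y [^] (1 + 2 * int P * l) \<otimes> z"
    and pow_X: "X [^] (2 * int P * int P) = \<one>"
    and Y_P: "Y [^] int P = X [^] (- int P)"
    and z_PP: "z [^] (2 * int P * int P) = X [^] (int P * int P)"
begin

definition p :: int where "p = int P"
definition \<alpha> :: int where "\<alpha> = 1 + 2 * p * l"

lemma m_ex: obtains m where "m \<ge> 2" "P = 2 ^ (m - 1)" "2 * p = 2 ^ m" "2 * p * p = 2 ^ (2 * m - 1)"
  "4 * p * p * p = 2 ^ (3 * m - 1)" "even p" "p = 2 ^ (m - 1)"
proof -
  obtain m where m: "m \<ge> 2" "P = 2 ^ (m - 1)" using P by blast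
  obtain p' :: int where "p' = 2 ^ (m - 1)" "even p'" "2 ^ m = 2 * p'" "2 ^ (2 * m - 1) = 2 * p' * p'"
    "2 ^ (3 * m - 1) = 4 * p' * p' * p'" by (rule pow2_split[OF m(1)])
  moreover have "p = p'" using m(2) \<open>p' = 2 ^ (m - 1)\<close> unfolding p_def by simp
  ultimately show thesis using that[OF m] by simp
qed

lemma X_cong: "2 * p * p dvd i - j \<Longrightarrow> X [^] i = X [^] j"
  by (rule int_pow_cong[OF X pow_X]) (simp add: p_def)

lemma X_zero: "2 * p * p dvd i \<Longrightarrow> X [^] i = \<one>"
  using X_cong[of i 0] by simp

lemma Y_p: "Y [^] (p * i) = X [^] (- (p * i))"
proof -
  have "Y [^] (p * i) = (Y [^] int P) [^] i" by (simp add: int_pow_pow p_def)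
  also have "\<dots> = X [^] (- (p * i))" unfolding Y_P by (simp add: int_pow_pow p_def)
  finally show ?thesis .
qed

lemma pow_Y: "Y [^] (2 * p * p) = \<one>"
  using Y_p[of "2 * p"] X_zero[of "- (p * (2 * p))"] by (simp add: mult_ac)

lemma Y_cong: "2 * p * p dvd i - j \<Longrightarrow> Y [^] i = Y [^] j"
  by (rule int_pow_cong[OF Y pow_Y])

lemma z_pp: "z [^] (2 * p * p * i) = X [^] (p * p * i)"
  using z_PP by (simp add: p_def flip: int_pow_pow)

lemma pow_z: "z [^] (4 * p * p) = \<one>"
  using z_pp[of 2] X_zero[of "p * p * 2"] by (simp add: mult_ac)

lemma Xz': "X \<otimes> z = z \<otimes> X [^] \<alpha>"
  using Xz by (simp add: \<alpha>_def p_def)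

lemma zY': "z \<otimes> Y = Y [^] \<alpha> \<otimes> z"
  using zY by (simp add: \<alpha>_def p_def)

lemma X_pow_z: "X [^] i \<otimes> z = z \<otimes> X [^] (i * \<alpha>)"
  using swap_pow[OF X z Xz', of i 1] by simp

lemma z_Y_pow: "z \<otimes> Y [^] i = Y [^] (i * \<alpha>) \<otimes> z"
  using swap_pow_left[OF Y z zY', of 1 i] by simp

text \<open>Both factors of \<open>\<alpha>^(2P) - 1 = (\<alpha> - 1) geo \<alpha> (2P)\<close> are
  divisible by \<open>2p\<close>. Hence \<open>z^(2P)\<close> centralises \<open>X\<close> and
  \<open>Y\<close>.\<close>

lemma alpha_pow: "2 * p * p dvd \<alpha> ^ (2 * P) - 1"
proof -
  obtain m where m: "m \<ge> 2" "2 * p = 2 ^ m" by (rule m_ex)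
  have "2 * p dvd geo (1 + 2 * p * l) (2 * P)"
    unfolding m(2) by (rule dvd_geo[OF m(1)]) (simp_all add: m(2)[symmetric] p_def)
  then have "(2 * p * l) * (2 * p) dvd (\<alpha> - 1) * geo \<alpha> (2 * P)"
    unfolding \<alpha>_def by (intro mult_dvd_mono) auto
  moreover have "2 * p * p dvd (2 * p * l) * (2 * p)" by (rule dvdI[of _ _ "2 * l"]) simp
  ultimately show ?thesis using geo_power[of \<alpha> "2 * P"] dvd_trans by (metis add_diff_cancel_left')
qed

definition w :: 'a where "w = z [^] (2 * p)"

lemma w [simp]: "w \<in> carrier G"
  by (simp add: w_def)

lemma w_nat: "w = z [^] (2 * P)"
  by (simp add: w_def p_def flip: int_pow_int)

lemma w_z: "w [^] (i::int) \<otimes> z = z \<otimes> w [^] i"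
  unfolding w_def using int_pow_comm_add[OF z, of "2 * p * i" 1] by (simp add: int_pow_pow)

lemma w_X: "w \<otimes> X = X \<otimes> w"
proof -
  have "X [^] (1::int) \<otimes> z [^] (2 * P) = z [^] (2 * P) \<otimes> X [^] (1 * \<alpha> ^ (2 * P))"
    by (rule swap_pow[OF X z Xz'])
  moreover have "X [^] (\<alpha> ^ (2 * P)) = X [^] (1::int)"
    by (rule X_cong[OF alpha_pow])
  ultimately show ?thesis by (simp add: w_nat)
qed

lemma w_Y: "w \<otimes> Y = Y \<otimes> w"
proof -
  have "z [^] (2 * P) \<otimes> Y [^] (1::int) = Y [^] (1 * \<alpha> ^ (2 * P)) \<otimes> z [^] (2 * P)"
    by (rule swap_pow_left[OF Y z zY'])
  moreover have "Y [^] (\<alpha> ^ (2 * P)) = Y [^] (1::int)"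
    by (rule Y_cong[OF alpha_pow])
  ultimately show ?thesis by (simp add: w_nat)
qed

lemma int_pow_commute:
  assumes "a \<in> carrier G" "b \<in> carrier G" "a \<otimes> b = b \<otimes> a"
  shows "a [^] (i::int) \<otimes> b [^] (j::int) = b [^] j \<otimes> a [^] i"
proof -
  have "a [^] i \<otimes> b = b \<otimes> a [^] i" by (rule swap_int_pow) (use assms in auto)
  then have "b [^] j \<otimes> a [^] i = a [^] i \<otimes> b [^] j"
    by (intro swap_int_pow) (use assms in auto)
  then show ?thesis by simp
qed

lemma w_cong: "2 * p dvd i - j \<Longrightarrow> w [^] i = w [^] j"
proof (rule int_pow_cong[OF w])
  show "w [^] (2 * p) = \<one>"
    unfolding w_def using pow_z by (simp add: int_pow_pow mult_ac)
qed

text \<open>As \<open>X\<close>, \<open>Y\<close> and \<open>w\<close> commute pairwise, words in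
  them become exponent vectors. The vectors are not unique: \<open>A_reduce\<close> encodes
  \<open>Y^p = X^-p\<close> and \<open>A_w_reduce\<close> encodes
  \<open>w^p = X^(p p)\<close>.\<close>

definition A :: "int \<Rightarrow> int \<Rightarrow> int \<Rightarrow> 'a" where
  "A i j k = X [^] i \<otimes> Y [^] j \<otimes> w [^] k"

lemma A_closed [simp]: "A i j k \<in> carrier G"
  by (simp add: A_def)

lemma A_eqI: "i = i' \<Longrightarrow> j = j' \<Longrightarrow> k = k' \<Longrightarrow> A i j k = A i' j' k'"
  by simp

lemma A_mult: "A i j k \<otimes> A i' j' k' = A (i + i') (j + j') (k + k')"
proof -
  have "A i j k \<otimes> A i' j' k' = X [^] i \<otimes> Y [^] j \<otimes> (w [^] k \<otimes> X [^] i') \<otimes> (Y [^] j' \<otimes> w [^] k')"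
    by (simp add: A_def m_assoc)
  also have "w [^] k \<otimes> X [^] i' = X [^] i' \<otimes> w [^] k"
    by (rule int_pow_commute) (simp_all add: w_X)
  also have "X [^] i \<otimes> Y [^] j \<otimes> (X [^] i' \<otimes> w [^] k) \<otimes> (Y [^] j' \<otimes> w [^] k')
      = X [^] i \<otimes> (Y [^] j \<otimes> X [^] i') \<otimes> (w [^] k \<otimes> Y [^] j') \<otimes> w [^] k'"
    by (simp add: m_assoc)
  also have "Y [^] j \<otimes> X [^] i' = X [^] i' \<otimes> Y [^] j"
    by (rule int_pow_commute) (simp_all add: XY)
  also have "w [^] k \<otimes> Y [^] j' = Y [^] j' \<otimes> w [^] k"
    by (rule int_pow_commute) (simp_all add: w_Y)
  also have "X [^] i \<otimes> (X [^] i' \<otimes> Y [^] j) \<otimes> (Y [^] j' \<otimes> w [^] k) \<otimes> w [^] k' = A (i + i') (j + j') (k + k')"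
    by (simp add: A_def int_pow_mult m_assoc)
  finally show ?thesis .
qed

lemma A_X: "X [^] i = A i 0 0" and A_Y: "Y [^] j = A 0 j 0" and A_w: "w [^] k = A 0 0 k"
  and A_one: "\<one> = A 0 0 0"
  by (simp_all add: A_def)

lemma A_inv: "inv (A i j k) = A (- i) (- j) (- k)"
  by (rule inv_equality) (simp_all add: A_mult flip: A_one)

lemma A_pow: "A i j k [^] (n::int) = A (i * n) (j * n) (k * n)"
proof -
  have nat: "A i j k [^] (n::nat) = A (i * int n) (j * int n) (k * int n)" for n
    by (induction n) (simp_all add: A_mult algebra_simps flip: A_one)
  show ?thesis
  proof (cases n rule: int_cases2)
    case (nonneg n)
    then show ?thesis by (simp add: nat int_pow_int)
  next
    case (nonpos n)
    then show ?thesis by (simp add: int_pow_neg int_pow_int nat A_inv)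
  qed
qed

lemma A_z: "A i 0 k \<otimes> z = z \<otimes> A (i * \<alpha>) 0 k"
proof -
  have "A i 0 k \<otimes> z = X [^] i \<otimes> (w [^] k \<otimes> z)" by (simp add: A_def m_assoc)
  also have "\<dots> = (X [^] i \<otimes> z) \<otimes> w [^] k" unfolding w_z by (simp add: m_assoc)
  also have "\<dots> = z \<otimes> A (i * \<alpha>) 0 k" unfolding X_pow_z by (simp add: A_def m_assoc)
  finally show ?thesis .
qed

lemma A_reduce: "A i (p * j + j') k = A (i - p * j) j' k"
proof -
  have "A i (p * j + j') k = A i 0 0 \<otimes> Y [^] (p * j) \<otimes> A 0 j' k"
    by (simp add: A_Y A_mult)
  also have "\<dots> = A (i - p * j) j' k"
    by (simp add: Y_p A_X A_mult)
  finally show ?thesis .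
qed

lemma A_w_reduce: "A i j (p * k + k') = A (i + p * p * k) j k'"
proof -
  have "w [^] (p * k) = X [^] (p * p * k)"
    unfolding w_def by (simp add: int_pow_pow z_pp flip: mult.assoc)
  then show ?thesis
    using A_mult[of "0" 0 "p * k" i j k'] A_mult[of "p * p * k" 0 0 i j k']
    by (simp add: A_w[symmetric] A_X[symmetric] add.commute)
qed

lemma A_cong: "2 * p * p dvd i - i' \<Longrightarrow> A i j k = A i' j k"
  unfolding A_def using X_cong by simp

text \<open>Allows conjugation by \<open>y\<close> to be derived from conjugation by
  \<open>x\<close> later on.\<close>

lemma relations_swap: "power_relations G Y X (inv z) P l"
proof unfold_locales
  have "inv z \<otimes> Y [^] (1 + 2 * int P * l)
      = inv z \<otimes> (Y [^] (1 + 2 * int P * l) \<otimes> z) \<otimes> inv z" by (simp add: m_assoc)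
  also have "\<dots> = inv z \<otimes> (z \<otimes> Y) \<otimes> inv z" by (simp only: zY)
  also have "\<dots> = Y \<otimes> inv z" by (simp add: m_assoc[symmetric])
  finally show "Y \<otimes> inv z = inv z \<otimes> Y [^] (1 + 2 * int P * l)" ..
  have "inv z \<otimes> X = inv z \<otimes> (X \<otimes> z) \<otimes> inv z" by (simp add: m_assoc)
  also have "\<dots> = inv z \<otimes> (z \<otimes> X [^] (1 + 2 * int P * l)) \<otimes> inv z" by (simp only: Xz)
  also have "\<dots> = X [^] (1 + 2 * int P * l) \<otimes> inv z" by (simp add: m_assoc[symmetric])
  finally show "inv z \<otimes> X = X [^] (1 + 2 * int P * l) \<otimes> inv z" .
  show "X [^] int P = Y [^] (- int P)"
    using Y_p[of "-1"] by (simp add: p_def)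
  show "inv z [^] (2 * int P * int P) = Y [^] (int P * int P)"
    using z_PP Y_p[of p] by (simp add: p_def int_pow_inv int_pow_neg)
  show "Y [^] (2 * int P * int P) = \<one>" using pow_Y by (simp add: p_def)
qed (use P l XY in simp_all)

text \<open>\<open>Y'\<close> and \<open>z'\<close> are the conjugates of \<open>Y\<close> and \<open>z\<close> by \<open>x\<close>; below, \<open>X'\<close> is the conjugate of \<open>X\<close> by \<open>y\<close>
  and \<open>y'\<close> that of \<open>y\<close> by \<open>x\<close>.\<close>

definition Y' :: 'a where "Y' = A (- (p * l)) 1 (- 1)"
definition z' :: 'a where "z' = z \<otimes> X [^] (- l)"

lemma Y'_closed [simp]: "Y' \<in> carrier G" and z'_closed [simp]: "z' \<in> carrier G"
  by (simp_all add: Y'_def z'_def)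

lemma z'_pow: "z' [^] (n::nat) = z [^] n \<otimes> X [^] (- l * geo \<alpha> n)"
  unfolding z'_def by (rule mult_pow_geo_right[OF X z Xz'])

lemma tri_2p: "tri (2 * p) = p * (2 * p - 1)"
  by (rule triI) simp

text \<open>The collected exponent is \<open>geo \<alpha> (2P)\<close>, which is \<open>2p\<close>
  modulo \<open>2 p p\<close>, since the linear correction \<open>2 p l tri(2p)\<close> contains the
  factor \<open>p\<close> of \<open>tri(2p)\<close>.\<close>

lemma z'_w: "z' [^] (2 * p) = A (- 2 * p * l) 0 1"
proof -
  obtain m where m: "m \<ge> 2" "2 * p = 2 ^ m" "2 * p * p = 2 ^ (2 * m - 1)" by (rule m_ex)
  have "2 ^ (2 * m + m - 1) dvd geo (1 + 2 * p * l) (2 * P) - int (2 * P) - (2 * p * l) * tri (int (2 * P))"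
    by (rule geo_cong[OF m(1)]) (simp_all add: m(2)[symmetric] p_def)
  then have "2 * p * p dvd geo \<alpha> (2 * P) - 2 * p - (2 * p * l) * tri (2 * p)"
    using pow2_dvd_weaken[of "2 * m + m - 1" _ "2 * m - 1"] unfolding m(3) \<alpha>_def by (simp add: p_def)
  moreover have "2 * p * p dvd (2 * p * l) * tri (2 * p)"
    unfolding tri_2p by (simp add: mult_ac)
  ultimately have "2 * p * p dvd geo \<alpha> (2 * P) - 2 * p"
    by (metis dvd_add diff_add_cancel)
  then have "2 * p * p dvd - l * geo \<alpha> (2 * P) - (- 2 * p * l)"
    using dvd_mult[of "2 * p * p" "geo \<alpha> (2 * P) - 2 * p" "- l"] by (simp add: algebra_simps)
  then have "X [^] (- l * geo \<alpha> (2 * P)) = X [^] (- 2 * p * l)" by (rule X_cong)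
  then have "z' [^] (2 * P) = w \<otimes> X [^] (- 2 * p * l)"
    unfolding z'_pow w_nat by simp
  also have "\<dots> = A (- 2 * p * l) 0 1"
    using A_w[of 1] by (simp add: A_X A_mult)
  finally show ?thesis by (simp add: p_def flip: int_pow_int)
qed

text \<open>Shows that conjugation by the future generator \<open>x\<close> respects the relations.
  The images are forced: \<open>z^x = z x^(1-\<alpha>) = z X^-l\<close>, and
  \<open>Y^x = (y z^-1)^(2p)\<close>, which \<open>y'_pow\<close> evaluates to
  \<open>Y'\<close>.\<close>

theorem relations_shift: "power_relations G X Y' z' P l"
proof unfold_locales
  show "X \<otimes> Y' = Y' \<otimes> X"
  proof -
    have "A 1 0 0 \<otimes> Y' = Y' \<otimes> A 1 0 0" by (simp add: Y'_def A_mult)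
    then show ?thesis by (simp add: A_def[of 1 0 0])
  qed
  show "X \<otimes> z' = z' \<otimes> X [^] (1 + 2 * int P * l)"
  proof -
    have "X \<otimes> z' = (X \<otimes> z) \<otimes> X [^] (- l)" by (simp add: z'_def m_assoc)
    also have "\<dots> = z \<otimes> (X [^] \<alpha> \<otimes> X [^] (- l))" by (simp add: Xz' m_assoc)
    also have "\<dots> = z' \<otimes> X [^] \<alpha>"
      by (simp add: z'_def m_assoc int_pow_comm_add[of X \<alpha>])
    finally show ?thesis by (simp add: \<alpha>_def p_def)
  qed
  show "z' \<otimes> Y' = Y' [^] (1 + 2 * int P * l) \<otimes> z'"
  proof -
    have "z' \<otimes> Y' = z \<otimes> (Y [^] (1::int) \<otimes> A (- (p * l) - l) 0 (- 1))"
      by (simp only: z'_def Y'_def m_assoc A_X A_Y A_mult A_closed z)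
        (intro arg_cong[where f = "(\<otimes>) z"] A_eqI; simp)
    also have "\<dots> = (z \<otimes> Y [^] (1::int)) \<otimes> A (- (p * l) - l) 0 (- 1)" by (simp add: m_assoc)
    also have "\<dots> = Y [^] \<alpha> \<otimes> z \<otimes> A (- (p * l) - l) 0 (- 1)" unfolding z_Y_pow by simp
    finally have 1: "z' \<otimes> Y' = Y [^] \<alpha> \<otimes> z \<otimes> A (- (p * l) - l) 0 (- 1)" .
    have "Y' [^] \<alpha> \<otimes> z' = Y [^] \<alpha> \<otimes> (A (- (p * l) * \<alpha>) 0 (- \<alpha>) \<otimes> z) \<otimes> X [^] (- l)"
      by (simp add: Y'_def z'_def A_pow A_Y A_mult m_assoc[symmetric])
    also have "\<dots> = Y [^] \<alpha> \<otimes> z \<otimes> (A (- (p * l) * \<alpha> * \<alpha>) 0 (- \<alpha>) \<otimes> X [^] (- l))"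
      unfolding A_z by (simp add: m_assoc)
    also have "A (- (p * l) * \<alpha> * \<alpha>) 0 (- \<alpha>) \<otimes> X [^] (- l) = A (- (p * l) * \<alpha> * \<alpha> - l) 0 (- \<alpha>)"
      by (simp add: A_X A_mult)
    also have "\<dots> = A (- (p * l) - l) 0 (- \<alpha>)"
      by (rule A_cong) (simp add: \<alpha>_def algebra_simps)
    also have "\<dots> = A (- (p * l) - l) 0 (- 1)"
      unfolding A_def using w_cong[of "- \<alpha>" "- 1"] by (simp add: \<alpha>_def)
    finally show ?thesis using 1 by (simp add: \<alpha>_def p_def)
  qed
  show "Y' [^] int P = X [^] (- int P)"
  proof -
    have "Y' [^] p = A (- (p * l) * p) (p * 1 + 0) (p * (-1) + 0)"
      by (simp add: Y'_def A_pow)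
    also have "\<dots> = A (- (p * l) * p - p - p * p) 0 0"
      unfolding A_reduce A_w_reduce by (intro A_eqI; simp)
    also have "\<dots> = A (- p) 0 0"
    proof (rule A_cong)
      \<comment> \<open>The exponents differ by \<open>- p p (l + 1)\<close>, a multiple of
        \<open>2 p p\<close> because \<open>l\<close> is odd.\<close>
      obtain l' where "l = 2 * l' + 1" using l by (auto elim: oddE)
      then show "2 * p * p dvd - (p * l) * p - p - p * p - - p" by (simp add: algebra_simps)
    qed
    finally show ?thesis by (simp add: A_X p_def)
  qed
  show "z' [^] (2 * int P * int P) = X [^] (int P * int P)"
  proof -
    have "z' [^] (2 * p * p) = A (- 2 * p * l * p) 0 (p * 1 + 0)"
    proof -
      have "z' [^] (2 * p * p) = (z' [^] (2 * p)) [^] p" by (simp add: int_pow_pow)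
      then show ?thesis by (simp add: z'_w A_pow)
    qed
    also have "\<dots> = A (- 2 * p * l * p + p * p) 0 0" by (simp only: A_w_reduce) simp
    also have "\<dots> = A (p * p) 0 0" by (rule A_cong) (simp add: algebra_simps)
    finally show ?thesis by (simp add: A_X p_def)
  qed
qed (use P l pow_X in simp_all)

section \<open>Iterating conjugation by \<open>x\<close>: the \<open>2P\<close>-th iterate is
  conjugation by \<open>X\<close>\<close>

context
  fixes f assumes f: "f \<in> hom G G" and f_X: "f X = X" and f_Y: "f Y = Y'" and f_z: "f z = z'"
begin

interpretation f: group_hom G G f
  by unfold_locales (rule f)

lemma shift_pow_X: "(f ^^ k) X = X"
  by (induction k) (simp_all add: f_X)

lemma shift_pow_z: "(f ^^ k) z = z \<otimes> X [^] (- l * int k)"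
  by (induction k)
    (simp_all add: f.hom_int_pow f_X f_z z'_def m_assoc algebra_simps flip: int_pow_mult)

lemma shift_A: "f (A i 1 k) = A (i - p * l - 2 * p * l * k) 1 (k - 1)"
proof -
  have "f w = A (- 2 * p * l) 0 1"
    unfolding w_def by (simp add: f.hom_int_pow f_z z'_w)
  then have "f (A i 1 k) = X [^] i \<otimes> Y' \<otimes> A (- 2 * p * l) 0 1 [^] k"
    by (simp add: A_def[of i 1 k] f.hom_int_pow f_X f_Y)
  then show ?thesis by (simp add: Y'_def A_pow A_X A_mult)
qed

text \<open>Each iteration adds \<open>X^(-pl) w^-1\<close>, and the power of \<open>w\<close>
  already present is twisted by \<open>X^(-2pl)\<close> per factor; these twists sum to a triangular
  number.\<close>

lemma shift_pow_Y: "(f ^^ k) Y = A (- p * l * int k + 2 * p * l * tri (int k)) 1 (- int k)"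
proof (induction k)
  case 0
  show ?case using A_Y[of 1] by simp
next
  case (Suc k)
  have "tri (int (Suc k)) = tri (int k) + int k"
    using tri_add[of 1 "int k"] by simp
  then show ?case
    by (simp only: funpow.simps comp_apply Suc shift_A) (intro A_eqI; simp add: algebra_simps)
qed

lemma shift_conj_X: "X \<otimes> X = X \<otimes> (f ^^ (2 * P)) X"
  by (simp add: shift_pow_X)

lemma shift_conj_z: "z \<otimes> X = X \<otimes> (f ^^ (2 * P)) z"
proof -
  have "X \<otimes> (f ^^ (2 * P)) z = (X \<otimes> z) \<otimes> X [^] (- l * (2 * p))"
    by (simp add: shift_pow_z p_def m_assoc)
  also have "\<dots> = z \<otimes> X [^] (1::int)"
    by (simp add: Xz' m_assoc \<alpha>_def flip: int_pow_mult)
  finally show ?thesis by simp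
qed

lemma shift_conj_Y: "Y \<otimes> X = X \<otimes> (f ^^ (2 * P)) Y"
proof -
  have "(f ^^ (2 * P)) Y = A (- p * l * (2 * p) + 2 * p * l * tri (2 * p)) 1 (- (2 * p))"
    by (simp add: shift_pow_Y p_def)
  also have "\<dots> = A 0 1 (- (2 * p))"
    unfolding tri_2p by (rule A_cong) (simp add: algebra_simps)
  also have "\<dots> = A 0 1 0"
    unfolding A_def using w_cong[of "- (2 * p)" 0] by simp
  finally show ?thesis by (simp add: A_def XY)
qed

end

definition X' :: 'a where "X' = A 1 (- (p * l)) 1"

lemma X'_closed [simp]: "X' \<in> carrier G"
  by (simp add: X'_def)

end

text \<open>Modulo \<open>c^2\<close> the sum is that of \<open>i\<close> plus \<open>c\<close>
  times that of \<open>i^2\<close>. The first is \<open>2 p p - p\<close>, the source of the summand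
  \<open>p\<close>; the second is divisible by \<open>p\<close> by the formula for square sums. The
  weighted sum is the exponent of \<open>X\<close> after conjugating \<open>y\<close> by
  \<open>x\<close> \<open>2P\<close> times.\<close>

lemma weighted_geo_sum:
  fixes c :: int
  assumes "m \<ge> 2" and p: "p = 2 ^ (m - 1)" and P: "int P = p" and c: "2 * p dvd c"
  shows "2 * p * p dvd (\<Sum>i<2 * P. int i * (1 + c) ^ i) + p"
proof -
  have cc: "2 * p * p dvd c * c"
  proof -
    have "2 * p * (2 * p) dvd c * c" using c by (intro mult_dvd_mono)
    moreover have "2 * p * (2 * p) = 2 * p * p * 2" by simp
    ultimately show ?thesis by (metis dvd_mult_left)
  qed
  have sum: "(\<Sum>i<n. int i) = tri (int n)" "6 * (\<Sum>i<n. int i * int i) = (int n - 1) * int n * (2 * int n - 1)" for n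
  proof (induction n)
    case (Suc n)
    { case 1 show ?case using Suc tri_add[of 1 "int n"] by simp }
    { case 2 show ?case using Suc(2) by (simp add: algebra_simps) }
  qed simp_all
  define S where "S = (\<Sum>i<2 * P. int i * int i)"
  have "p dvd S"
  proof -
    have "6 * S = (2 * p - 1) * (2 * p) * (4 * p - 1)"
      unfolding S_def using sum(2)[of "2 * P"] P by simp
    then have "3 * S = p * ((2 * p - 1) * (4 * p - 1))" by simp
    then have "p dvd 3 * S" by simp
    moreover have "coprime p 3" unfolding p by simp
    ultimately show ?thesis by (simp add: coprime_dvd_mult_right_iff)
  qed
  then have S: "2 * p * p dvd c * S" using mult_dvd_mono[OF c] by blast
  have "(\<Sum>i<2 * P. int i * (1 + c) ^ i) + p
      = (\<Sum>i<2 * P. int i * ((1 + c) ^ i - 1 - int i * c)) + (\<Sum>i<2 * P. int i) + c * S + p"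
    unfolding S_def sum_distrib_left
    by (simp add: algebra_simps flip: sum.distrib)
  also have "(\<Sum>i<2 * P. int i) = p * (2 * p - 1)"
    unfolding sum(1) using P by (intro triI) simp
  finally have eq: "(\<Sum>i<2 * P. int i * (1 + c) ^ i) + p
      = (\<Sum>i<2 * P. int i * ((1 + c) ^ i - 1 - int i * c)) + 2 * p * p + c * S"
    by (simp add: algebra_simps)
  have "2 * p * p dvd (\<Sum>i<2 * P. int i * ((1 + c) ^ i - 1 - int i * c))"
    by (intro dvd_sum dvd_mult) (use power_linear_cong cc dvd_trans in blast)
  then show ?thesis unfolding eq using S by (intro dvd_add) auto
qed

locale power_relations_y = power_relations +
  fixes y :: 'a
  assumes y [simp]: "y \<in> carrier G"
    and y_pow: "y [^] (2 * int P) = Y"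
    and zy: "z \<otimes> y = y [^] (1 + 2 * int P * l) \<otimes> z"
    and Xy: "X \<otimes> y = y \<otimes> power_relations.X' G X Y z P l"
begin

lemma zy': "z \<otimes> y = y \<otimes> (Y [^] l \<otimes> z)"
proof -
  have "y [^] (1 + 2 * int P * l) = y \<otimes> (y [^] (2 * int P)) [^] l"
    by (simp add: int_pow_mult int_pow_pow)
  then show ?thesis using zy by (simp add: y_pow m_assoc)
qed

lemma y_pow': "y [^] (2 * p * i) = Y [^] i"
  by (simp add: y_pow p_def flip: int_pow_pow)

lemma y_cong: "4 * p * p * p dvd i - j \<Longrightarrow> y [^] i = y [^] j"
proof (rule int_pow_cong[OF y])
  have "y [^] (2 * p * (2 * p * p)) = \<one>" unfolding y_pow' by (rule pow_Y)
  moreover have "2 * p * (2 * p * p) = 4 * p * p * p" by simp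
  ultimately show "y [^] (4 * p * p * p) = \<one>" by simp
qed

definition y' :: 'a where "y' = y \<otimes> inv z"

lemma y'_closed [simp]: "y' \<in> carrier G"
  by (simp add: y'_def)

lemma y'_pow: "y' [^] (2 * int P) = Y'"
proof -
  \<comment> \<open>The inverse has the shape \<open>a b\<close> with
    \<open>b a = a^\<alpha> b\<close>, so \<open>mult_pow_geo\<close> applies with \<alpha> itself
    instead of an inverse of \<alpha> modulo the order of \<open>y\<close>.\<close>
  have inv: "inv y' = y [^] (- \<alpha>) \<otimes> z"
  proof -
    have "inv y' = z \<otimes> inv y" by (simp add: y'_def inv_mult_group)
    also have "z \<otimes> y [^] (-1::int) = y [^] (-1 * \<alpha>) \<otimes> z"
      using swap_pow_left[OF y z, of \<alpha> 1 "-1"] zy by (simp add: \<alpha>_def p_def)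
    then have "z \<otimes> inv y = y [^] (- \<alpha>) \<otimes> z" by (simp add: int_pow_neg)
    finally show ?thesis .
  qed
  have za: "z \<otimes> y [^] (- \<alpha>) = (y [^] (- \<alpha>)) [^] \<alpha> \<otimes> z"
    using swap_pow_left[OF y z, of \<alpha> 1 "- \<alpha>"] zy by (simp add: \<alpha>_def p_def int_pow_pow)
  have "inv y' [^] (2 * P) = (y [^] (- \<alpha>)) [^] geo \<alpha> (2 * P) \<otimes> z [^] (2 * P)"
    unfolding inv by (rule mult_pow_geo[OF _ z za]) simp
  also have "(y [^] (- \<alpha>)) [^] geo \<alpha> (2 * P) = y [^] (2 * p * (- (1 + p * l)))"
  proof -
    obtain m where m: "m \<ge> 2" "2 * p = 2 ^ m" "4 * p * p * p = 2 ^ (3 * m - 1)" by (rule m_ex)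
    have "2 ^ (2 * m + m - 1) dvd geo (1 + 2 * p * l) (2 * P) - int (2 * P) - (2 * p * l) * tri (int (2 * P))"
      by (rule geo_cong[OF m(1)]) (simp_all add: m(2)[symmetric] p_def)
    moreover have "2 * m + m - 1 = 3 * m - 1" by simp
    ultimately have "4 * p * p * p dvd geo \<alpha> (2 * P) - 2 * p - (2 * p * l) * tri (2 * p)"
      unfolding m(3) \<alpha>_def by (simp add: p_def)
    then obtain t where "geo \<alpha> (2 * P) - 2 * p - (2 * p * l) * tri (2 * p) = 4 * p * p * p * t"
      by blast
    then have geo: "geo \<alpha> (2 * P) = 4 * p * p * p * t + 2 * p + (2 * p * l) * (p * (2 * p - 1))"
      unfolding tri_2p by linarith
    have "- \<alpha> * geo \<alpha> (2 * P) - 2 * p * (- (1 + p * l))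
        = - \<alpha> * (4 * p * p * p * t + 2 * p + (2 * p * l) * (p * (2 * p - 1))) + 2 * p * (1 + p * l)"
      unfolding geo by (simp only: mult_minus_right diff_minus_eq_add)
    also have "\<dots> = 4 * p * p * p * (- \<alpha> * t - l - l * l * (2 * p - 1))"
      by (simp add: \<alpha>_def algebra_simps)
    finally have "4 * p * p * p dvd - \<alpha> * geo \<alpha> (2 * P) - 2 * p * (- (1 + p * l))" by simp
    then show ?thesis by (simp add: int_pow_pow y_cong)
  qed
  also have "y [^] (2 * p * (- (1 + p * l))) \<otimes> z [^] (2 * P) = A 0 (- (1 + p * l)) 1"
    unfolding y_pow' by (simp add: A_def w_nat)
  also have "inv y' [^] (2 * P) = inv (y' [^] (2 * P))"
    by (simp add: nat_pow_inv)
  finally have "inv (inv (y' [^] (2 * P))) = inv (A 0 (- (1 + p * l)) 1)" by simp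
  then have "y' [^] (2 * P) = A 0 (p * l + 1) (- 1)"
    by (simp add: A_inv add.commute)
  also have "\<dots> = Y'" unfolding A_reduce by (simp add: Y'_def)
  finally show ?thesis by (simp flip: int_pow_int)
qed

sublocale shifted: power_relations G X Y' z' P l
  by (rule relations_shift)

lemma shifted_X': "shifted.X' = A (1 + p * l - 2 * p * l) 0 1"
proof -
  have w': "shifted.w = A (- 2 * p * l) 0 1"
    by (simp add: shifted.w_def z'_w)
  have "shifted.X' = X [^] (1::int) \<otimes> Y' [^] (- (p * l)) \<otimes> shifted.w [^] (1::int)"
    by (simp only: shifted.X'_def shifted.A_def)
  also have "\<dots> = A (1 + p * l * (p * l) - 2 * p * l) (p * (- l) + 0) (p * l + 1)"
    by (simp only: w' Y'_def A_pow A_X A_mult) (intro A_eqI; simp)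
  also have "\<dots> = A (1 + p * l * (p * l) - 2 * p * l + p * l + p * p * l) 0 1"
    unfolding A_reduce A_w_reduce by (intro A_eqI; simp)
  also have "\<dots> = A (1 + p * l - 2 * p * l) 0 1"
  proof (rule A_cong)
    \<comment> \<open>Supplies the factor 2 that \<open>p p l (l + 1)\<close> needs to vanish as an
      exponent of \<open>X\<close>.\<close>
    have "even (l * (l + 1))" by simp
    then obtain t where t: "l * (l + 1) = 2 * t" by blast
    have "1 + p * l * (p * l) - 2 * p * l + p * l + p * p * l - (1 + p * l - 2 * p * l) = p * p * (l * (l + 1))"
      by (simp add: algebra_simps)
    then show "2 * p * p dvd 1 + p * l * (p * l) - 2 * p * l + p * l + p * p * l - (1 + p * l - 2 * p * l)"
      unfolding t by simp
  qed
  finally show ?thesis .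
qed

text \<open>The analogue of \<open>relations_shift\<close> one layer higher; it makes conjugation by
  \<open>x\<close> an endomorphism of the group generated by \<open>X\<close>, \<open>Y\<close>,
  \<open>z\<close>, \<open>y\<close>.\<close>

theorem relations_y_shift: "power_relations_y G X Y' z' P l y'"
proof unfold_locales
  show "y' [^] (2 * int P) = Y'" by (rule y'_pow)
  show "X \<otimes> y' = y' \<otimes> shifted.X'"
  proof -
    have X'_eq: "X' = A (1 + p * l) 0 1"
      unfolding X'_def using A_reduce[of 1 "- l" 0 1] by simp
    have "A (1 + p * l - 2 * p * l) 0 1 \<otimes> z = z \<otimes> A ((1 + p * l - 2 * p * l) * \<alpha>) 0 1"
      by (rule A_z)
    also have "A ((1 + p * l - 2 * p * l) * \<alpha>) 0 1 = X'"
      unfolding X'_eq by (rule A_cong) (simp add: \<alpha>_def algebra_simps)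
    finally have "shifted.X' \<otimes> z = z \<otimes> X'" by (simp add: shifted_X')
    then have "X' \<otimes> inv z = inv z \<otimes> shifted.X'"
      by (intro inv_swap[symmetric]) simp_all
    then have "y \<otimes> (X' \<otimes> inv z) = y \<otimes> (inv z \<otimes> shifted.X')" by simp
    then show ?thesis
      by (simp add: y'_def m_assoc[symmetric] Xy)
  qed
  show "z' \<otimes> y' = y' [^] (1 + 2 * int P * l) \<otimes> z'"
  proof -
    have 1: "z' \<otimes> y' = y \<otimes> (Y [^] l \<otimes> z \<otimes> X' [^] (- l) \<otimes> inv z)"
    proof -
      have "X [^] (- l) \<otimes> y = y \<otimes> X' [^] (- l)"
        by (rule swap_int_pow) (simp_all add: Xy)
      then have "z' \<otimes> y' = z \<otimes> y \<otimes> X' [^] (- l) \<otimes> inv z"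
        by (simp add: z'_def y'_def m_assoc[symmetric]) (simp add: m_assoc)
      then show ?thesis by (simp add: zy' m_assoc)
    qed
    have 2: "y' [^] (1 + 2 * int P * l) \<otimes> z' = y \<otimes> (inv z \<otimes> Y' [^] l \<otimes> z \<otimes> X [^] (- l))"
    proof -
      have "y' [^] (1 + 2 * int P * l) = y' \<otimes> Y' [^] l"
        by (simp add: int_pow_mult y'_pow flip: int_pow_pow)
      then show ?thesis by (simp add: y'_def z'_def m_assoc)
    qed
    have zz: "X [^] i \<otimes> (z \<otimes> z) = z \<otimes> z \<otimes> X [^] (i * \<alpha> * \<alpha>)" for i
      using X_pow_z[of i] X_pow_z[of "i * \<alpha>"] by (simp add: m_assoc[symmetric]) (simp add: m_assoc)
    \<comment> \<open>After cancelling \<open>y\<close>, the relation says that \<open>z\<close>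
      carries one expression to the other. Both sides are brought to the form \<open>Y^l z z\<close>
      times an exponent vector, and the vectors are compared modulo \<open>2 p p\<close>.\<close>
    have "z \<otimes> (Y [^] l \<otimes> z \<otimes> X' [^] (- l)) = (Y' [^] l \<otimes> z \<otimes> X [^] (- l)) \<otimes> z"
    proof -
      have "z \<otimes> (Y [^] l \<otimes> z \<otimes> X' [^] (- l)) = (z \<otimes> Y [^] l) \<otimes> z \<otimes> X' [^] (- l)"
        by (simp add: m_assoc)
      also have "\<dots> = Y [^] (l * \<alpha>) \<otimes> (z \<otimes> z) \<otimes> X' [^] (- l)"
        unfolding z_Y_pow by (simp add: m_assoc)
      also have "Y [^] (l * \<alpha>) = Y [^] l \<otimes> X [^] (- 2 * p * l * l)"
        using Y_p[of "2 * l * l"] by (simp add: \<alpha>_def algebra_simps int_pow_mult)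
      also have "Y [^] l \<otimes> X [^] (- 2 * p * l * l) \<otimes> (z \<otimes> z) \<otimes> X' [^] (- l)
          = Y [^] l \<otimes> X [^] (- 2 * p * l * l) \<otimes> (z \<otimes> z) \<otimes> A (- l - p * l * l) 0 (- l)"
        unfolding X'_def A_pow using A_reduce[of "- l" "l * l" 0 "- l"] by (simp add: algebra_simps)
      also have "Y [^] l \<otimes> X [^] (- 2 * p * l * l) \<otimes> (z \<otimes> z) \<otimes> A (- l - p * l * l) 0 (- l)
          = Y [^] l \<otimes> (z \<otimes> z) \<otimes> (A (- 2 * p * l * l * \<alpha> * \<alpha>) 0 0 \<otimes> A (- l - p * l * l) 0 (- l))"
        using zz[of "- 2 * p * l * l"] by (simp add: m_assoc A_X)
      also have "A (- 2 * p * l * l * \<alpha> * \<alpha>) 0 0 \<otimes> A (- l - p * l * l) 0 (- l)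
          = A (- 2 * p * l * l * \<alpha> * \<alpha> - l - p * l * l) 0 (- l)"
        unfolding A_mult by (intro A_eqI; simp)
      also have "\<dots> = A (- (p * l * l) * \<alpha> * \<alpha> - l * \<alpha>) 0 (- l)"
        by (rule A_cong) (simp add: \<alpha>_def algebra_simps)
      finally have L: "z \<otimes> (Y [^] l \<otimes> z \<otimes> X' [^] (- l))
          = Y [^] l \<otimes> (z \<otimes> z) \<otimes> A (- (p * l * l) * \<alpha> * \<alpha> - l * \<alpha>) 0 (- l)" .
      have "(Y' [^] l \<otimes> z \<otimes> X [^] (- l)) \<otimes> z = Y' [^] l \<otimes> (z \<otimes> (X [^] (- l) \<otimes> z))"
        by (simp add: m_assoc)
      also have "\<dots> = Y [^] l \<otimes> (A (- (p * l * l)) 0 (- l) \<otimes> z) \<otimes> z \<otimes> X [^] (- l * \<alpha>)"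
        unfolding X_pow_z Y'_def A_pow by (simp add: A_Y A_mult m_assoc[symmetric] mult_ac)
      also have "\<dots> = Y [^] l \<otimes> z \<otimes> (A (- (p * l * l) * \<alpha>) 0 (- l) \<otimes> z) \<otimes> X [^] (- l * \<alpha>)"
        unfolding A_z[of "- (p * l * l)"] by (simp add: m_assoc)
      also have "\<dots> = Y [^] l \<otimes> (z \<otimes> z) \<otimes> (A (- (p * l * l) * \<alpha> * \<alpha>) 0 (- l) \<otimes> X [^] (- l * \<alpha>))"
        unfolding A_z by (simp add: m_assoc)
      also have "A (- (p * l * l) * \<alpha> * \<alpha>) 0 (- l) \<otimes> X [^] (- l * \<alpha>)
          = A (- (p * l * l) * \<alpha> * \<alpha> - l * \<alpha>) 0 (- l)"
        by (simp add: A_X A_mult)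
      finally show ?thesis using L by simp
    qed
    then have "inv z \<otimes> (Y' [^] l \<otimes> z \<otimes> X [^] (- l)) = Y [^] l \<otimes> z \<otimes> X' [^] (- l) \<otimes> inv z"
      by (intro inv_swap) simp_all
    then have "Y [^] l \<otimes> z \<otimes> X' [^] (- l) \<otimes> inv z = inv z \<otimes> Y' [^] l \<otimes> z \<otimes> X [^] (- l)"
      by (simp add: m_assoc)
    then show ?thesis by (simp add: 1 2)
  qed
qed simp

text \<open>The \<open>k\<close>-th iterate takes \<open>y\<close> to \<open>y X^(e k) z^-k\<close>.
  At \<open>k = 2P\<close> the correction is \<open>X^(-pl) w^-1\<close> by
  \<open>weighted_geo_sum\<close>, exactly what cancels the difference between \<open>X'\<close> and
  \<open>X\<close> in \<open>X y = y X'\<close>.\<close>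

lemma shift_conj_y:
  assumes f: "f \<in> hom G G" and f_X: "f X = X" and f_Y: "f Y = Y'" and f_z: "f z = z'"
    and f_y: "f y = y'"
  shows "y \<otimes> X = X \<otimes> (f ^^ (2 * P)) y"
proof -
  interpret f: group_hom G G f by unfold_locales (rule f)
  have fk: "(f ^^ k) \<in> hom G G" for k
    by (induction k) (use f in \<open>auto simp: hom_def Pi_iff\<close>)
  define e where "e k = l * (\<Sum>i<k. int i * \<alpha> ^ i)" for k
  have "(f ^^ k) y = y \<otimes> X [^] e k \<otimes> inv (z [^] k)" for k
  proof (induction k)
    case (Suc k)
    interpret fk: group_hom G G "f ^^ k" by unfold_locales (rule fk)
    have "(f ^^ Suc k) y = (f ^^ k) y \<otimes> inv ((f ^^ k) z)"
      by (simp add: funpow_Suc_right f_y y'_def del: funpow.simps)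
    also have "\<dots> = y \<otimes> X [^] e k \<otimes> (inv (z [^] k) \<otimes> X [^] (l * int k)) \<otimes> inv z"
      unfolding shift_pow_z[OF f f_X f_Y f_z] Suc
      by (simp add: inv_mult_group int_pow_neg m_assoc)
    also have "inv (z [^] k) \<otimes> X [^] (l * int k) = X [^] (l * int k * \<alpha> ^ k) \<otimes> inv (z [^] k)"
      by (rule inv_swap) (use swap_pow[OF X z Xz', of "l * int k" k] in simp_all)
    also have "y \<otimes> X [^] e k \<otimes> (X [^] (l * int k * \<alpha> ^ k) \<otimes> inv (z [^] k)) \<otimes> inv z
        = y \<otimes> (X [^] e k \<otimes> X [^] (l * int k * \<alpha> ^ k)) \<otimes> (inv (z [^] k) \<otimes> inv z)"
      by (simp add: m_assoc)
    also have "X [^] e k \<otimes> X [^] (l * int k * \<alpha> ^ k) = X [^] e (Suc k)"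
      by (simp add: e_def algebra_simps flip: int_pow_mult)
    also have "inv (z [^] k) \<otimes> inv z = inv (z [^] Suc k)"
      by (metis inv_mult_group nat_pow_Suc2 nat_pow_closed z)
    finally show ?case .
  qed (simp add: e_def)
  then have "(f ^^ (2 * P)) y = y \<otimes> X [^] e (2 * P) \<otimes> inv w"
    by (simp add: w_nat)
  also have "X [^] e (2 * P) = X [^] (- (p * l))"
  proof (rule X_cong)
    obtain m where m: "m \<ge> 2" "p = 2 ^ (m - 1)" by (rule m_ex)
    have "2 * p * p dvd (\<Sum>i<2 * P. int i * (1 + 2 * p * l) ^ i) + p"
      by (rule weighted_geo_sum[OF m]) (simp_all add: p_def)
    then have "2 * p * p dvd l * ((\<Sum>i<2 * P. int i * \<alpha> ^ i) + p)"
      unfolding \<alpha>_def by (rule dvd_mult)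
    then show "2 * p * p dvd e (2 * P) - - (p * l)"
      by (simp add: e_def algebra_simps)
  qed
  finally have "X \<otimes> (f ^^ (2 * P)) y = (X \<otimes> y) \<otimes> (X [^] (- (p * l)) \<otimes> w [^] (-1::int))"
    by (simp add: m_assoc int_pow_neg)
  also have "\<dots> = y \<otimes> (A 1 (p * (- l) + 0) 1 \<otimes> (A (- (p * l)) 0 0 \<otimes> A 0 0 (- 1)))"
    by (simp add: Xy m_assoc X'_def A_X A_w)
  also have "A 1 (p * (- l) + 0) 1 \<otimes> (A (- (p * l)) 0 0 \<otimes> A 0 0 (- 1)) = A 1 0 0"
    unfolding A_reduce by (simp add: A_mult)
  finally show ?thesis by (simp add: A_def)
qed

end

section \<open>A model of the group $J_2(\alpha)$\<close>

context power_relations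
begin

lemma X'_eq: "X' = X \<otimes> Y [^] (- (int P * l)) \<otimes> z [^] (2 * int P)"
  by (simp add: X'_def A_def w_def p_def)

lemma swap_Y': "power_relations.Y' G Y X (inv z) P l = X'"
proof -
  interpret sw: power_relations G Y X "inv z" P l by (rule relations_swap)
  have "sw.w [^] (-1::int) = w [^] (1::int)"
    by (simp add: sw.w_def w_def int_pow_inv int_pow_neg)
  then have "sw.Y' = A 0 (- (p * l)) 0 \<otimes> A 1 0 0 \<otimes> A 0 0 1"
    unfolding sw.Y'_def sw.A_def by (simp add: A_def)
  also have "\<dots> = X'" by (simp add: A_mult X'_def)
  finally show ?thesis .
qed

text \<open>Swap, shift, swap back: conjugation by \<open>y\<close> is conjugation by
  \<open>x\<close> seen through the symmetry.\<close>

lemma relations_swap_shift: "power_relations G X' Y (inv (inv z \<otimes> Y [^] (- l))) P l"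
proof -
  interpret sw: power_relations G Y X "inv z" P l by (rule relations_swap)
  have "power_relations G Y sw.Y' sw.z' P l" by (rule sw.relations_shift)
  then have "power_relations G sw.Y' Y (inv sw.z') P l" by (rule power_relations.relations_swap)
  then show ?thesis unfolding swap_Y' sw.z'_def .
qed

lemma inv_swap_z': "inv (inv z \<otimes> Y [^] (- l)) = Y [^] l \<otimes> z"
  by (simp add: inv_mult_group int_pow_neg)

lemma swap_shift_conj:
  assumes f: "f \<in> hom G G" and f_X: "f X = X'" and f_Y: "f Y = Y" and f_z: "f z = Y [^] l \<otimes> z"
    and a: "a \<in> {X, Y, z}"
  shows "a \<otimes> Y = Y \<otimes> (f ^^ (2 * P)) a"
proof -
  interpret f: group_hom G G f by unfold_locales (rule f)
  interpret sw: power_relations G Y X "inv z" P l by (rule relations_swap)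
  have "f (inv z) = sw.z'"
    unfolding sw.z'_def by (simp add: f_z inv_mult_group int_pow_neg)
  note f' = f f_Y f_X[folded swap_Y'] this
  have fk: "(f ^^ k) \<in> hom G G" for k
    by (induction k) (use f in \<open>auto simp: hom_def Pi_iff\<close>)
  \<comment> \<open>The symmetry speaks about \<open>z^-1\<close>; passing to the subgroup it
    generates transfers the identity to \<open>z\<close>.\<close>
  have "b \<otimes> Y = Y \<otimes> (f ^^ (2 * P)) b" if "b \<in> generate G {inv z}" for b
    using hom_conj_generate[OF is_group _ fk Y, of id "{inv z}" "2 * P"] that sw.shift_conj_z[OF f']
    by (simp add: id_def hom_def)
  moreover have "inv (inv z) \<in> generate G {inv z}" by (rule generate.inv) simp
  ultimately have "z \<otimes> Y = Y \<otimes> (f ^^ (2 * P)) z" by simp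
  then show ?thesis
    using a sw.shift_conj_X[OF f'] sw.shift_conj_Y[OF f'] by auto
qed

lemma relations_hom:
  assumes "group H" "h \<in> hom G H"
  shows "power_relations H (h X) (h Y) (h z) P l"
proof -
  interpret H: group H by fact
  interpret h: group_hom G H h by unfold_locales fact
  have eq: "h a = h b" if "a = b" for a b using that by simp
  show ?thesis
    by unfold_locales
      (use P l eq[OF XY] eq[OF Xz] eq[OF zY] eq[OF pow_X] eq[OF Y_P] eq[OF z_PP] in
        \<open>simp_all add: h.hom_int_pow\<close>)
qed

lemma hom_X':
  assumes "group H" "h \<in> hom G H"
  shows "power_relations.X' H (h X) (h Y) (h z) P l = h X'"
proof -
  interpret H: group H by fact
  interpret h: group_hom G H h by unfold_locales fact
  interpret cH: power_relations H "h X" "h Y" "h z" P l by (rule relations_hom[OF assms])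
  show ?thesis by (simp add: cH.X'_eq X'_eq h.hom_int_pow)
qed

end

section \<open>The tower of cyclic extensions \<open>G1\<close> to \<open>G5\<close>\<close>

definition unit_group :: "unit monoid" where
  "unit_group = \<lparr>carrier = {()}, monoid.mult = (\<lambda>_ _. ()), one = ()\<rparr>"

lemma group_unit_group: "group unit_group"
  by (rule groupI) (auto simp: unit_group_def)

lemma id_hom: "(\<lambda>a. a) \<in> hom G G"
  by (simp add: hom_def)

text \<open>\<open>g\<close> inverts \<alpha> modulo the exponent of \<open>X\<close> and
  \<open>Y\<close>, so that the action of \<open>z\<close> on \<open>Y\<close> is a power
  map.\<close>

locale macdonald_model =
  fixes P :: nat and l g :: int
  assumes P: "\<exists>m\<ge>2. P = 2 ^ (m - 1)" and l: "odd l"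
    and g: "2 * int P * int P dvd g * (1 + 2 * int P * l) - 1"
begin

abbreviation "\<alpha> \<equiv> 1 + 2 * int P * l"

lemma P_gt: "P > 1"
proof -
  obtain m where m: "m \<ge> 2" "P = 2 ^ (m - 1)" using P by blast
  have "(1::nat) < 2 ^ (m - 1)" by (rule one_less_power) (use m in auto)
  then show ?thesis using m(2) by simp
qed

lemma PP_gt: "2 * P * P > 1"
proof -
  have "2 * 1 * 1 \<le> 2 * P * P" by (intro mult_le_mono) (use P_gt in auto)
  then show ?thesis by linarith
qed

lemma g_cong: "2 * int P dvd g - 1"
proof -
  have "2 * int P dvd g * \<alpha> - 1" using g by (metis dvd_mult_left)
  moreover have "g - 1 = (g * \<alpha> - 1) - 2 * int P * (l * g)" by (simp add: algebra_simps)
  ultimately show ?thesis by (metis dvd_diff dvd_triv_left)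
qed

definition "G1 = cyc_ext unit_group (\<lambda>a. a) (2 * P * P) ()"
definition "X1 = cyc_gen unit_group"

lemma E1: "cyclic_extension unit_group (\<lambda>a. a) (2 * P * P) ()"
proof -
  interpret group unit_group by (rule group_unit_group)
  show ?thesis
  proof unfold_locales
    show "() \<in> carrier unit_group" by (simp add: unit_group_def)
    show "(\<lambda>a. a) \<in> hom unit_group unit_group" by (rule id_hom)
  qed (use PP_gt in simp_all)
qed

interpretation E1: cyclic_extension unit_group "\<lambda>a. a" "2 * P * P" "()"
  rewrites "cyc_ext unit_group (\<lambda>a. a) (2 * P * P) () = G1" and "cyc_gen unit_group = X1"
  by (rule E1) (simp_all add: G1_def X1_def)

lemma gen1: "generate G1 {X1} = carrier G1"
proof -
  have "generate unit_group {} = carrier unit_group"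
    using E1.K.generate_empty by (simp add: unit_group_def)
  from E1.generate_E[OF _ this] show ?thesis by simp
qed

lemma hom1:
  assumes "group H" "X \<in> carrier H" "X [^]\<^bsub>H\<^esub> (2 * P * P) = \<one>\<^bsub>H\<^esub>"
  obtains f where "f \<in> hom G1 H" "f X1 = X"
proof -
  interpret H: group H by fact
  have "(\<lambda>_. \<one>\<^bsub>H\<^esub>) \<in> hom unit_group H" by (simp add: hom_def)
  moreover have "generate unit_group {} = carrier unit_group"
    using E1.K.generate_empty by (simp add: unit_group_def)
  ultimately show thesis
    using E1.hom_E[OF assms(1), of "\<lambda>_. \<one>\<^bsub>H\<^esub>" X "{}"] assms(2,3) that by auto
qed

text \<open>The prescribed value of \<open>Y^P\<close>. As \<open>Y^P\<close> is already a power of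
  \<open>X\<close>, this layer has index \<open>P\<close> only.\<close>

definition "u2 = X1 [^]\<^bsub>G1\<^esub> (- int P)"
definition "G2 = cyc_ext G1 (\<lambda>a. a) P u2"
definition "X2 = (cyc_emb X1 :: nat \<times> nat \<times> unit)"
definition "Y2 = cyc_gen G1"

lemma E2: "cyclic_extension G1 (\<lambda>a. a) P u2"
proof unfold_locales
  fix a assume "a \<in> carrier G1"
  have "a \<otimes>\<^bsub>G1\<^esub> u2 = u2 \<otimes>\<^bsub>G1\<^esub> a"
    using E1.E.hom_conj_generate[OF E1.E.is_group id_hom id_hom, of u2 "{X1}" a] \<open>a \<in> carrier G1\<close>
      E1.E.int_pow_comm_add[OF E1.gen_closed, of 1 "- int P"]
    by (simp add: gen1 u2_def)
  moreover have "((\<lambda>a. a) ^^ P) a = a" by (induction P) simp_all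
  ultimately show "a \<otimes>\<^bsub>G1\<^esub> u2 = u2 \<otimes>\<^bsub>G1\<^esub> ((\<lambda>a. a) ^^ P) a" by simp
qed (use P_gt id_hom in \<open>simp_all add: u2_def\<close>)

interpretation E2: cyclic_extension G1 "\<lambda>a. a" P u2
  rewrites "cyc_ext G1 (\<lambda>a. a) P u2 = G2" and "cyc_gen G1 = Y2"
  by (rule E2) (simp_all add: G2_def Y2_def)

lemma X2_closed [simp]: "X2 \<in> carrier G2"
  by (simp add: X2_def)

lemma gen2: "generate G2 {X2, Y2} = carrier G2"
  using E2.generate_E[OF _ gen1] by (simp add: X2_def insert_commute)

lemma X2Y2: "X2 \<otimes>\<^bsub>G2\<^esub> Y2 = Y2 \<otimes>\<^bsub>G2\<^esub> X2"
  using E2.emb_gen[OF E1.gen_closed] by (simp add: X2_def)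

lemma pow_X2: "X2 [^]\<^bsub>G2\<^esub> (2 * int P * int P) = \<one>\<^bsub>G2\<^esub>"
proof -
  have "X1 [^]\<^bsub>G1\<^esub> (2 * int P * int P) = X1 [^]\<^bsub>G1\<^esub> (2 * P * P)"
    by (metis int_pow_int of_nat_mult of_nat_numeral)
  also have "\<dots> = \<one>\<^bsub>G1\<^esub>" using E1.gen_pow_n by (metis E1.emb.hom_one unit_group_def monoid.select_convs(2))
  finally show ?thesis
    by (simp add: X2_def flip: E2.emb.hom_int_pow)
qed

lemma Y2_P: "Y2 [^]\<^bsub>G2\<^esub> int P = X2 [^]\<^bsub>G2\<^esub> (- int P)"
  using E2.gen_pow_n by (simp add: X2_def u2_def int_pow_int flip: E2.emb.hom_int_pow)

lemma hom2:
  assumes H: "group H" and X: "X \<in> carrier H" and Y: "Y \<in> carrier H"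
    and "X [^]\<^bsub>H\<^esub> (2 * int P * int P) = \<one>\<^bsub>H\<^esub>" "X \<otimes>\<^bsub>H\<^esub> Y = Y \<otimes>\<^bsub>H\<^esub> X"
    "Y [^]\<^bsub>H\<^esub> int P = X [^]\<^bsub>H\<^esub> (- int P)"
  obtains f where "f \<in> hom G2 H" "f X2 = X" "f Y2 = Y"
proof -
  interpret H: group H by fact
  have "X [^]\<^bsub>H\<^esub> (2 * P * P) = \<one>\<^bsub>H\<^esub>"
    using assms(4) by (metis int_pow_int of_nat_mult of_nat_numeral)
  then obtain f1 where f1: "f1 \<in> hom G1 H" "f1 X1 = X" using hom1[OF H X] by blast
  interpret f1: group_hom G1 H f1 by unfold_locales (rule f1)
  have "Y [^]\<^bsub>H\<^esub> P = f1 u2"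
    using assms(6) by (simp add: u2_def f1.hom_int_pow f1(2) int_pow_int)
  then obtain f where "f \<in> hom G2 H" "f Y2 = Y" "\<And>a. a \<in> carrier G1 \<Longrightarrow> f (cyc_emb a) = f1 a"
    using E2.hom_E[OF H f1(1) Y _ gen1] f1(2) assms(5) by auto
  then show thesis using that f1(2) by (simp add: X2_def)
qed

lemma abelian2:
  assumes "a \<in> carrier G2" "b \<in> carrier G2"
  shows "a \<otimes>\<^bsub>G2\<^esub> b = b \<otimes>\<^bsub>G2\<^esub> a"
proof -
  have XY: "c \<otimes>\<^bsub>G2\<^esub> d = d \<otimes>\<^bsub>G2\<^esub> c" if "c \<in> {X2, Y2}" "d \<in> {X2, Y2}" for c d
    using that X2Y2 by auto
  have *: "c \<otimes>\<^bsub>G2\<^esub> d = d \<otimes>\<^bsub>G2\<^esub> c" if "c \<in> carrier G2" "d \<in> {X2, Y2}" for c d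
    using E2.E.hom_conj_generate[OF E2.E.is_group id_hom id_hom, of d "{X2, Y2}" c] that XY
    by (auto simp: gen2)
  then have "c \<otimes>\<^bsub>G2\<^esub> b = b \<otimes>\<^bsub>G2\<^esub> c" if "c \<in> {X2, Y2}" for c
    using *[OF assms(2) that] by simp
  then show ?thesis
    using E2.E.hom_conj_generate[OF E2.E.is_group id_hom id_hom, of b "{X2, Y2}" a] assms
    by (simp add: gen2)
qed

lemma X2_cong: "2 * int P * int P dvd i - j \<Longrightarrow> X2 [^]\<^bsub>G2\<^esub> i = X2 [^]\<^bsub>G2\<^esub> j"
  by (rule E2.E.int_pow_cong[OF X2_closed pow_X2])

lemma pow_Y2: "Y2 [^]\<^bsub>G2\<^esub> (2 * int P * int P) = \<one>\<^bsub>G2\<^esub>"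
proof -
  have "Y2 [^]\<^bsub>G2\<^esub> (2 * int P * int P) = (Y2 [^]\<^bsub>G2\<^esub> int P) [^]\<^bsub>G2\<^esub> (2 * int P)"
    by (simp add: E2.E.int_pow_pow mult_ac)
  also have "\<dots> = X2 [^]\<^bsub>G2\<^esub> (- (2 * int P * int P))"
    unfolding Y2_P by (simp add: E2.E.int_pow_pow mult_ac)
  also have "\<dots> = X2 [^]\<^bsub>G2\<^esub> (0::int)" by (rule X2_cong) simp
  finally show ?thesis by simp
qed

lemma Y2_cong: "2 * int P * int P dvd i - j \<Longrightarrow> Y2 [^]\<^bsub>G2\<^esub> i = Y2 [^]\<^bsub>G2\<^esub> j"
  by (rule E2.E.int_pow_cong[OF E2.gen_closed pow_Y2])

text \<open>\<open>zeta\<close>, \<open>eta\<close> and \<open>xi\<close> will be conjugation by \<open>z\<close>, \<open>y\<close> and \<open>x\<close>.\<close>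

definition "zeta = (SOME f. f \<in> hom G2 G2 \<and> f X2 = X2 [^]\<^bsub>G2\<^esub> \<alpha> \<and> f Y2 = Y2 [^]\<^bsub>G2\<^esub> g)"

lemma zeta: "zeta \<in> hom G2 G2" "zeta X2 = X2 [^]\<^bsub>G2\<^esub> \<alpha>" "zeta Y2 = Y2 [^]\<^bsub>G2\<^esub> g"
proof -
  have "\<exists>f. f \<in> hom G2 G2 \<and> f X2 = X2 [^]\<^bsub>G2\<^esub> \<alpha> \<and> f Y2 = Y2 [^]\<^bsub>G2\<^esub> g"
  proof -
    have 1: "(X2 [^]\<^bsub>G2\<^esub> \<alpha>) [^]\<^bsub>G2\<^esub> (2 * int P * int P) = \<one>\<^bsub>G2\<^esub>"
    proof -
      have "(X2 [^]\<^bsub>G2\<^esub> \<alpha>) [^]\<^bsub>G2\<^esub> (2 * int P * int P) = (X2 [^]\<^bsub>G2\<^esub> (2 * int P * int P)) [^]\<^bsub>G2\<^esub> \<alpha>"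
        by (simp only: E2.E.int_pow_pow X2_closed mult.commute)
      then show ?thesis by (simp add: pow_X2)
    qed
    have "(Y2 [^]\<^bsub>G2\<^esub> g) [^]\<^bsub>G2\<^esub> int P = (Y2 [^]\<^bsub>G2\<^esub> int P) [^]\<^bsub>G2\<^esub> g"
      by (simp add: E2.E.int_pow_pow mult.commute)
    also have "\<dots> = X2 [^]\<^bsub>G2\<^esub> (- (int P * g))"
      unfolding Y2_P by (simp add: E2.E.int_pow_pow)
    \<comment> \<open>\<open>g\<close> and \<alpha> are both 1 modulo \<open>2P\<close>; after
      multiplication by \<open>P\<close> they agree modulo the order of \<open>X\<close>.\<close>
    also have "\<dots> = X2 [^]\<^bsub>G2\<^esub> (- (int P * \<alpha>))"
    proof (rule X2_cong)
      have "int P * (2 * int P) dvd int P * ((2 * int P) * l - (g - 1))"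
        by (rule mult_dvd_mono[OF dvd_refl dvd_diff[OF dvd_triv_left g_cong]])
      then show "2 * int P * int P dvd - (int P * g) - - (int P * \<alpha>)"
        by (simp add: algebra_simps)
    qed
    also have "\<dots> = (X2 [^]\<^bsub>G2\<^esub> \<alpha>) [^]\<^bsub>G2\<^esub> (- int P)"
      by (simp add: E2.E.int_pow_pow mult.commute)
    finally have 2: "(Y2 [^]\<^bsub>G2\<^esub> g) [^]\<^bsub>G2\<^esub> int P = (X2 [^]\<^bsub>G2\<^esub> \<alpha>) [^]\<^bsub>G2\<^esub> (- int P)" .
    obtain f where "f \<in> hom G2 G2" "f X2 = X2 [^]\<^bsub>G2\<^esub> \<alpha>" "f Y2 = Y2 [^]\<^bsub>G2\<^esub> g"
      by (rule hom2[OF E2.E.is_group _ _ 1 _ 2]) (simp_all add: abelian2)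
    then show ?thesis by blast
  qed
  from someI_ex[OF this] show "zeta \<in> hom G2 G2" "zeta X2 = X2 [^]\<^bsub>G2\<^esub> \<alpha>" "zeta Y2 = Y2 [^]\<^bsub>G2\<^esub> g"
    unfolding zeta_def by auto
qed

text \<open>The value imposed on \<open>z^(2 P P)\<close>: the involution of the cyclic group
  generated by \<open>X\<close>.\<close>

definition "u3 = X2 [^]\<^bsub>G2\<^esub> (int P * int P)"
definition "G3 = cyc_ext G2 zeta (2 * P * P) u3"
definition "X3 = (cyc_emb X2 :: nat \<times> nat \<times> nat \<times> unit)"
definition "Y3 = (cyc_emb Y2 :: nat \<times> nat \<times> nat \<times> unit)"
definition "z3 = cyc_gen G2"

text \<open>Makes \<open>zeta ^^ (2 * P * P)\<close> trivial, as it must be since \<open>u3\<close>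
  lies in the abelian group \<open>G2\<close>.\<close>

lemma power_cong_one: "2 * int P dvd e - 1 \<Longrightarrow> 2 * int P * int P dvd e ^ (2 * P * P) - 1"
proof -
  assume e: "2 * int P dvd e - 1"
  obtain m where m: "m \<ge> 2" "P = 2 ^ (m - 1)" using P by blast
  obtain p :: int where p: "p = 2 ^ (m - 1)" "2 ^ m = 2 * p" "2 ^ (2 * m - 1) = 2 * p * p"
    by (rule pow2_split[OF m(1)])
  have Pp: "int P = p" using m(2) p(1) by simp
  have "2 ^ (2 * m - 1) dvd geo (1 + (e - 1)) (2 * P * P)"
  proof (rule dvd_geo[OF m(1)])
    show "2 ^ m dvd e - 1" using e by (simp add: p(2) Pp)
    show "2 ^ (2 * m - 1) dvd int (2 * P * P)" unfolding p(3) by (simp add: Pp)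
  qed
  then show ?thesis unfolding p(3) using geo_power[of e "2 * P * P"] by (simp add: Pp)
qed

lemma E3: "cyclic_extension G2 zeta (2 * P * P) u3"
proof -
  interpret zeta: group_hom G2 G2 zeta by unfold_locales (rule zeta(1))
  have zk: "(zeta ^^ k) \<in> hom G2 G2" for k
    by (induction k) (use zeta(1) in \<open>auto simp: hom_def Pi_iff\<close>)
  have zX: "(zeta ^^ k) X2 = X2 [^]\<^bsub>G2\<^esub> (\<alpha> ^ k)" for k
    by (induction k) (simp_all add: zeta.hom_int_pow zeta(2) E2.E.int_pow_pow mult.commute)
  have zY: "(zeta ^^ k) Y2 = Y2 [^]\<^bsub>G2\<^esub> (g ^ k)" for k
    by (induction k) (simp_all add: zeta.hom_int_pow zeta(3) E2.E.int_pow_pow mult.commute)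
  have zX1: "(zeta ^^ (2 * P * P)) X2 = X2"
    unfolding zX using X2_cong[OF power_cong_one, of \<alpha>] by (simp add: X2_cong)
  have zY1: "(zeta ^^ (2 * P * P)) Y2 = Y2"
    unfolding zY using Y2_cong[OF power_cong_one, of g] g_cong by simp
  show ?thesis
  proof unfold_locales
    show "zeta u3 = u3"
      unfolding u3_def by (simp add: zeta.hom_int_pow zeta(2) E2.E.int_pow_pow)
        (rule X2_cong, simp add: algebra_simps)
    fix a assume a: "a \<in> carrier G2"
    have "c \<otimes>\<^bsub>G2\<^esub> u3 = u3 \<otimes>\<^bsub>G2\<^esub> (zeta ^^ (2 * P * P)) c" if "c \<in> {X2, Y2}" for c
      using that by (elim insertE emptyE) (simp_all only: zX1 zY1 abelian2 u3_def E2.E.int_pow_closed X2_closed E2.gen_closed)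
    then show "a \<otimes>\<^bsub>G2\<^esub> u3 = u3 \<otimes>\<^bsub>G2\<^esub> (zeta ^^ (2 * P * P)) a"
      using E2.E.hom_conj_generate[OF E2.E.is_group id_hom zk, of u3 "{X2, Y2}" "2 * P * P" a] a
      by (simp add: gen2 u3_def)
  qed (use PP_gt zeta in \<open>simp_all add: u3_def\<close>)
qed

interpretation E3: cyclic_extension G2 zeta "2 * P * P" u3
  rewrites "cyc_ext G2 zeta (2 * P * P) u3 = G3" and "cyc_gen G2 = z3"
  by (rule E3) (simp_all add: G3_def z3_def)

lemma XY3_closed [simp]: "X3 \<in> carrier G3" "Y3 \<in> carrier G3"
  by (simp_all add: X3_def Y3_def)

lemma gen3: "generate G3 {X3, Y3, z3} = carrier G3"
  using E3.generate_E[OF _ gen2] by (simp add: X3_def Y3_def insert_commute)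

lemma relations3: "power_relations G3 X3 Y3 z3 P l"
proof unfold_locales
  show "X3 \<otimes>\<^bsub>G3\<^esub> Y3 = Y3 \<otimes>\<^bsub>G3\<^esub> X3"
    unfolding X3_def Y3_def by (simp add: X2Y2 flip: E3.emb.hom_mult)
  show "X3 \<otimes>\<^bsub>G3\<^esub> z3 = z3 \<otimes>\<^bsub>G3\<^esub> X3 [^]\<^bsub>G3\<^esub> \<alpha>"
    using E3.emb_gen[OF X2_closed] by (simp add: X3_def zeta E3.emb.hom_int_pow)
  have Yz: "Y3 \<otimes>\<^bsub>G3\<^esub> z3 = z3 \<otimes>\<^bsub>G3\<^esub> Y3 [^]\<^bsub>G3\<^esub> g"
    using E3.emb_gen[OF E2.gen_closed] by (simp add: Y3_def zeta E3.emb.hom_int_pow)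
  have "Y3 [^]\<^bsub>G3\<^esub> \<alpha> \<otimes>\<^bsub>G3\<^esub> z3 = z3 \<otimes>\<^bsub>G3\<^esub> Y3 [^]\<^bsub>G3\<^esub> (\<alpha> * g)"
    using E3.E.swap_pow[OF _ _ Yz, of \<alpha> 1] by simp
  also have "Y3 [^]\<^bsub>G3\<^esub> (\<alpha> * g) = cyc_emb (Y2 [^]\<^bsub>G2\<^esub> (\<alpha> * g))"
    by (simp add: Y3_def E3.emb.hom_int_pow)
  also have "Y2 [^]\<^bsub>G2\<^esub> (\<alpha> * g) = Y2 [^]\<^bsub>G2\<^esub> (1::int)"
    by (rule Y2_cong) (use g in \<open>simp only: mult.commute\<close>)
  finally show "z3 \<otimes>\<^bsub>G3\<^esub> Y3 = Y3 [^]\<^bsub>G3\<^esub> \<alpha> \<otimes>\<^bsub>G3\<^esub> z3"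
    by (simp add: Y3_def)
  show "X3 [^]\<^bsub>G3\<^esub> (2 * int P * int P) = \<one>\<^bsub>G3\<^esub>"
    by (simp add: X3_def pow_X2 flip: E3.emb.hom_int_pow)
  show "Y3 [^]\<^bsub>G3\<^esub> int P = X3 [^]\<^bsub>G3\<^esub> (- int P)"
    unfolding X3_def Y3_def by (simp only: E3.emb.hom_int_pow[symmetric] X2_closed E2.gen_closed Y2_P)
  have "z3 [^]\<^bsub>G3\<^esub> (2 * int P * int P) = z3 [^]\<^bsub>G3\<^esub> (2 * P * P)"
    by (metis int_pow_int of_nat_mult of_nat_numeral)
  then show "z3 [^]\<^bsub>G3\<^esub> (2 * int P * int P) = X3 [^]\<^bsub>G3\<^esub> (int P * int P)"
    using E3.gen_pow_n by (simp add: u3_def X3_def E3.emb.hom_int_pow)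
qed (use P l in simp_all)

interpretation c3: power_relations G3 X3 Y3 z3 P l
  by (rule relations3)

text \<open>\<open>G3\<close> is universal for \<open>power_relations\<close>. Applied to
  \<open>G3\<close> itself with the generators conjugated by \<open>y\<close>, this yields
  \<open>eta\<close>.\<close>

lemma hom3:
  assumes "power_relations H X Y z P l"
  obtains f where "f \<in> hom G3 H" "f X3 = X" "f Y3 = Y" "f z3 = z"
proof -
  interpret H: power_relations H X Y z P l by fact
  obtain f2 where f2: "f2 \<in> hom G2 H" "f2 X2 = X" "f2 Y2 = Y"
    by (rule hom2[OF H.is_group H.X H.Y H.pow_X H.XY H.Y_P])
  interpret f2: group_hom G2 H f2 by unfold_locales (rule f2)
  have "Y \<otimes>\<^bsub>H\<^esub> z = z \<otimes>\<^bsub>H\<^esub> Y [^]\<^bsub>H\<^esub> g"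
  proof -
    have "Y [^]\<^bsub>H\<^esub> (g * \<alpha>) = Y [^]\<^bsub>H\<^esub> (1::int)"
      by (rule H.Y_cong) (use g in \<open>simp add: H.p_def\<close>)
    then show ?thesis using H.z_Y_pow[of g] by (simp add: H.\<alpha>_def H.p_def)
  qed
  then have 1: "f2 a \<otimes>\<^bsub>H\<^esub> z = z \<otimes>\<^bsub>H\<^esub> f2 (zeta a)" if "a \<in> {X2, Y2}" for a
    using that H.Xz by (auto simp: f2 zeta f2.hom_int_pow)
  have "z [^]\<^bsub>H\<^esub> (2 * P * P) = z [^]\<^bsub>H\<^esub> (2 * int P * int P)"
    by (metis int_pow_int of_nat_mult of_nat_numeral)
  then have 2: "z [^]\<^bsub>H\<^esub> (2 * P * P) = f2 u3"
    by (simp add: H.z_PP u3_def f2.hom_int_pow f2)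
  obtain f where "f \<in> hom G3 H" "f z3 = z" "\<And>a. a \<in> carrier G2 \<Longrightarrow> f (cyc_emb a) = f2 a"
    using E3.hom_E[OF H.is_group f2(1) H.z _ gen2 1 2] by auto
  then show thesis using that f2 by (simp add: X3_def Y3_def)
qed

definition "eta = (SOME f. f \<in> hom G3 G3 \<and> f X3 = c3.X' \<and> f Y3 = Y3 \<and> f z3 = Y3 [^]\<^bsub>G3\<^esub> l \<otimes>\<^bsub>G3\<^esub> z3)"

lemma eta: "eta \<in> hom G3 G3" "eta X3 = c3.X'" "eta Y3 = Y3" "eta z3 = Y3 [^]\<^bsub>G3\<^esub> l \<otimes>\<^bsub>G3\<^esub> z3"
proof -
  have "\<exists>f. f \<in> hom G3 G3 \<and> f X3 = c3.X' \<and> f Y3 = Y3 \<and> f z3 = Y3 [^]\<^bsub>G3\<^esub> l \<otimes>\<^bsub>G3\<^esub> z3"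
    by (rule hom3[OF c3.relations_swap_shift]) (auto simp: c3.inv_swap_z')
  from someI_ex[OF this] show "eta \<in> hom G3 G3" "eta X3 = c3.X'" "eta Y3 = Y3"
      "eta z3 = Y3 [^]\<^bsub>G3\<^esub> l \<otimes>\<^bsub>G3\<^esub> z3"
    unfolding eta_def by auto
qed

definition "G4 = cyc_ext G3 eta (2 * P) Y3"
definition "X4 = (cyc_emb X3 :: nat \<times> nat \<times> nat \<times> nat \<times> unit)"
definition "Y4 = (cyc_emb Y3 :: nat \<times> nat \<times> nat \<times> nat \<times> unit)"
definition "z4 = (cyc_emb z3 :: nat \<times> nat \<times> nat \<times> nat \<times> unit)"
definition "y4 = cyc_gen G3"

lemma E4: "cyclic_extension G3 eta (2 * P) Y3"
proof unfold_locales
  have ek: "(eta ^^ k) \<in> hom G3 G3" for k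
    by (induction k) (use eta(1) in \<open>auto simp: hom_def Pi_iff\<close>)
  fix a assume a: "a \<in> carrier G3"
  show "a \<otimes>\<^bsub>G3\<^esub> Y3 = Y3 \<otimes>\<^bsub>G3\<^esub> (eta ^^ (2 * P)) a"
    using E3.E.hom_conj_generate[OF E3.E.is_group id_hom ek, of Y3 "{X3, Y3, z3}" "2 * P" a] a
      c3.swap_shift_conj[OF eta]
    by (simp add: gen3)
qed (use P_gt eta in simp_all)

interpretation E4: cyclic_extension G3 eta "2 * P" Y3
  rewrites "cyc_ext G3 eta (2 * P) Y3 = G4" and "cyc_gen G3 = y4"
  by (rule E4) (simp_all add: G4_def y4_def)

lemma XYz4_closed [simp]: "X4 \<in> carrier G4" "Y4 \<in> carrier G4" "z4 \<in> carrier G4"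
  by (simp_all add: X4_def Y4_def z4_def)

lemma gen4: "generate G4 {X4, Y4, z4, y4} = carrier G4"
  using E4.generate_E[OF _ gen3] by (simp add: X4_def Y4_def z4_def insert_commute)

lemma relations_y4: "power_relations_y G4 X4 Y4 z4 P l y4"
proof -
  have c4: "power_relations G4 X4 Y4 z4 P l"
    unfolding X4_def Y4_def z4_def by (rule c3.relations_hom[OF E4.E.is_group E4.emb_hom])
  interpret c4: power_relations G4 X4 Y4 z4 P l by (rule c4)
  have X': "c4.X' = cyc_emb c3.X'"
    unfolding X4_def Y4_def z4_def by (rule c3.hom_X'[OF E4.E.is_group E4.emb_hom])
  have y4P: "y4 [^]\<^bsub>G4\<^esub> (2 * int P) = Y4"
    using E4.gen_pow_n unfolding Y4_def by (metis int_pow_int of_nat_mult of_nat_numeral)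
  show ?thesis
  proof unfold_locales
    have "z4 \<otimes>\<^bsub>G4\<^esub> y4 = y4 \<otimes>\<^bsub>G4\<^esub> (Y4 [^]\<^bsub>G4\<^esub> l \<otimes>\<^bsub>G4\<^esub> z4)"
      using E4.emb_gen[OF c3.z] by (simp add: z4_def Y4_def eta E4.emb.hom_int_pow)
    also have "\<dots> = y4 [^]\<^bsub>G4\<^esub> \<alpha> \<otimes>\<^bsub>G4\<^esub> z4"
      by (simp add: E4.E.int_pow_mult E4.E.int_pow_pow E4.E.m_assoc flip: y4P)
    finally show "z4 \<otimes>\<^bsub>G4\<^esub> y4 = y4 [^]\<^bsub>G4\<^esub> \<alpha> \<otimes>\<^bsub>G4\<^esub> z4" .
    show "X4 \<otimes>\<^bsub>G4\<^esub> y4 = y4 \<otimes>\<^bsub>G4\<^esub> c4.X'"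
      using E4.emb_gen[OF c3.X] unfolding X' by (simp add: X4_def eta)
  qed (simp_all add: y4P)
qed

interpretation c4: power_relations_y G4 X4 Y4 z4 P l y4
  by (rule relations_y4)

text \<open>\<open>G4\<close> is universal for \<open>power_relations_y\<close>; with
  \<open>relations_y_shift\<close> this yields \<open>xi\<close>.\<close>

lemma hom4:
  assumes "power_relations_y H X Y z P l y"
  obtains f where "f \<in> hom G4 H" "f X4 = X" "f Y4 = Y" "f z4 = z" "f y4 = y"
proof -
  interpret H: power_relations_y H X Y z P l y by fact
  obtain f3 where f3: "f3 \<in> hom G3 H" "f3 X3 = X" "f3 Y3 = Y" "f3 z3 = z"
    by (rule hom3[OF H.power_relations_axioms])
  interpret f3: group_hom G3 H f3 by unfold_locales (rule f3)
  have "f3 c3.X' = H.X'"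
    using c3.hom_X'[OF H.is_group f3(1)] by (simp add: f3)
  moreover have "Y \<otimes>\<^bsub>H\<^esub> y = y \<otimes>\<^bsub>H\<^esub> Y"
    using H.int_pow_comm_add[OF H.y, of "2 * int P" 1] by (simp add: H.y_pow)
  ultimately have 1: "f3 a \<otimes>\<^bsub>H\<^esub> y = y \<otimes>\<^bsub>H\<^esub> f3 (eta a)" if "a \<in> {X3, Y3, z3}" for a
    using that H.Xy H.zy' by (auto simp: f3 eta f3.hom_int_pow)
  have 2: "y [^]\<^bsub>H\<^esub> (2 * P) = f3 Y3"
    using H.y_pow f3 by (metis int_pow_int of_nat_mult of_nat_numeral)
  obtain f where "f \<in> hom G4 H" "f y4 = y" "\<And>a. a \<in> carrier G3 \<Longrightarrow> f (cyc_emb a) = f3 a"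
    using E4.hom_E[OF H.is_group f3(1) H.y _ gen3 1 2] by auto
  then show thesis using that f3 by (simp add: X4_def Y4_def z4_def)
qed

definition "xi = (SOME f. f \<in> hom G4 G4 \<and> f X4 = X4 \<and> f Y4 = c4.Y' \<and> f z4 = c4.z' \<and> f y4 = c4.y')"

lemma xi: "xi \<in> hom G4 G4" "xi X4 = X4" "xi Y4 = c4.Y'" "xi z4 = c4.z'" "xi y4 = c4.y'"
proof -
  have "\<exists>f. f \<in> hom G4 G4 \<and> f X4 = X4 \<and> f Y4 = c4.Y' \<and> f z4 = c4.z' \<and> f y4 = c4.y'"
    by (rule hom4[OF c4.relations_y_shift]) auto
  from someI_ex[OF this] show "xi \<in> hom G4 G4" "xi X4 = X4" "xi Y4 = c4.Y'" "xi z4 = c4.z'" "xi y4 = c4.y'"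
    unfolding xi_def by auto
qed

text \<open>The top of the tower. The layers have orders \<open>2^(2m-1)\<close>,
  \<open>2^(m-1)\<close>, \<open>2^(2m-1)\<close>, \<open>2^m\<close>, \<open>2^m\<close>, in total
  \<open>2^(7m-3)\<close>.\<close>

definition "G5 = cyc_ext G4 xi (2 * P) X4"
definition "x5 = cyc_gen G4"
definition "y5 = (cyc_emb y4 :: nat \<times> nat \<times> nat \<times> nat \<times> nat \<times> unit)"
definition "z5 = (cyc_emb z4 :: nat \<times> nat \<times> nat \<times> nat \<times> nat \<times> unit)"

lemma E5: "cyclic_extension G4 xi (2 * P) X4"
proof unfold_locales
  have xk: "(xi ^^ k) \<in> hom G4 G4" for k
    by (induction k) (use xi(1) in \<open>auto simp: hom_def Pi_iff\<close>)
  fix a assume a: "a \<in> carrier G4"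
  have "c \<otimes>\<^bsub>G4\<^esub> X4 = X4 \<otimes>\<^bsub>G4\<^esub> (xi ^^ (2 * P)) c" if "c \<in> {X4, Y4, z4, y4}" for c
    using that c4.shift_conj_X[OF xi(1-4)] c4.shift_conj_Y[OF xi(1-4)] c4.shift_conj_z[OF xi(1-4)]
      c4.shift_conj_y[OF xi] by (elim insertE emptyE) simp_all
  then show "a \<otimes>\<^bsub>G4\<^esub> X4 = X4 \<otimes>\<^bsub>G4\<^esub> (xi ^^ (2 * P)) a"
    using E4.E.hom_conj_generate[OF E4.E.is_group id_hom xk, of X4 "{X4, Y4, z4, y4}" "2 * P" a] a
    by (simp add: gen4)
qed (use P_gt xi in simp_all)

interpretation E5: cyclic_extension G4 xi "2 * P" X4
  rewrites "cyc_ext G4 xi (2 * P) X4 = G5" and "cyc_gen G4 = x5"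
  by (rule E5) (simp_all add: G5_def x5_def)

lemma group_G5: "group G5"
  by (rule E5.E.is_group)

lemma yz5_closed [simp]: "x5 \<in> carrier G5" "y5 \<in> carrier G5" "z5 \<in> carrier G5"
  by (simp_all add: y5_def z5_def)

lemma x5_pow: "x5 [^]\<^bsub>G5\<^esub> (2 * int P * i) = cyc_emb (X4 [^]\<^bsub>G4\<^esub> i)"
proof -
  have "x5 [^]\<^bsub>G5\<^esub> (2 * int P) = cyc_emb X4"
    using E5.gen_pow_n by (metis int_pow_int of_nat_mult of_nat_numeral)
  then show ?thesis by (simp add: E5.emb.hom_int_pow flip: E5.E.int_pow_pow)
qed

lemma commutator5: "commutator G5 x5 y5 = z5"
proof -
  have "y5 \<otimes>\<^bsub>G5\<^esub> x5 = x5 \<otimes>\<^bsub>G5\<^esub> (y5 \<otimes>\<^bsub>G5\<^esub> inv\<^bsub>G5\<^esub> z5)"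
    using E5.emb_gen[OF c4.y] by (simp add: y5_def z5_def xi c4.y'_def)
  then have "y5 \<otimes>\<^bsub>G5\<^esub> x5 \<otimes>\<^bsub>G5\<^esub> z5 = x5 \<otimes>\<^bsub>G5\<^esub> y5"
    by (simp add: E5.E.m_assoc)
  then have "commutator G5 x5 y5 = inv\<^bsub>G5\<^esub> x5 \<otimes>\<^bsub>G5\<^esub> inv\<^bsub>G5\<^esub> y5 \<otimes>\<^bsub>G5\<^esub> (y5 \<otimes>\<^bsub>G5\<^esub> x5 \<otimes>\<^bsub>G5\<^esub> z5)"
    by (simp add: commutator_def E5.E.m_assoc)
  also have "\<dots> = inv\<^bsub>G5\<^esub> x5 \<otimes>\<^bsub>G5\<^esub> (inv\<^bsub>G5\<^esub> y5 \<otimes>\<^bsub>G5\<^esub> y5) \<otimes>\<^bsub>G5\<^esub> x5 \<otimes>\<^bsub>G5\<^esub> z5"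
    by (simp only: E5.E.m_assoc yz5_closed E5.E.inv_closed E5.E.m_closed)
  also have "\<dots> = z5" by simp
  finally show ?thesis .
qed

lemma commutator5': "commutator G5 y5 x5 = inv\<^bsub>G5\<^esub> z5"
  unfolding commutator5[symmetric] commutator_def by (simp add: E5.E.inv_mult_group E5.E.m_assoc)

lemma conj_x5: "conjugate G5 x5 (commutator G5 x5 y5) = x5 [^]\<^bsub>G5\<^esub> \<alpha>"
proof -
  have "z5 \<otimes>\<^bsub>G5\<^esub> x5 = x5 \<otimes>\<^bsub>G5\<^esub> (z5 \<otimes>\<^bsub>G5\<^esub> cyc_emb (X4 [^]\<^bsub>G4\<^esub> (- l)))"
    using E5.emb_gen[OF c4.z] by (simp add: z5_def xi c4.z'_def)
  also have "cyc_emb (X4 [^]\<^bsub>G4\<^esub> (- l)) = x5 [^]\<^bsub>G5\<^esub> (- (2 * int P * l))"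
    using x5_pow[of "- l"] by simp
  finally have "z5 \<otimes>\<^bsub>G5\<^esub> x5 \<otimes>\<^bsub>G5\<^esub> x5 [^]\<^bsub>G5\<^esub> (2 * int P * l)
      = x5 \<otimes>\<^bsub>G5\<^esub> z5 \<otimes>\<^bsub>G5\<^esub> (x5 [^]\<^bsub>G5\<^esub> (- (2 * int P * l)) \<otimes>\<^bsub>G5\<^esub> x5 [^]\<^bsub>G5\<^esub> (2 * int P * l))"
    by (simp add: E5.E.m_assoc)
  also have "\<dots> = x5 \<otimes>\<^bsub>G5\<^esub> z5" by (simp flip: E5.E.int_pow_mult)
  finally have "x5 \<otimes>\<^bsub>G5\<^esub> z5 = z5 \<otimes>\<^bsub>G5\<^esub> x5 [^]\<^bsub>G5\<^esub> \<alpha>"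
    by (simp add: E5.E.int_pow_mult E5.E.m_assoc)
  then show ?thesis
    by (simp add: commutator5 conjugate_def E5.E.m_assoc) (simp add: E5.E.m_assoc[symmetric])
qed

lemma conj_y5: "conjugate G5 y5 (commutator G5 y5 x5) = y5 [^]\<^bsub>G5\<^esub> \<alpha>"
proof -
  have "z5 \<otimes>\<^bsub>G5\<^esub> y5 = y5 [^]\<^bsub>G5\<^esub> \<alpha> \<otimes>\<^bsub>G5\<^esub> z5"
    unfolding z5_def y5_def
    by (simp only: E5.emb.hom_int_pow[symmetric] E5.emb.hom_mult[symmetric] c4.y c4.z c4.zy E4.E.int_pow_closed)
  then show ?thesis
    by (simp add: commutator5' conjugate_def E5.E.m_assoc)
qed

lemma pow_x5: "x5 [^]\<^bsub>G5\<^esub> (2 * int P * (2 * int P * int P)) = \<one>\<^bsub>G5\<^esub>"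
  unfolding x5_pow c4.pow_X by simp

lemma pow_y5: "y5 [^]\<^bsub>G5\<^esub> (2 * int P * (2 * int P * int P)) = \<one>\<^bsub>G5\<^esub>"
  using c4.y_pow'[of "2 * int P * int P"] c4.pow_Y
  by (simp add: y5_def c4.p_def flip: E5.emb.hom_int_pow)

section \<open>Orders and independence of exponents in \<open>G5\<close>\<close>

lemma X1_order: "X1 [^]\<^bsub>G1\<^esub> (i::int) = \<one>\<^bsub>G1\<^esub> \<Longrightarrow> 2 * int P * int P dvd i"
  using E1.gen_pow_emb_eq_one[of "()" i] E1.emb.hom_one by (auto simp: unit_group_def)

lemma x5_order: "x5 [^]\<^bsub>G5\<^esub> (i::int) = \<one>\<^bsub>G5\<^esub> \<Longrightarrow> 2 * int P * (2 * int P * int P) dvd i"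
proof -
  assume "x5 [^]\<^bsub>G5\<^esub> i = \<one>\<^bsub>G5\<^esub>"
  then obtain i' where i': "i = 2 * int P * i'" "X4 [^]\<^bsub>G4\<^esub> i' = \<one>\<^bsub>G4\<^esub>"
    using E5.gen_pow_emb_eq_one[of "\<one>\<^bsub>G4\<^esub>" i] by auto
  have "X4 [^]\<^bsub>G4\<^esub> i' = cyc_emb (cyc_emb (cyc_emb (X1 [^]\<^bsub>G1\<^esub> i')))"
    by (simp add: X4_def X3_def X2_def E4.emb.hom_int_pow E3.emb.hom_int_pow E2.emb.hom_int_pow)
  moreover have "\<one>\<^bsub>G4\<^esub> = cyc_emb (cyc_emb (cyc_emb \<one>\<^bsub>G1\<^esub>))" by simp
  ultimately have "X1 [^]\<^bsub>G1\<^esub> i' = \<one>\<^bsub>G1\<^esub>"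
    using i'(2) by (simp add: cyc_emb_def)
  then show ?thesis unfolding i'(1) by (intro mult_dvd_mono X1_order dvd_refl)
qed

text \<open>The tower is peeled from the top, with \<open>inv_comm\<close> rotating the word each
  time so that the next generator stands first. This yields \<open>i = 2 P i'\<close>,
  \<open>j = 2 P j'\<close> and the full divisibility of \<open>k\<close>; the missing factors
  \<open>P\<close> come from the two abelian layers, where \<open>P\<close> divides
  \<open>j'\<close> and then also \<open>i'\<close>.\<close>

lemma normal_form_eq_one:
  assumes "x5 [^]\<^bsub>G5\<^esub> (i::int) \<otimes>\<^bsub>G5\<^esub> y5 [^]\<^bsub>G5\<^esub> (j::int) \<otimes>\<^bsub>G5\<^esub> z5 [^]\<^bsub>G5\<^esub> (k::int) = \<one>\<^bsub>G5\<^esub>"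
  shows "2 * int P * int P dvd i \<and> 2 * int P * int P dvd j \<and> 2 * int P * int P dvd k"
proof -
  have "x5 [^]\<^bsub>G5\<^esub> i \<otimes>\<^bsub>G5\<^esub> cyc_emb (y4 [^]\<^bsub>G4\<^esub> j \<otimes>\<^bsub>G4\<^esub> z4 [^]\<^bsub>G4\<^esub> k) = \<one>\<^bsub>G5\<^esub>"
    using assms by (simp add: y5_def z5_def E5.emb.hom_int_pow E5.E.m_assoc)
  then obtain i' where i: "i = 2 * int P * i'"
    and 4: "X4 [^]\<^bsub>G4\<^esub> i' \<otimes>\<^bsub>G4\<^esub> (y4 [^]\<^bsub>G4\<^esub> j \<otimes>\<^bsub>G4\<^esub> z4 [^]\<^bsub>G4\<^esub> k) = \<one>\<^bsub>G4\<^esub>"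
    using E5.gen_pow_emb_eq_one[of "y4 [^]\<^bsub>G4\<^esub> j \<otimes>\<^bsub>G4\<^esub> z4 [^]\<^bsub>G4\<^esub> k" i] by auto
  then have "y4 [^]\<^bsub>G4\<^esub> j \<otimes>\<^bsub>G4\<^esub> cyc_emb (z3 [^]\<^bsub>G3\<^esub> k \<otimes>\<^bsub>G3\<^esub> X3 [^]\<^bsub>G3\<^esub> i') = \<one>\<^bsub>G4\<^esub>"
    using E4.E.inv_comm[OF 4] by (simp add: X4_def z4_def E4.emb.hom_int_pow E4.E.m_assoc)
  then obtain j' where j: "j = 2 * int P * j'"
    and 3: "Y3 [^]\<^bsub>G3\<^esub> j' \<otimes>\<^bsub>G3\<^esub> (z3 [^]\<^bsub>G3\<^esub> k \<otimes>\<^bsub>G3\<^esub> X3 [^]\<^bsub>G3\<^esub> i') = \<one>\<^bsub>G3\<^esub>"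
    using E4.gen_pow_emb_eq_one[of "z3 [^]\<^bsub>G3\<^esub> k \<otimes>\<^bsub>G3\<^esub> X3 [^]\<^bsub>G3\<^esub> i'" j] by auto
  then have "z3 [^]\<^bsub>G3\<^esub> k \<otimes>\<^bsub>G3\<^esub> cyc_emb (X2 [^]\<^bsub>G2\<^esub> i' \<otimes>\<^bsub>G2\<^esub> Y2 [^]\<^bsub>G2\<^esub> j') = \<one>\<^bsub>G3\<^esub>"
    using E3.E.inv_comm[OF 3] by (simp add: X3_def Y3_def E3.emb.hom_int_pow E3.E.m_assoc)
  then obtain k' where k: "k = 2 * int P * int P * k'"
    and 2: "u3 [^]\<^bsub>G2\<^esub> k' \<otimes>\<^bsub>G2\<^esub> (X2 [^]\<^bsub>G2\<^esub> i' \<otimes>\<^bsub>G2\<^esub> Y2 [^]\<^bsub>G2\<^esub> j') = \<one>\<^bsub>G2\<^esub>"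
    using E3.gen_pow_emb_eq_one[of "X2 [^]\<^bsub>G2\<^esub> i' \<otimes>\<^bsub>G2\<^esub> Y2 [^]\<^bsub>G2\<^esub> j'" k] by auto
  then have "(X2 [^]\<^bsub>G2\<^esub> (int P * int P * k' + i')) \<otimes>\<^bsub>G2\<^esub> Y2 [^]\<^bsub>G2\<^esub> j' = \<one>\<^bsub>G2\<^esub>"
    by (simp add: u3_def E2.E.int_pow_pow E2.E.int_pow_mult E2.E.m_assoc)
  then have "Y2 [^]\<^bsub>G2\<^esub> j' \<otimes>\<^bsub>G2\<^esub> cyc_emb (X1 [^]\<^bsub>G1\<^esub> (int P * int P * k' + i')) = \<one>\<^bsub>G2\<^esub>"
    using E2.E.inv_comm by (simp add: X2_def E2.emb.hom_int_pow)
  then obtain j'' where j': "j' = int P * j''"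
    and 1: "u2 [^]\<^bsub>G1\<^esub> j'' \<otimes>\<^bsub>G1\<^esub> X1 [^]\<^bsub>G1\<^esub> (int P * int P * k' + i') = \<one>\<^bsub>G1\<^esub>"
    using E2.gen_pow_emb_eq_one[of "X1 [^]\<^bsub>G1\<^esub> (int P * int P * k' + i')" j'] by auto
  from 1 have "X1 [^]\<^bsub>G1\<^esub> (- int P * j'' + (int P * int P * k' + i')) = \<one>\<^bsub>G1\<^esub>"
    by (simp add: u2_def E1.E.int_pow_pow flip: E1.E.int_pow_mult)
  then have "int P * (2 * int P) dvd - int P * j'' + (int P * int P * k' + i')"
    using X1_order by (simp add: mult_ac)
  then have "int P dvd - int P * j'' + (int P * int P * k' + i')" by (rule dvd_mult_left)
  moreover have "int P dvd - int P * j'' + int P * int P * k'" by simp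
  ultimately have "int P dvd i'"
    by (metis add.assoc dvd_add_right_iff)
  then show ?thesis unfolding i j k j' by auto
qed

end

theorem macdonald_model_exists:
  assumes m: "m \<ge> 2" and l: "odd (l :: int)"
  shows "\<exists>(M :: (nat \<times> nat \<times> nat \<times> nat \<times> nat \<times> unit) monoid) x y. group M \<and> x \<in> carrier M \<and> y \<in> carrier M \<and>
    conjugate M x (commutator M x y) = x [^]\<^bsub>M\<^esub> (1 + 2 ^ m * l) \<and>
    conjugate M y (commutator M y x) = y [^]\<^bsub>M\<^esub> (1 + 2 ^ m * l) \<and>
    x [^]\<^bsub>M\<^esub> ((2::int) ^ (3 * m - 1)) = \<one>\<^bsub>M\<^esub> \<and> y [^]\<^bsub>M\<^esub> ((2::int) ^ (3 * m - 1)) = \<one>\<^bsub>M\<^esub> \<and>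
    (\<forall>(i::int) (j::int) (k::int). x [^]\<^bsub>M\<^esub> i \<otimes>\<^bsub>M\<^esub> y [^]\<^bsub>M\<^esub> j \<otimes>\<^bsub>M\<^esub> commutator M x y [^]\<^bsub>M\<^esub> k = \<one>\<^bsub>M\<^esub> \<longrightarrow>
       2 ^ (2 * m - 1) dvd i \<and> 2 ^ (2 * m - 1) dvd j \<and> 2 ^ (2 * m - 1) dvd k) \<and>
    (\<forall>i :: int. x [^]\<^bsub>M\<^esub> i = \<one>\<^bsub>M\<^esub> \<longrightarrow> 2 ^ (3 * m - 1) dvd i)"
proof -
  obtain p :: int where p: "p = 2 ^ (m - 1)" "2 ^ m = 2 * p" "2 ^ (2 * m - 1) = 2 * p * p"
    "2 ^ (3 * m - 1) = 4 * p * p * p"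
    by (rule pow2_split[OF m])
  define P :: nat where "P = 2 ^ (m - 1)"
  have Pp: "int P = p" by (simp add: P_def p(1))
  have "odd (1 + 2 * p * l)" by simp
  then obtain g where "2 ^ (2 * m - 1) dvd (1 + 2 * p * l) * g - 1" by (rule odd_inverse_mod_pow2)
  then have g: "2 * int P * int P dvd g * (1 + 2 * int P * l) - 1"
    unfolding Pp p(3) by (simp add: mult.commute)
  interpret macdonald_model P l g
    by unfold_locales (use m l g P_def in auto)
  have 4: "4 * p * p * p = 2 * int P * (2 * int P * int P)" by (simp add: Pp)
  show ?thesis
    unfolding p(2-4)
    by (rule exI[of _ G5], rule exI[of _ x5], rule exI[of _ y5], intro conjI allI impI)
      (use group_G5 conj_x5 conj_y5 pow_x5 pow_y5 normal_form_eq_one x5_order in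
        \<open>simp_all add: Pp commutator5 4\<close>)
qed

section \<open>Presentations and quotients by the centre\<close>

lemma (in group_hom) hom_commutator:
  "a \<in> carrier G \<Longrightarrow> b \<in> carrier G \<Longrightarrow> h (commutator G a b) = commutator H (h a) (h b)"
  by (simp add: commutator_def)

lemma (in group_hom) hom_conjugate:
  "a \<in> carrier G \<Longrightarrow> b \<in> carrier G \<Longrightarrow> h (conjugate G a b) = conjugate H (h a) (h b)"
  by (simp add: conjugate_def)

lemma (in group) commutator_closed [simp]:
  "a \<in> carrier G \<Longrightarrow> b \<in> carrier G \<Longrightarrow> commutator G a b \<in> carrier G"
  by (simp add: commutator_def)

lemma (in group) conjugate_closed [simp]:
  "a \<in> carrier G \<Longrightarrow> b \<in> carrier G \<Longrightarrow> conjugate G a b \<in> carrier G"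
  by (simp add: conjugate_def)

section \<open>Homomorphisms out of quotients and presented groups\<close>

context normal
begin

lemma rcos_hom: "(\<lambda>a. H #> a) \<in> hom G (G Mod H)"
  using r_coset_hom_Mod .

lemma rcos_group_hom: "group_hom G (G Mod H) (\<lambda>a. H #> a)"
  by (simp add: group_hom_def group_hom_axioms_def is_group factorgroup_is_group rcos_hom)

lemma rcos_eq_one_iff: "a \<in> carrier G \<Longrightarrow> H #> a = \<one>\<^bsub>G Mod H\<^esub> \<longleftrightarrow> a \<in> H"
  using rcos_self[of a] coset_join2[of a H] by (auto simp: FactGroup_def subgroup_axioms)

lemma carrier_Mod: "carrier (G Mod H) = (\<lambda>a. H #> a) ` carrier G"
  by (auto simp: FactGroup_def RCOSETS_def)

lemma hom_Mod:
  assumes K: "group K" and h: "h \<in> hom G K" and ker: "\<And>a. a \<in> H \<Longrightarrow> h a = \<one>\<^bsub>K\<^esub>"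
  obtains f where "f \<in> hom (G Mod H) K" "\<And>a. a \<in> carrier G \<Longrightarrow> f (H #> a) = h a"
proof -
  interpret h: group_hom G K h
    using K h by (simp add: group_hom_def group_hom_axioms_def is_group)
  interpret p: group_hom G "G Mod H" "\<lambda>a. H #> a" by (rule rcos_group_hom)
  define f where "f A = h (SOME a. a \<in> carrier G \<and> H #> a = A)" for A
  have f: "f (H #> a) = h a" if a: "a \<in> carrier G" for a
  proof -
    define b where "b = (SOME b. b \<in> carrier G \<and> H #> b = H #> a)"
    have "b \<in> carrier G \<and> H #> b = H #> a"
      unfolding b_def by (rule someI[of _ a]) (use a in simp)
    then have b: "b \<in> carrier G" "H #> b = H #> a" by auto
    have "H #> (b \<otimes> inv a) = \<one>\<^bsub>G Mod H\<^esub>"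
      using a b(1) p.hom_closed[OF a] by (simp only: p.hom_mult inv_closed p.hom_inv b(2) p.H.r_inv)
    then have "b \<otimes> inv a \<in> H" using a b(1) rcos_eq_one_iff[of "b \<otimes> inv a"] by blast
    then have "h (b \<otimes> inv a) = \<one>\<^bsub>K\<^esub>" by (rule ker)
    then have "h b = h a"
      using a b(1) by (simp add: h.H.inv_equality h.H.inv_solve_right')
    then show ?thesis by (simp add: f_def b_def)
  qed
  have "f \<in> hom (G Mod H) K"
  proof (rule homI)
    fix A B assume "A \<in> carrier (G Mod H)" "B \<in> carrier (G Mod H)"
    then obtain a b where ab: "A = H #> a" "B = H #> b" and c: "a \<in> carrier G" "b \<in> carrier G"
      unfolding carrier_Mod by blast
    show "f (A \<otimes>\<^bsub>G Mod H\<^esub> B) = f A \<otimes>\<^bsub>K\<^esub> f B"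
    proof -
      have eq: "(H #> a) \<otimes>\<^bsub>G Mod H\<^esub> (H #> b) = H #> (a \<otimes> b)"
        by (rule p.hom_mult[symmetric, OF c])
      show ?thesis unfolding ab eq by (simp only: f c m_closed h.hom_mult)
    qed
  qed (auto simp: carrier_Mod f)
  then show thesis using f by (rule that)
qed

end

lemma normal_closure_subset: "N \<lhd> G \<Longrightarrow> S \<subseteq> N \<Longrightarrow> normal_closure G S \<subseteq> N"
  by (auto simp: normal_closure_def)

lemma subset_normal_closure: "S \<subseteq> normal_closure G S"
  by (auto simp: normal_closure_def)

definition relators :: "(('g \<times> bool) list set \<times> ('g \<times> bool) list set) set \<Rightarrow> ('g \<times> bool) list set set" where
  "relators R = (\<lambda>(r, s). r \<otimes>\<^bsub>free_group\<^esub> inv\<^bsub>free_group\<^esub> s) ` R"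

definition presented_class ::
  "(('g \<times> bool) list set \<times> ('g \<times> bool) list set) set \<Rightarrow> ('g \<times> bool) list set \<Rightarrow> ('g \<times> bool) list set set" where
  "presented_class R a = normal_closure free_group (relators R) #>\<^bsub>free_group\<^esub> a"

context
  fixes R :: "(('g \<times> bool) list set \<times> ('g \<times> bool) list set) set"
  assumes R: "R \<subseteq> carrier free_group \<times> carrier free_group"
begin

interpretation F: group "free_group :: ('g \<times> bool) list set monoid"
  by (rule group_free_group)

interpretation N: normal "normal_closure free_group (relators R)" free_group
  unfolding relators_def by (intro F.normal_closure_normal presented_relators_closed R)

lemma presented_group_eq: "presented_group R = free_group Mod normal_closure free_group (relators R)"
  by (simp add: presented_group_def relators_def)

lemma presented_group_hom: "group_hom free_group (presented_group R) (presented_class R)"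
  unfolding presented_group_eq presented_class_def by (rule N.rcos_group_hom)

lemma carrier_presented_group: "carrier (presented_group R) = presented_class R ` carrier free_group"
  unfolding presented_group_eq presented_class_def by (rule N.carrier_Mod)

lemma presented_class_eq_iff:
  assumes "r \<in> carrier free_group" "s \<in> carrier free_group"
  shows "presented_class R r = presented_class R s \<longleftrightarrow>
    r \<otimes>\<^bsub>free_group\<^esub> inv\<^bsub>free_group\<^esub> s \<in> normal_closure free_group (relators R)"
proof -
  interpret p: group_hom free_group "presented_group R" "presented_class R"
    by (rule presented_group_hom)
  have "presented_class R r = presented_class R s \<longleftrightarrow>
      presented_class R (r \<otimes>\<^bsub>free_group\<^esub> inv\<^bsub>free_group\<^esub> s) = \<one>\<^bsub>presented_group R\<^esub>"
    using assms p.H.inv_solve_right'[of "\<one>\<^bsub>presented_group R\<^esub>" "presented_class R r" "presented_class R s"]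
    by auto
  also have "\<dots> \<longleftrightarrow> r \<otimes>\<^bsub>free_group\<^esub> inv\<^bsub>free_group\<^esub> s \<in> normal_closure free_group (relators R)"
    unfolding presented_group_eq presented_class_def using assms by (intro N.rcos_eq_one_iff) simp
  finally show ?thesis .
qed

lemma presented_class_eq: "(r, s) \<in> R \<Longrightarrow> presented_class R r = presented_class R s"
proof -
  assume rs: "(r, s) \<in> R"
  then have "r \<otimes>\<^bsub>free_group\<^esub> inv\<^bsub>free_group\<^esub> s \<in> relators R" unfolding relators_def by force
  then show ?thesis
    using rs R subset_normal_closure[of "relators R"] by (subst presented_class_eq_iff) auto
qed

lemma hom_presented_group:
  assumes H: "group H" and h: "h \<in> hom free_group H" and eq: "\<And>r s. (r, s) \<in> R \<Longrightarrow> h r = h s"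
  obtains f where "f \<in> hom (presented_group R) H"
    "\<And>a. a \<in> carrier free_group \<Longrightarrow> f (presented_class R a) = h a"
proof -
  interpret h: group_hom free_group H h
    using H h by (simp add: group_hom_def group_hom_axioms_def F.is_group)
  have "relators R \<subseteq> kernel free_group H h"
  proof
    fix t assume "t \<in> relators R"
    then obtain r s where t: "t = r \<otimes>\<^bsub>free_group\<^esub> inv\<^bsub>free_group\<^esub> s" and rs: "(r, s) \<in> R"
      unfolding relators_def by auto
    have "r \<in> carrier free_group" "s \<in> carrier free_group" using rs R by auto
    then show "t \<in> kernel free_group H h" using eq[OF rs] by (simp add: t kernel_def)
  qed
  then have "normal_closure free_group (relators R) \<subseteq> kernel free_group H h"
    by (rule normal_closure_subset[OF h.normal_kernel])
  then have "h a = \<one>\<^bsub>H\<^esub>" if "a \<in> normal_closure free_group (relators R)" for a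
    using that by (auto simp: kernel_def)
  then show thesis
    using N.hom_Mod[OF H h] that unfolding presented_group_eq presented_class_def by metis
qed

end

text \<open>Equivalent sets of relations have the same normal closure, so the presented groups are
  equal and not merely isomorphic.\<close>

lemma presented_group_cong:
  assumes R: "R \<subseteq> carrier free_group \<times> carrier free_group"
    and R': "R' \<subseteq> carrier free_group \<times> carrier free_group"
    and 1: "\<And>r s. (r, s) \<in> R' \<Longrightarrow> presented_class R r = presented_class R s"
    and 2: "\<And>r s. (r, s) \<in> R \<Longrightarrow> presented_class R' r = presented_class R' s"
  shows "presented_group R = presented_group R'"
proof -
  interpret F: group "free_group :: ('a \<times> bool) list set monoid" by (rule group_free_group)
  have sub: "normal_closure free_group (relators S') \<subseteq> normal_closure free_group (relators S)"
    if S: "S \<subseteq> carrier free_group \<times> carrier free_group" "S' \<subseteq> carrier free_group \<times> carrier free_group"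
      and eq: "\<And>r s. (r, s) \<in> S' \<Longrightarrow> presented_class S r = presented_class S s"
    for S S' :: "(('a \<times> bool) list set \<times> ('a \<times> bool) list set) set"
  proof (rule normal_closure_subset)
    show "normal_closure free_group (relators S) \<lhd> free_group"
      unfolding relators_def by (intro F.normal_closure_normal presented_relators_closed S)
    show "relators S' \<subseteq> normal_closure free_group (relators S)"
    proof
      fix t assume "t \<in> relators S'"
      then obtain r s where t: "t = r \<otimes>\<^bsub>free_group\<^esub> inv\<^bsub>free_group\<^esub> s" and rs: "(r, s) \<in> S'"
        unfolding relators_def by auto
      show "t \<in> normal_closure free_group (relators S)"
        using presented_class_eq_iff[OF S(1), of r s] eq[OF rs] rs S(2) by (auto simp: t)
    qed
  qed
  show ?thesis
    unfolding presented_group_eq[OF R] presented_group_eq[OF R']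
    using sub[OF R R' 1] sub[OF R' R 2] by simp
qed

section \<open>\<open>J2\<close> as a presented group, and the passage to \<open>H2\<close>\<close>

definition J2_x :: "int \<Rightarrow> (generator \<times> bool) list set set" where
  "J2_x \<alpha> = presented_class (J2_relations \<alpha>) (free_gen Gen_x)"

definition J2_y :: "int \<Rightarrow> (generator \<times> bool) list set set" where
  "J2_y \<alpha> = presented_class (J2_relations \<alpha>) (free_gen Gen_y)"

lemma J2_relations_closed: "J2_relations \<alpha> \<subseteq> carrier free_group \<times> carrier free_group"
proof -
  interpret F: group "free_group :: (generator \<times> bool) list set monoid" by (rule group_free_group)
  show ?thesis by (simp add: J2_relations_def Let_def free_gen_closed)
qed

lemma J2_proj: "group_hom free_group (J2 \<alpha>) (presented_class (J2_relations \<alpha>))"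
  unfolding J2_def by (rule presented_group_hom[OF J2_relations_closed])

lemma J2_rel:
  shows "J2_x \<alpha> \<in> carrier (J2 \<alpha>)" "J2_y \<alpha> \<in> carrier (J2 \<alpha>)"
    "conjugate (J2 \<alpha>) (J2_x \<alpha>) (commutator (J2 \<alpha>) (J2_x \<alpha>) (J2_y \<alpha>)) = J2_x \<alpha> [^]\<^bsub>J2 \<alpha>\<^esub> \<alpha>"
    "conjugate (J2 \<alpha>) (J2_y \<alpha>) (commutator (J2 \<alpha>) (J2_y \<alpha>) (J2_x \<alpha>)) = J2_y \<alpha> [^]\<^bsub>J2 \<alpha>\<^esub> \<alpha>"
    "J2_x \<alpha> [^]\<^bsub>J2 \<alpha>\<^esub> ((2::int) ^ (3 * level \<alpha> - 1)) = \<one>\<^bsub>J2 \<alpha>\<^esub>"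
    "J2_y \<alpha> [^]\<^bsub>J2 \<alpha>\<^esub> ((2::int) ^ (3 * level \<alpha> - 1)) = \<one>\<^bsub>J2 \<alpha>\<^esub>"
proof -
  interpret p: group_hom free_group "J2 \<alpha>" "presented_class (J2_relations \<alpha>)" by (rule J2_proj)
  let ?x = "free_gen Gen_x" and ?y = "free_gen Gen_y" and ?n = "(2::nat) ^ (3 * level \<alpha> - 1)"
  have mem: "(conjugate free_group ?x (commutator free_group ?x ?y), ?x [^]\<^bsub>free_group\<^esub> \<alpha>) \<in> J2_relations \<alpha>"
    "(conjugate free_group ?y (commutator free_group ?y ?x), ?y [^]\<^bsub>free_group\<^esub> \<alpha>) \<in> J2_relations \<alpha>"
    "(?x [^]\<^bsub>free_group\<^esub> ?n, \<one>\<^bsub>free_group\<^esub>) \<in> J2_relations \<alpha>"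
    "(?y [^]\<^bsub>free_group\<^esub> ?n, \<one>\<^bsub>free_group\<^esub>) \<in> J2_relations \<alpha>"
    by (simp_all add: J2_relations_def Let_def)
  note eq = mem[THEN presented_class_eq[OF J2_relations_closed]]
  have pow: "b [^]\<^bsub>J2 \<alpha>\<^esub> ((2::int) ^ k) = b [^]\<^bsub>J2 \<alpha>\<^esub> ((2::nat) ^ k)" for b k
    by (metis int_pow_int of_nat_numeral of_nat_power)
  show "J2_x \<alpha> \<in> carrier (J2 \<alpha>)" "J2_y \<alpha> \<in> carrier (J2 \<alpha>)"
    by (simp_all add: J2_x_def J2_y_def free_gen_closed)
  show "conjugate (J2 \<alpha>) (J2_x \<alpha>) (commutator (J2 \<alpha>) (J2_x \<alpha>) (J2_y \<alpha>)) = J2_x \<alpha> [^]\<^bsub>J2 \<alpha>\<^esub> \<alpha>"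
    using eq(1) by (simp add: J2_x_def J2_y_def free_gen_closed p.hom_conjugate p.hom_commutator p.hom_int_pow)
  show "conjugate (J2 \<alpha>) (J2_y \<alpha>) (commutator (J2 \<alpha>) (J2_y \<alpha>) (J2_x \<alpha>)) = J2_y \<alpha> [^]\<^bsub>J2 \<alpha>\<^esub> \<alpha>"
    using eq(2) by (simp add: J2_x_def J2_y_def free_gen_closed p.hom_conjugate p.hom_commutator p.hom_int_pow)
  show "J2_x \<alpha> [^]\<^bsub>J2 \<alpha>\<^esub> ((2::int) ^ (3 * level \<alpha> - 1)) = \<one>\<^bsub>J2 \<alpha>\<^esub>"
    using eq(3) unfolding pow by (simp add: J2_x_def free_gen_closed p.hom_nat_pow)
  show "J2_y \<alpha> [^]\<^bsub>J2 \<alpha>\<^esub> ((2::int) ^ (3 * level \<alpha> - 1)) = \<one>\<^bsub>J2 \<alpha>\<^esub>"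
    using eq(4) unfolding pow by (simp add: J2_y_def free_gen_closed p.hom_nat_pow)
qed

lemma J2_hom:
  assumes H: "group H" and u: "u \<in> carrier H" and v: "v \<in> carrier H"
    and "conjugate H u (commutator H u v) = u [^]\<^bsub>H\<^esub> \<alpha>"
    and "conjugate H v (commutator H v u) = v [^]\<^bsub>H\<^esub> \<alpha>"
    and "u [^]\<^bsub>H\<^esub> ((2::int) ^ (3 * level \<alpha> - 1)) = \<one>\<^bsub>H\<^esub>"
    and "v [^]\<^bsub>H\<^esub> ((2::int) ^ (3 * level \<alpha> - 1)) = \<one>\<^bsub>H\<^esub>"
  obtains f where "f \<in> hom (J2 \<alpha>) H" "f (J2_x \<alpha>) = u" "f (J2_y \<alpha>) = v"
proof -
  interpret H: group H by fact
  have "range (\<lambda>k. case k of Gen_x \<Rightarrow> u | Gen_y \<Rightarrow> v) \<subseteq> carrier H"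
    using u v by (auto split: generator.splits)
  from H.free_group_universal[OF this] obtain h where h: "h \<in> hom free_group H"
    "h (free_gen Gen_x) = u" "h (free_gen Gen_y) = v" by auto
  interpret h: group_hom free_group H h
    using H h by (simp add: group_hom_def group_hom_axioms_def group_free_group)
  have pow: "b [^]\<^bsub>H\<^esub> ((2::int) ^ k) = b [^]\<^bsub>H\<^esub> ((2::nat) ^ k)" for b k
    by (metis int_pow_int of_nat_numeral of_nat_power)
  have eq: "h r = h s" if "(r, s) \<in> J2_relations \<alpha>" for r s
    using that assms(4-7) unfolding pow
    by (auto simp: J2_relations_def Let_def free_gen_closed h.hom_conjugate h.hom_commutator
        h.hom_int_pow h.hom_nat_pow h(2,3))
  obtain f where "f \<in> hom (presented_group (J2_relations \<alpha>)) H"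
    "\<And>a. a \<in> carrier free_group \<Longrightarrow> f (presented_class (J2_relations \<alpha>) a) = h a"
    using hom_presented_group[OF J2_relations_closed H h(1) eq] by metis
  then show thesis
    using that[of f] by (simp add: J2_def J2_x_def J2_y_def free_gen_closed h(2,3))
qed

text \<open>Every word is a product of generators and inverses, and the inverse of a generator is a
  nonnegative power of it.\<close>

lemma J2_generated:
  assumes one: "\<one>\<^bsub>J2 \<alpha>\<^esub> \<in> S"
    and step: "\<And>h. h \<in> S \<Longrightarrow> h \<in> carrier (J2 \<alpha>) \<Longrightarrow> h \<otimes>\<^bsub>J2 \<alpha>\<^esub> J2_x \<alpha> \<in> S \<and> h \<otimes>\<^bsub>J2 \<alpha>\<^esub> J2_y \<alpha> \<in> S"
  shows "carrier (J2 \<alpha>) \<subseteq> S"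
proof -
  interpret p: group_hom free_group "J2 \<alpha>" "presented_class (J2_relations \<alpha>)" by (rule J2_proj)
  let ?p = "presented_class (J2_relations \<alpha>)"
  have gen: "?p (free_gen k) \<in> {J2_x \<alpha>, J2_y \<alpha>}" for k
    by (cases k) (simp_all add: J2_x_def J2_y_def)
  have pow: "h \<otimes>\<^bsub>J2 \<alpha>\<^esub> b [^]\<^bsub>J2 \<alpha>\<^esub> (n::nat) \<in> S"
    if "h \<in> S" "h \<in> carrier (J2 \<alpha>)" "b \<in> {J2_x \<alpha>, J2_y \<alpha>}" for h b n
  proof (induction n)
    case (Suc n)
    have b: "b \<in> carrier (J2 \<alpha>)" using that(3) J2_rel(1,2)[of \<alpha>] by auto
    then show ?case
      using step[OF Suc] that(2,3) by (auto simp: p.H.m_assoc)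
  qed (use that in simp)
  have inv: "h \<otimes>\<^bsub>J2 \<alpha>\<^esub> inv\<^bsub>J2 \<alpha>\<^esub> b \<in> S"
    if "h \<in> S" "h \<in> carrier (J2 \<alpha>)" "b \<in> {J2_x \<alpha>, J2_y \<alpha>}" for h b
  proof -
    let ?n = "(2::nat) ^ (3 * level \<alpha> - 1)"
    have b: "b \<in> carrier (J2 \<alpha>)" using that(3) J2_rel(1,2)[of \<alpha>] by auto
    have "b [^]\<^bsub>J2 \<alpha>\<^esub> ?n = \<one>\<^bsub>J2 \<alpha>\<^esub>"
      using that(3) J2_rel(5,6)[of \<alpha>] by (auto simp flip: int_pow_int)
    then have "b [^]\<^bsub>J2 \<alpha>\<^esub> (?n - 1) \<otimes>\<^bsub>J2 \<alpha>\<^esub> b = \<one>\<^bsub>J2 \<alpha>\<^esub>"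
      by (metis Suc_pred' nat_pow_Suc pos2 zero_less_power)
    then have "inv\<^bsub>J2 \<alpha>\<^esub> b = b [^]\<^bsub>J2 \<alpha>\<^esub> (?n - 1)"
      using b p.H.inv_equality by simp
    then show ?thesis using pow[OF that] by simp
  qed
  have "?p (word_class w) \<in> S" for w
  proof (induction w rule: rev_induct)
    case Nil
    then show ?case using one p.hom_one by (simp add: one_free_group)
  next
    case (snoc a w)
    obtain k b where a: "a = (k, b)" by (cases a)
    have "?p (word_class (w @ [a])) = ?p (word_class w) \<otimes>\<^bsub>J2 \<alpha>\<^esub> ?p (word_class [a])"
      by (simp add: carrier_free_group flip: free_group_mult p.hom_mult)
    moreover have "?p (word_class [a]) = (if b then ?p (free_gen k) else inv\<^bsub>J2 \<alpha>\<^esub> ?p (free_gen k))"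
      using p.hom_inv[OF free_gen_closed[of k]] by (simp add: a inv_free_gen) (simp add: free_gen_def)
    moreover have "?p (word_class w) \<in> carrier (J2 \<alpha>)"
      by (rule p.hom_closed) (simp add: carrier_free_group)
    ultimately show ?case
      using snoc inv[OF snoc _ gen] pow[OF snoc _ gen, where n = 1]
      by (simp add: free_gen_closed split: if_splits)
  qed
  then show ?thesis
    unfolding J2_def carrier_presented_group[OF J2_relations_closed] by (auto simp: carrier_free_group)
qed

text \<open>The exponent \<alpha> is applied only to \<open>x\<close> and \<open>y\<close>, whose
  \<open>2^(3m-1)\<close>-th powers are trivial. This settles \<open>m = 1\<close>.\<close>

lemma J2_cong:
  assumes level: "level \<alpha> = level \<beta>" and cong: "2 ^ (3 * level \<alpha> - 1) dvd \<alpha> - \<beta>"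
  shows "J2 \<alpha> = J2 \<beta>"
proof -
  have *: "presented_class (J2_relations \<alpha>) r = presented_class (J2_relations \<alpha>) s"
    if level: "level \<alpha> = level \<beta>" and cong: "2 ^ (3 * level \<alpha> - 1) dvd \<alpha> - \<beta>"
      and rs: "(r, s) \<in> J2_relations \<beta>" for \<alpha> \<beta> r s
  proof -
    interpret p: group_hom free_group "J2 \<alpha>" "presented_class (J2_relations \<alpha>)" by (rule J2_proj)
    note rel = J2_rel[of \<alpha>]
    have "J2_x \<alpha> [^]\<^bsub>J2 \<alpha>\<^esub> \<alpha> = J2_x \<alpha> [^]\<^bsub>J2 \<alpha>\<^esub> \<beta>" "J2_y \<alpha> [^]\<^bsub>J2 \<alpha>\<^esub> \<alpha> = J2_y \<alpha> [^]\<^bsub>J2 \<alpha>\<^esub> \<beta>"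
      by (rule p.H.int_pow_cong[OF _ _ cong]; rule rel)+
    moreover have pow: "b [^]\<^bsub>J2 \<alpha>\<^esub> ((2::int) ^ k) = b [^]\<^bsub>J2 \<alpha>\<^esub> ((2::nat) ^ k)" for b k
      by (metis int_pow_int of_nat_numeral of_nat_power)
    let ?x = "free_gen Gen_x" and ?y = "free_gen Gen_y" and ?n = "(2::nat) ^ (3 * level \<beta> - 1)"
    have "(r, s) = (conjugate free_group ?x (commutator free_group ?x ?y), ?x [^]\<^bsub>free_group\<^esub> \<beta>)
      \<or> (r, s) = (conjugate free_group ?y (commutator free_group ?y ?x), ?y [^]\<^bsub>free_group\<^esub> \<beta>)
      \<or> (r, s) = (?x [^]\<^bsub>free_group\<^esub> ?n, \<one>\<^bsub>free_group\<^esub>)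
      \<or> (r, s) = (?y [^]\<^bsub>free_group\<^esub> ?n, \<one>\<^bsub>free_group\<^esub>)"
      using rs by (simp add: J2_relations_def Let_def)
    ultimately show ?thesis
      using rel(3-6) unfolding pow level[symmetric]
      by (elim disjE) (simp_all add: free_gen_closed p.hom_conjugate p.hom_commutator
          p.hom_int_pow p.hom_nat_pow J2_x_def J2_y_def)
  qed
  have "2 ^ (3 * level \<beta> - 1) dvd \<beta> - \<alpha>"
    using cong level by (simp add: dvd_diff_commute)
  then show ?thesis
    unfolding J2_def
    by (intro presented_group_cong J2_relations_closed *[OF level cong] *[OF level[symmetric]])
qed

text \<open>What the coordinate calculations in \<open>H2\<close> rest on. Here
  \<open>1 - 2^m l\<close> inverts \<open>1 + 2^m l\<close>, because the square of
  \<open>2^m l\<close> is 0 modulo \<open>2^(2m-1)\<close>.\<close>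

locale macdonald_quotient = macdonald_pair G x y "1 + 2 ^ m * l" "1 - 2 ^ m * l" "2 ^ (2 * m - 1)"
  for G (structure) and x y :: 'a and m :: nat and l :: int +
  assumes m: "m \<ge> 2" and l: "odd l"
    and pow_z: "z [^] ((2::int) ^ (2 * m - 1)) = \<one>"
    and normal_form: "\<And>h. h \<in> carrier G \<Longrightarrow> \<exists>(i::nat) (j::nat) (k::nat). h = x [^] i \<otimes> y [^] j \<otimes> z [^] k"
    and unique: "\<And>i j k. x [^] (i::int) \<otimes> y [^] (j::int) \<otimes> z [^] (k::int) = \<one> \<Longrightarrow>
      2 ^ (2 * m - 1) dvd i \<and> 2 ^ (2 * m - 1) dvd j \<and> 2 ^ (2 * m - 1) dvd k"

definition H2_x :: "int \<Rightarrow> (generator \<times> bool) list set set set" where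
  "H2_x \<alpha> = center (J2 \<alpha>) #>\<^bsub>J2 \<alpha>\<^esub> J2_x \<alpha>"

definition H2_y :: "int \<Rightarrow> (generator \<times> bool) list set set set" where
  "H2_y \<alpha> = center (J2 \<alpha>) #>\<^bsub>J2 \<alpha>\<^esub> J2_y \<alpha>"

context
  fixes m :: nat and l \<alpha> :: int
  assumes m: "m \<ge> 2" and l: "odd l" and \<alpha>: "\<alpha> = 1 + 2 ^ m * l"
begin

lemma level_alpha: "level \<alpha> = m"
  unfolding \<alpha> by (rule level_eq[OF l])

interpretation J: group "J2 \<alpha>" by (rule group_J2)

interpretation Z: normal "center (J2 \<alpha>)" "J2 \<alpha>" by (rule J.center_normal)

interpretation p: group_hom "J2 \<alpha>" "H2 \<alpha>" "\<lambda>a. center (J2 \<alpha>) #>\<^bsub>J2 \<alpha>\<^esub> a"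
  unfolding H2_def by (rule Z.rcos_group_hom)

lemma J2_macdonald: "\<exists>l' g. macdonald_generated (J2 \<alpha>) (J2_x \<alpha>) (J2_y \<alpha>) m l' g"
proof -
  \<comment> \<open>A positive odd representative of \<open>l\<close>, as the locale
    \<open>macdonald\<close> demands; reducing modulo \<open>2^(2m-1)\<close> keeps \<alpha> modulo
    \<open>2^(3m-1)\<close>.\<close>
  define l' where "l' = l mod 2 ^ (2 * m - 1)"
  have "(2::int) ^ (2 * m - 1) = 2 * 2 ^ (2 * m - 2)"
    using m by (simp flip: power_Suc add: Suc_diff_le numeral_2_eq_2)
  then have l': "odd l'"
    unfolding l'_def using l by (metis dvd_mod_iff dvd_triv_left)
  have "l' \<ge> 0" by (simp add: l'_def)
  moreover have "l' \<noteq> 0" using l' by auto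
  ultimately have "l' > 0" by simp
  obtain t where t: "l = l' + 2 ^ (2 * m - 1) * t"
    unfolding l'_def by (metis add.commute mult_div_mod_eq)
  have "(2::int) ^ m * 2 ^ (2 * m - 1) = 2 ^ (3 * m - 1)"
    using m by (simp flip: power_add)
  then have cong: "2 ^ (3 * m - 1) dvd \<alpha> - (1 + 2 ^ m * l')"
    by (simp add: \<alpha> t algebra_simps flip: mult.assoc)
  have "odd (1 + 2 ^ m * l')" using m by simp
  then obtain g where "2 ^ (3 * m - 1) dvd (1 + 2 ^ m * l') * g - 1" by (rule odd_inverse_mod_pow2)
  then have g: "2 ^ (3 * m - 1) dvd g * (1 + 2 ^ m * l') - 1" by (simp add: mult.commute)
  note rel = J2_rel[of \<alpha>, unfolded level_alpha]
  have "macdonald_generated (J2 \<alpha>) (J2_x \<alpha>) (J2_y \<alpha>) m l' g"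
  proof unfold_locales
    show "conjugate (J2 \<alpha>) (J2_x \<alpha>) (commutator (J2 \<alpha>) (J2_x \<alpha>) (J2_y \<alpha>))
        = J2_x \<alpha> [^]\<^bsub>J2 \<alpha>\<^esub> (1 + 2 ^ m * l')"
      unfolding rel(3) by (rule J.int_pow_cong[OF rel(1,5) cong])
    show "conjugate (J2 \<alpha>) (J2_y \<alpha>) (commutator (J2 \<alpha>) (J2_y \<alpha>) (J2_x \<alpha>))
        = J2_y \<alpha> [^]\<^bsub>J2 \<alpha>\<^esub> (1 + 2 ^ m * l')"
      unfolding rel(4) by (rule J.int_pow_cong[OF rel(2,6) cong])
    show "carrier (J2 \<alpha>) \<subseteq> S" if "\<one>\<^bsub>J2 \<alpha>\<^esub> \<in> S"
      "\<And>h. h \<in> S \<Longrightarrow> h \<in> carrier (J2 \<alpha>) \<Longrightarrow> h \<otimes>\<^bsub>J2 \<alpha>\<^esub> J2_x \<alpha> \<in> S \<and> h \<otimes>\<^bsub>J2 \<alpha>\<^esub> J2_y \<alpha> \<in> S" for S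
      using that by (rule J2_generated)
  qed (use rel m l' g \<open>l' > 0\<close> in auto)
  then show ?thesis by blast
qed

lemma J2_unique:
  shows "J2_x \<alpha> [^]\<^bsub>J2 \<alpha>\<^esub> (i::int) \<otimes>\<^bsub>J2 \<alpha>\<^esub> J2_y \<alpha> [^]\<^bsub>J2 \<alpha>\<^esub> (j::int) \<otimes>\<^bsub>J2 \<alpha>\<^esub>
      commutator (J2 \<alpha>) (J2_x \<alpha>) (J2_y \<alpha>) [^]\<^bsub>J2 \<alpha>\<^esub> (k::int) = \<one>\<^bsub>J2 \<alpha>\<^esub> \<Longrightarrow>
      2 ^ (2 * m - 1) dvd i \<and> 2 ^ (2 * m - 1) dvd j \<and> 2 ^ (2 * m - 1) dvd k"
    and "J2_x \<alpha> [^]\<^bsub>J2 \<alpha>\<^esub> i = \<one>\<^bsub>J2 \<alpha>\<^esub> \<Longrightarrow> 2 ^ (3 * m - 1) dvd i"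
proof -
  obtain M :: "(nat \<times> nat \<times> nat \<times> nat \<times> nat \<times> unit) monoid" and x y where M: "group M" "x \<in> carrier M" "y \<in> carrier M"
    "conjugate M x (commutator M x y) = x [^]\<^bsub>M\<^esub> (1 + 2 ^ m * l)"
    "conjugate M y (commutator M y x) = y [^]\<^bsub>M\<^esub> (1 + 2 ^ m * l)"
    "x [^]\<^bsub>M\<^esub> ((2::int) ^ (3 * m - 1)) = \<one>\<^bsub>M\<^esub>" "y [^]\<^bsub>M\<^esub> ((2::int) ^ (3 * m - 1)) = \<one>\<^bsub>M\<^esub>"
    and U1: "\<And>i j k. x [^]\<^bsub>M\<^esub> (i::int) \<otimes>\<^bsub>M\<^esub> y [^]\<^bsub>M\<^esub> (j::int) \<otimes>\<^bsub>M\<^esub> commutator M x y [^]\<^bsub>M\<^esub> (k::int) = \<one>\<^bsub>M\<^esub> \<Longrightarrow>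
       2 ^ (2 * m - 1) dvd i \<and> 2 ^ (2 * m - 1) dvd j \<and> 2 ^ (2 * m - 1) dvd k"
    and U2: "\<And>i :: int. x [^]\<^bsub>M\<^esub> i = \<one>\<^bsub>M\<^esub> \<Longrightarrow> 2 ^ (3 * m - 1) dvd i"
    using macdonald_model_exists[OF m l] by blast
  obtain f where f: "f \<in> hom (J2 \<alpha>) M" "f (J2_x \<alpha>) = x" "f (J2_y \<alpha>) = y"
    by (rule J2_hom[OF M(1-3)[simplified], of \<alpha>]) (use M in \<open>simp_all only: level_alpha \<alpha>[symmetric]\<close>)
  interpret f: group_hom "J2 \<alpha>" M f
    using M(1) f(1) by (simp add: group_hom_def group_hom_axioms_def J.is_group)
  note rel = J2_rel[of \<alpha>]
  show "2 ^ (2 * m - 1) dvd i \<and> 2 ^ (2 * m - 1) dvd j \<and> 2 ^ (2 * m - 1) dvd k"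
    if "J2_x \<alpha> [^]\<^bsub>J2 \<alpha>\<^esub> (i::int) \<otimes>\<^bsub>J2 \<alpha>\<^esub> J2_y \<alpha> [^]\<^bsub>J2 \<alpha>\<^esub> (j::int) \<otimes>\<^bsub>J2 \<alpha>\<^esub>
      commutator (J2 \<alpha>) (J2_x \<alpha>) (J2_y \<alpha>) [^]\<^bsub>J2 \<alpha>\<^esub> (k::int) = \<one>\<^bsub>J2 \<alpha>\<^esub>"
  proof (rule U1)
    show "x [^]\<^bsub>M\<^esub> i \<otimes>\<^bsub>M\<^esub> y [^]\<^bsub>M\<^esub> j \<otimes>\<^bsub>M\<^esub> commutator M x y [^]\<^bsub>M\<^esub> k = \<one>\<^bsub>M\<^esub>"
      using arg_cong[OF that, of f] rel(1,2) by (simp add: f.hom_int_pow f.hom_commutator f(2,3))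
  qed
  show "2 ^ (3 * m - 1) dvd i" if "J2_x \<alpha> [^]\<^bsub>J2 \<alpha>\<^esub> i = \<one>\<^bsub>J2 \<alpha>\<^esub>"
    using arg_cong[OF that, of f] rel(1) U2 by (simp add: f.hom_int_pow f(2))
qed

lemma center_J2: "center (J2 \<alpha>) = {J2_x \<alpha> [^]\<^bsub>J2 \<alpha>\<^esub> (2 ^ (2 * m - 1) * i) | i :: int. True}"
proof -
  obtain l' g where "macdonald_generated (J2 \<alpha>) (J2_x \<alpha>) (J2_y \<alpha>) m l' g" using J2_macdonald by blast
  then interpret mg: macdonald_generated "J2 \<alpha>" "J2_x \<alpha>" "J2_y \<alpha>" m l' g .
  show ?thesis
    using mg.center_eq J2_unique unfolding mg.N_def mg.z_def by blast
qed

lemma H2_macdonald_quotient: "macdonald_quotient (H2 \<alpha>) (H2_x \<alpha>) (H2_y \<alpha>) m l"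
proof -
  obtain l' g where "macdonald_generated (J2 \<alpha>) (J2_x \<alpha>) (J2_y \<alpha>) m l' g" using J2_macdonald by blast
  then interpret mg: macdonald_generated "J2 \<alpha>" "J2_x \<alpha>" "J2_y \<alpha>" m l' g .
  note rel = J2_rel[of \<alpha>]
  let ?p = "\<lambda>a. center (J2 \<alpha>) #>\<^bsub>J2 \<alpha>\<^esub> a"
  have xy: "H2_x \<alpha> = ?p (J2_x \<alpha>)" "H2_y \<alpha> = ?p (J2_y \<alpha>)"
    by (simp_all add: H2_x_def H2_y_def)
  have z: "commutator (H2 \<alpha>) (H2_x \<alpha>) (H2_y \<alpha>) = ?p mg.z"
    unfolding xy mg.z_def by (rule p.hom_commutator[symmetric]; rule rel)
  have one: "?p a = \<one>\<^bsub>H2 \<alpha>\<^esub> \<longleftrightarrow> a \<in> center (J2 \<alpha>)" if "a \<in> carrier (J2 \<alpha>)" for a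
    using Z.rcos_eq_one_iff[OF that] by (simp add: H2_def)
  interpret hp: macdonald_pair "H2 \<alpha>" "H2_x \<alpha>" "H2_y \<alpha>" "1 + 2 ^ m * l" "1 - 2 ^ m * l" "2 ^ (2 * m - 1)"
  proof unfold_locales
    show "H2_x \<alpha> \<in> carrier (H2 \<alpha>)" "H2_y \<alpha> \<in> carrier (H2 \<alpha>)"
      unfolding xy using rel(1,2) by (auto intro: p.hom_closed)
    show "conjugate (H2 \<alpha>) (H2_x \<alpha>) (commutator (H2 \<alpha>) (H2_x \<alpha>) (H2_y \<alpha>)) = H2_x \<alpha> [^]\<^bsub>H2 \<alpha>\<^esub> (1 + 2 ^ m * l)"
      using rel(1,2) arg_cong[OF rel(3), of ?p]
      by (simp add: xy \<alpha>[symmetric] p.hom_conjugate p.hom_commutator p.hom_int_pow)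
    show "conjugate (H2 \<alpha>) (H2_y \<alpha>) (commutator (H2 \<alpha>) (H2_y \<alpha>) (H2_x \<alpha>)) = H2_y \<alpha> [^]\<^bsub>H2 \<alpha>\<^esub> (1 + 2 ^ m * l)"
      using rel(1,2) arg_cong[OF rel(4), of ?p]
      by (simp add: xy \<alpha>[symmetric] p.hom_conjugate p.hom_commutator p.hom_int_pow)
    have 1: "J2_x \<alpha> [^]\<^bsub>J2 \<alpha>\<^esub> mg.N \<in> center (J2 \<alpha>)"
      using mg.x_pow_N_center[of 1] by simp
    then show "H2_x \<alpha> [^]\<^bsub>H2 \<alpha>\<^esub> ((2::int) ^ (2 * m - 1)) = \<one>\<^bsub>H2 \<alpha>\<^esub>"
      using one by (simp add: xy mg.N_def flip: p.hom_int_pow)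
    obtain s where "J2_y \<alpha> [^]\<^bsub>J2 \<alpha>\<^esub> mg.N = J2_x \<alpha> [^]\<^bsub>J2 \<alpha>\<^esub> (mg.N * s)" by (rule mg.x_y_pow_N)
    then have "J2_y \<alpha> [^]\<^bsub>J2 \<alpha>\<^esub> mg.N \<in> center (J2 \<alpha>)" using mg.x_pow_N_center by simp
    then show "H2_y \<alpha> [^]\<^bsub>H2 \<alpha>\<^esub> ((2::int) ^ (2 * m - 1)) = \<one>\<^bsub>H2 \<alpha>\<^esub>"
      using one by (simp add: xy mg.N_def flip: p.hom_int_pow)
    show "2 ^ (2 * m - 1) dvd (1 - 2 ^ m * l) * (1 + 2 ^ m * l) - 1"
    proof -
      have "2 ^ (2 * m - 1) dvd (2 ^ m * l) * (2 ^ m * l)"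
        by (rule pow2_dvd_mult[of m _ m]) simp_all
      then show ?thesis by (simp add: algebra_simps)
    qed
  qed
  have z: "hp.z = ?p mg.z" unfolding hp.z_def by (rule z)
  show ?thesis
  proof unfold_locales
    obtain r where "mg.z [^]\<^bsub>J2 \<alpha>\<^esub> mg.N = J2_x \<alpha> [^]\<^bsub>J2 \<alpha>\<^esub> (mg.N * r)" by (rule mg.z_pow_N)
    then have "mg.z [^]\<^bsub>J2 \<alpha>\<^esub> mg.N \<in> center (J2 \<alpha>)" using mg.x_pow_N_center by simp
    then show "hp.z [^]\<^bsub>H2 \<alpha>\<^esub> ((2::int) ^ (2 * m - 1)) = \<one>\<^bsub>H2 \<alpha>\<^esub>"
      using one by (simp add: z mg.N_def flip: p.hom_int_pow)
  next
    fix h assume "h \<in> carrier (H2 \<alpha>)"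
    then obtain a where a: "a \<in> carrier (J2 \<alpha>)" "h = ?p a"
      unfolding H2_def Z.carrier_Mod by blast
    obtain i j k :: nat where "a = J2_x \<alpha> [^]\<^bsub>J2 \<alpha>\<^esub> i \<otimes>\<^bsub>J2 \<alpha>\<^esub> J2_y \<alpha> [^]\<^bsub>J2 \<alpha>\<^esub> j \<otimes>\<^bsub>J2 \<alpha>\<^esub> mg.z [^]\<^bsub>J2 \<alpha>\<^esub> k"
      using mg.normal_form[OF a(1)] .
    then have "h = H2_x \<alpha> [^]\<^bsub>H2 \<alpha>\<^esub> i \<otimes>\<^bsub>H2 \<alpha>\<^esub> H2_y \<alpha> [^]\<^bsub>H2 \<alpha>\<^esub> j \<otimes>\<^bsub>H2 \<alpha>\<^esub>
        hp.z [^]\<^bsub>H2 \<alpha>\<^esub> k"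
      unfolding z unfolding a(2) xy by (simp add: p.hom_nat_pow)
    then show "\<exists>(i::nat) (j::nat) (k::nat). h = H2_x \<alpha> [^]\<^bsub>H2 \<alpha>\<^esub> i \<otimes>\<^bsub>H2 \<alpha>\<^esub> H2_y \<alpha> [^]\<^bsub>H2 \<alpha>\<^esub> j \<otimes>\<^bsub>H2 \<alpha>\<^esub>
        hp.z [^]\<^bsub>H2 \<alpha>\<^esub> k"
      by blast
  next
    fix i j k :: int
    let ?w = "J2_x \<alpha> [^]\<^bsub>J2 \<alpha>\<^esub> i \<otimes>\<^bsub>J2 \<alpha>\<^esub> J2_y \<alpha> [^]\<^bsub>J2 \<alpha>\<^esub> j \<otimes>\<^bsub>J2 \<alpha>\<^esub> mg.z [^]\<^bsub>J2 \<alpha>\<^esub> k"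
    assume "H2_x \<alpha> [^]\<^bsub>H2 \<alpha>\<^esub> i \<otimes>\<^bsub>H2 \<alpha>\<^esub> H2_y \<alpha> [^]\<^bsub>H2 \<alpha>\<^esub> j \<otimes>\<^bsub>H2 \<alpha>\<^esub>
        hp.z [^]\<^bsub>H2 \<alpha>\<^esub> k = \<one>\<^bsub>H2 \<alpha>\<^esub>"
    then have "?p ?w = \<one>\<^bsub>H2 \<alpha>\<^esub>" unfolding z unfolding xy by (simp add: p.hom_int_pow)
    then obtain t :: int where t: "?w = J2_x \<alpha> [^]\<^bsub>J2 \<alpha>\<^esub> (2 ^ (2 * m - 1) * t)"
      using one center_J2 by auto
    \<comment> \<open>A word that dies in the quotient is a power of \<open>x^(2^(2m-1))\<close>.
      Absorbing that power into the exponent of \<open>x\<close> does not change it modulo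
      \<open>2^(2m-1)\<close>, so independence in \<open>J2\<close> applies.\<close>
    have "J2_x \<alpha> [^]\<^bsub>J2 \<alpha>\<^esub> (- (2 ^ (2 * m - 1) * t)) \<otimes>\<^bsub>J2 \<alpha>\<^esub> ?w = \<one>\<^bsub>J2 \<alpha>\<^esub>"
      unfolding t by (simp flip: J.int_pow_mult)
    then have "J2_x \<alpha> [^]\<^bsub>J2 \<alpha>\<^esub> (- (2 ^ (2 * m - 1) * t) + i) \<otimes>\<^bsub>J2 \<alpha>\<^esub> J2_y \<alpha> [^]\<^bsub>J2 \<alpha>\<^esub> j \<otimes>\<^bsub>J2 \<alpha>\<^esub> mg.z [^]\<^bsub>J2 \<alpha>\<^esub> k = \<one>\<^bsub>J2 \<alpha>\<^esub>"
      by (simp only: J.int_pow_mult mg.x) (simp add: J.m_assoc)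
    from J2_unique(1)[OF this[unfolded mg.z_def]]
    have "2 ^ (2 * m - 1) dvd - (2 ^ (2 * m - 1) * t) + i" "2 ^ (2 * m - 1) dvd j" "2 ^ (2 * m - 1) dvd k"
      by blast+
    moreover have "2 ^ (2 * m - 1) dvd - (2 ^ (2 * m - 1) * t) + i \<longleftrightarrow> 2 ^ (2 * m - 1) dvd i"
      by (rule dvd_add_right_iff) simp
    ultimately show "2 ^ (2 * m - 1) dvd i \<and> 2 ^ (2 * m - 1) dvd j \<and> 2 ^ (2 * m - 1) dvd k"
      by blast
  qed (use m l in auto)
qed

text \<open>The centre consists of the powers of \<open>x^(2^(2m-1))\<close>, so a homomorphism from
  \<open>J2\<close> factors through \<open>H2\<close> as soon as it kills this one element.\<close>

lemma H2_hom:
  assumes K: "group K" and u: "u \<in> carrier K" and v: "v \<in> carrier K"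
    and "conjugate K u (commutator K u v) = u [^]\<^bsub>K\<^esub> \<alpha>"
    and "conjugate K v (commutator K v u) = v [^]\<^bsub>K\<^esub> \<alpha>"
    and u_pow: "u [^]\<^bsub>K\<^esub> ((2::int) ^ (2 * m - 1)) = \<one>\<^bsub>K\<^esub>"
    and v_pow: "v [^]\<^bsub>K\<^esub> ((2::int) ^ (2 * m - 1)) = \<one>\<^bsub>K\<^esub>"
  obtains f where "f \<in> hom (H2 \<alpha>) K" "f (H2_x \<alpha>) = u" "f (H2_y \<alpha>) = v"
proof -
  interpret K: group K by fact
  have pow: "b [^]\<^bsub>K\<^esub> ((2::int) ^ (3 * m - 1)) = \<one>\<^bsub>K\<^esub>"
    if "b \<in> carrier K" "b [^]\<^bsub>K\<^esub> ((2::int) ^ (2 * m - 1)) = \<one>\<^bsub>K\<^esub>" for b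
    using K.int_pow_cong[OF that, of "2 ^ (3 * m - 1)" 0] by (simp add: le_imp_power_dvd)
  obtain h where h: "h \<in> hom (J2 \<alpha>) K" "h (J2_x \<alpha>) = u" "h (J2_y \<alpha>) = v"
    by (rule J2_hom[OF K u v assms(4,5)]) (use pow u v u_pow v_pow in \<open>simp_all add: level_alpha\<close>)
  interpret h: group_hom "J2 \<alpha>" K h
    using K h(1) by (simp add: group_hom_def group_hom_axioms_def J.is_group)
  have "h a = \<one>\<^bsub>K\<^esub>" if a: "a \<in> center (J2 \<alpha>)" for a
  proof -
    obtain i :: int where i: "a = J2_x \<alpha> [^]\<^bsub>J2 \<alpha>\<^esub> (2 ^ (2 * m - 1) * i)"
      using a unfolding center_J2 by blast
    have "h a = (u [^]\<^bsub>K\<^esub> ((2::int) ^ (2 * m - 1))) [^]\<^bsub>K\<^esub> i"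
      using J2_rel(1)[of \<alpha>] u by (simp add: i h.hom_int_pow h(2) K.int_pow_pow)
    then show ?thesis unfolding u_pow by simp
  qed
  then obtain f where "f \<in> hom (H2 \<alpha>) K" "\<And>a. a \<in> carrier (J2 \<alpha>) \<Longrightarrow> f (center (J2 \<alpha>) #>\<^bsub>J2 \<alpha>\<^esub> a) = h a"
    using Z.hom_Mod[OF K h(1)] unfolding H2_def by metis
  then show thesis
    using that J2_rel(1,2)[of \<alpha>] h by (simp add: H2_x_def H2_y_def)
qed

end

section \<open>Multiplication in $H_2(\alpha)$\<close>

context macdonald_quotient
begin

definition N :: int where "N = 2 ^ (2 * m - 1)"
definition q :: int where "q = 2 ^ m * l"

lemma q_dvd: "2 ^ m dvd q"
  by (simp add: q_def)

lemma qq: "N dvd q * q * i"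
  unfolding N_def using pow2_dvd_mult[OF q_dvd q_dvd, of "2 * m - 1"] by simp

text \<open>\<open>q\<close> gives \<open>m\<close> factors 2 and the triangular number of a
  multiple of \<open>2^m\<close> gives \<open>m - 1\<close>, together just those of
  \<open>N\<close>. So \<open>q * tri i\<close> depends only on \<open>i\<close> modulo
  \<open>2^m\<close>.\<close>

lemma qtri_cong: "2 ^ m dvd i - j \<Longrightarrow> N dvd q * tri i - q * tri j"
proof -
  assume d: "2 ^ m dvd i - j"
  have "q * tri i - q * tri j = q * tri (i - j) + q * (i - j) * j"
  proof -
    have t: "tri i = tri (i - j) + tri j + (i - j) * j" using tri_add[of "i - j" j] by simp
    show ?thesis unfolding t by (simp add: algebra_simps)
  qed
  moreover have "N dvd q * tri (i - j)"
    unfolding N_def by (rule pow2_dvd_mult[OF q_dvd dvd_tri[OF d]]) simp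
  moreover have "N dvd q * (i - j)"
    unfolding N_def by (rule pow2_dvd_mult[OF q_dvd d]) simp
  ultimately show ?thesis by simp
qed

lemma N_dvd: "2 ^ m dvd N"
  unfolding N_def using m by (intro le_imp_power_dvd) simp

lemma qtri_q: "N dvd q * tri (q * i)"
  using qtri_cong[of "q * i" 0] q_dvd by simp

lemma nat_cong: obtains n :: nat where "N dvd i - int n"
proof -
  have "N > 0" by (simp add: N_def)
  then have "int (nat (i mod N)) = i mod N" by simp
  then have "N dvd i - int (nat (i mod N))" by (simp add: mod_eq_dvd_iff[symmetric])
  then show thesis by (rule that)
qed

lemma x_cong: "N dvd i - j \<Longrightarrow> x [^] i = x [^] j"
  by (rule int_pow_cong[OF x pow_x]) (simp add: N_def)

lemma y_cong: "N dvd i - j \<Longrightarrow> y [^] i = y [^] j"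
  by (rule int_pow_cong[OF y pow_y]) (simp add: N_def)

lemma z_cong: "N dvd i - j \<Longrightarrow> z [^] i = z [^] j"
  by (rule int_pow_cong[OF z pow_z]) (simp add: N_def)

text \<open>\<open>(1 - q)^k\<close> is \<open>1 - k q\<close> modulo \<open>N\<close> because
  \<open>q^2\<close> vanishes; this makes the exponent linear in \<open>k\<close> and valid for
  negative \<open>k\<close>.\<close>

lemma z_pow_x_pow: "z [^] k \<otimes> x [^] i = x [^] (i * (1 - k * q)) \<otimes> z [^] (k::int)"
proof -
  obtain n where n: "N dvd k - int n" by (rule nat_cong)
  have "z [^] n \<otimes> x [^] i = x [^] (i * (1 - q) ^ n) \<otimes> z [^] n"
    by (rule swap_pow_left) (use zx in \<open>simp_all add: q_def\<close>)
  moreover have "x [^] (i * (1 - q) ^ n) = x [^] (i * (1 - k * q))"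
  proof (rule x_cong)
    have "N dvd (1 - q) ^ n - 1 + int n * q"
      using power_linear_cong[of "- q" n] qq[of 1] dvd_trans by fastforce
    moreover have "N dvd (k - int n) * q" using n by simp
    ultimately have "N dvd ((1 - q) ^ n - 1 + int n * q) + (k - int n) * q" by (rule dvd_add)
    then have "N dvd i * (((1 - q) ^ n - 1 + int n * q) + (k - int n) * q)" by (rule dvd_mult)
    then show "N dvd i * (1 - q) ^ n - i * (1 - k * q)" by (simp add: algebra_simps)
  qed
  moreover have "z [^] k = z [^] n" using z_cong[OF n] by (simp add: int_pow_int)
  ultimately show ?thesis by simp
qed

lemma z_pow_y_pow: "z [^] k \<otimes> y [^] i = y [^] (i * (1 + k * q)) \<otimes> z [^] (k::int)"
proof -
  obtain n where n: "N dvd k - int n" by (rule nat_cong)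
  have "z [^] n \<otimes> y [^] i = y [^] (i * (1 + q) ^ n) \<otimes> z [^] n"
    by (rule swap_pow_left) (use z_y in \<open>simp_all add: q_def\<close>)
  moreover have "y [^] (i * (1 + q) ^ n) = y [^] (i * (1 + k * q))"
  proof (rule y_cong)
    have "N dvd (1 + q) ^ n - 1 - int n * q"
      using power_linear_cong[of q n] qq[of 1] dvd_trans by fastforce
    moreover have "N dvd (k - int n) * q" using n by simp
    ultimately have "N dvd ((1 + q) ^ n - 1 - int n * q) - (k - int n) * q" by (rule dvd_diff)
    then have "N dvd i * (((1 + q) ^ n - 1 - int n * q) - (k - int n) * q)" by (rule dvd_mult)
    then show "N dvd i * (1 + q) ^ n - i * (1 + k * q)" by (simp add: algebra_simps)
  qed
  moreover have "z [^] k = z [^] n" using z_cong[OF n] by (simp add: int_pow_int)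
  ultimately show ?thesis by simp
qed

lemma geo_q: "N dvd j - int n \<Longrightarrow> N dvd geo (1 - q) n - (j - q * tri j)"
proof -
  assume n: "N dvd j - int n"
  have "N dvd geo (1 + - q) n - int n - (- q) * tri (int n)"
    unfolding N_def using geo_cong[OF m, of "- q" 0 n] q_dvd by simp
  from dvd_diff[OF dvd_add[OF this] n] have "N dvd q * tri j - q * tri (int n) \<Longrightarrow>
    N dvd (geo (1 + - q) n - int n - (- q) * tri (int n)) + (q * tri j - q * tri (int n)) - (j - int n)" .
  moreover have "N dvd q * tri j - q * tri (int n)"
    using n N_dvd dvd_trans by (intro qtri_cong) blast
  ultimately have "N dvd (geo (1 + - q) n - int n - (- q) * tri (int n)) + (q * tri j - q * tri (int n)) - (j - int n)"
    by blast
  then show ?thesis by (simp add: algebra_simps)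
qed

lemma x_int_pow_y: "x [^] (i::int) \<otimes> y = y \<otimes> x [^] (i - q * tri i) \<otimes> z [^] i"
proof -
  obtain n where n: "N dvd i - int n" by (rule nat_cong)
  have "x [^] n \<otimes> y = y \<otimes> x [^] geo (1 - q) n \<otimes> z [^] n"
    using x_pow_y[of n] by (simp add: q_def)
  moreover have "x [^] geo (1 - q) n = x [^] (i - q * tri i)" by (rule x_cong[OF geo_q[OF n]])
  ultimately show ?thesis
    using x_cong[OF n] z_cong[OF n] by (simp add: int_pow_int)
qed

lemma y_int_pow_x: "y [^] (j::int) \<otimes> x = x \<otimes> y [^] (j - q * tri j) \<otimes> z [^] (- j)"
proof -
  obtain n where n: "N dvd j - int n" by (rule nat_cong)
  have "y [^] n \<otimes> x = x \<otimes> y [^] geo (1 - q) n \<otimes> inv (z [^] n)"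
    using y_pow_x[of n] by (simp add: q_def)
  moreover have "y [^] geo (1 - q) n = y [^] (j - q * tri j)" by (rule y_cong[OF geo_q[OF n]])
  ultimately show ?thesis
    using y_cong[OF n] z_cong[OF n] by (simp add: int_pow_int int_pow_neg)
qed

lemma z_pow_q_x: "z [^] k \<otimes> x [^] (q * i) = x [^] (q * i) \<otimes> z [^] (k::int)"
proof -
  have "x [^] (q * i * (1 - k * q)) = x [^] (q * i)"
    by (rule x_cong) (use qq[of "- (i * k)"] in \<open>simp add: algebra_simps\<close>)
  then show ?thesis by (simp add: z_pow_x_pow)
qed

lemma z_pow_q_y: "z [^] (q * k) \<otimes> y = y \<otimes> z [^] (q * (k::int))"
proof -
  have "y [^] (1 * (1 + q * k * q)) = y [^] (1::int)"
    by (rule y_cong) (use qq[of k] in \<open>simp add: algebra_simps\<close>)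
  then show ?thesis using z_pow_y_pow[of "q * k" 1] by simp
qed

text \<open>The commutator of \<open>x^(q i)\<close> with \<open>y\<close> is
  \<open>z^(q i)\<close>, which commutes with both, so powers behave as in a group of class
  two.\<close>

lemma y_pow_x_pow_q: "y [^] (b::int) \<otimes> x [^] (q * i) = x [^] (q * i) \<otimes> y [^] b \<otimes> z [^] (- (b * q * i))"
proof -
  have "x [^] (q * i - q * tri (q * i)) = x [^] (q * i)"
    by (rule x_cong) (use qtri_q[of i] in simp)
  then have "(y \<otimes> z [^] (q * i)) \<otimes> x [^] (q * i) = x [^] (q * i) \<otimes> y"
    using x_int_pow_y[of "q * i"] z_pow_q_x[of "q * i" i] by (simp add: m_assoc)
  then have "(y \<otimes> z [^] (q * i)) [^] b \<otimes> x [^] (q * i) = x [^] (q * i) \<otimes> y [^] b"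
    by (intro swap_int_pow) simp_all
  moreover have "(y \<otimes> z [^] (q * i)) [^] b = y [^] b \<otimes> z [^] (q * i * b)"
    using int_pow_mult_distrib[of y "z [^] (q * i)" b] z_pow_q_y[of i] by (simp add: int_pow_pow)
  ultimately have "x [^] (q * i) \<otimes> y [^] b \<otimes> z [^] (- (q * i * b))
      = y [^] b \<otimes> (z [^] (q * i * b) \<otimes> x [^] (q * i)) \<otimes> z [^] (- (q * i * b))"
    by (simp add: m_assoc)
  also have "\<dots> = y [^] b \<otimes> x [^] (q * i)"
    unfolding z_pow_q_x by (simp add: m_assoc flip: int_pow_mult)
  finally show ?thesis by (simp add: mult_ac)
qed

definition E :: "int \<Rightarrow> int \<Rightarrow> int \<Rightarrow> 'a" where
  "E i j k = x [^] i \<otimes> y [^] j \<otimes> z [^] k"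

lemma E_closed [simp]: "E i j k \<in> carrier G"
  by (simp add: E_def)

lemma E_cong: "N dvd i - i' \<Longrightarrow> N dvd j - j' \<Longrightarrow> N dvd k - k' \<Longrightarrow> E i j k = E i' j' k'"
  unfolding E_def using x_cong y_cong z_cong by simp

text \<open>Collection of one \<open>x\<close> at a time; each step creates only terms linear in
  \<open>q\<close>, everything else being 0 modulo \<open>N\<close>.\<close>

lemma y_pow_x_nat_pow: "y [^] j \<otimes> x [^] int i =
  E (int i + j * q * tri (int i)) (j - int i * q * tri j) (- (int i * j) + q * tri (int i) * tri j - q * j\<^sup>2 * tri (int i))"
proof (induction i)
  case (Suc i)
  let ?i = "int i" and ?T = "tri j"
  define A B C where "A = ?i + j * q * tri ?i" and B: "B = j - ?i * q * ?T"
    and C: "C = - (?i * j) + q * tri ?i * ?T - q * j\<^sup>2 * tri ?i"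
  define B' where "B' = B - q * tri B"
  \<comment> \<open>\<open>C\<close> equals \<open>-n\<close> up to multiples of \<open>q\<close>,
    so moving \<open>z^C\<close> past \<open>x\<close> contributes exactly
    \<open>x^(q n)\<close>.\<close>
  define n where "n = ?i * j"
  have IH: "y [^] j \<otimes> x [^] ?i = E A B C"
    using Suc by (simp add: A_def B C)
  have "y [^] j \<otimes> x [^] int (Suc i) = (y [^] j \<otimes> x [^] ?i) \<otimes> x"
    by (simp add: m_assoc int_pow_mult add.commute[of 1])
  also have "\<dots> = x [^] A \<otimes> y [^] B \<otimes> (z [^] C \<otimes> x [^] (1::int))"
    unfolding IH E_def by (simp add: m_assoc)
  also have "z [^] C \<otimes> x [^] (1::int) = x [^] (1 * (1 - C * q)) \<otimes> z [^] C"
    by (rule z_pow_x_pow)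
  also have "x [^] (1 * (1 - C * q)) = x [^] (1 + q * n)"
  proof (rule x_cong)
    have "1 * (1 - C * q) - (1 + q * n) = q * q * (j\<^sup>2 * tri ?i - tri ?i * ?T)"
      by (simp add: C n_def algebra_simps)
    then show "N dvd 1 * (1 - C * q) - (1 + q * n)" using qq by metis
  qed
  also have "x [^] (1 + q * n) = x \<otimes> x [^] (q * n)" by (simp add: int_pow_mult)
  also have "x [^] A \<otimes> y [^] B \<otimes> (x \<otimes> x [^] (q * n) \<otimes> z [^] C)
      = x [^] A \<otimes> (y [^] B \<otimes> x) \<otimes> x [^] (q * n) \<otimes> z [^] C" by (simp add: m_assoc)
  also have "y [^] B \<otimes> x = x \<otimes> y [^] B' \<otimes> z [^] (- B)"
    unfolding B'_def by (rule y_int_pow_x)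
  also have "x [^] A \<otimes> (x \<otimes> y [^] B' \<otimes> z [^] (- B)) \<otimes> x [^] (q * n) \<otimes> z [^] C
      = x [^] A \<otimes> x \<otimes> y [^] B' \<otimes> (z [^] (- B) \<otimes> x [^] (q * n)) \<otimes> z [^] C" by (simp add: m_assoc)
  also have "z [^] (- B) \<otimes> x [^] (q * n) = x [^] (q * n) \<otimes> z [^] (- B)"
    by (rule z_pow_q_x)
  also have "x [^] A \<otimes> x \<otimes> y [^] B' \<otimes> (x [^] (q * n) \<otimes> z [^] (- B)) \<otimes> z [^] C
      = x [^] A \<otimes> x \<otimes> (y [^] B' \<otimes> x [^] (q * n)) \<otimes> (z [^] (- B) \<otimes> z [^] C)" by (simp add: m_assoc)
  also have "y [^] B' \<otimes> x [^] (q * n) = x [^] (q * n) \<otimes> y [^] B' \<otimes> z [^] (- (B' * q * n))"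
    by (rule y_pow_x_pow_q)
  also have "x [^] A \<otimes> x \<otimes> (x [^] (q * n) \<otimes> y [^] B' \<otimes> z [^] (- (B' * q * n))) \<otimes> (z [^] (- B) \<otimes> z [^] C)
      = (x [^] A \<otimes> x [^] (1::int) \<otimes> x [^] (q * n)) \<otimes> y [^] B' \<otimes> (z [^] (- (B' * q * n)) \<otimes> z [^] (- B) \<otimes> z [^] C)"
    by (simp add: m_assoc)
  also have "\<dots> = E (A + 1 + q * n) B' (- (B' * q * n) + - B + C)"
    by (simp only: E_def int_pow_mult x z)
  also have "\<dots> = E (int (Suc i) + j * q * tri (int (Suc i))) (j - int (Suc i) * q * tri j)
      (- (int (Suc i) * j) + q * tri (int (Suc i)) * tri j - q * j\<^sup>2 * tri (int (Suc i)))"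
  proof -
    have tri: "tri (int (Suc i)) = tri ?i + ?i" using tri_add[of 1 ?i] by simp
    \<comment> \<open>The cost of replacing \<open>tri B\<close> by \<open>tri j\<close>; it
      vanishes because \<open>B\<close> and \<open>j\<close> differ by a multiple of
      \<open>q\<close>.\<close>
    define d where "d = q * tri B - q * ?T"
    have d: "N dvd d" unfolding d_def
    proof (rule qtri_cong)
      show "2 ^ m dvd B - j" using q_dvd by (simp add: B)
    qed
    have B'_eq: "B' = j - ?i * q * ?T - q * ?T - d" by (simp add: B'_def B d_def)
    show ?thesis
    proof (rule E_cong)
      show "N dvd (A + 1 + q * n) - (int (Suc i) + j * q * tri (int (Suc i)))"
        unfolding tri by (simp add: A_def n_def algebra_simps)
      have "B' - (j - int (Suc i) * q * tri j) = - d"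
        unfolding B'_eq by (simp add: algebra_simps)
      then show "N dvd B' - (j - int (Suc i) * q * tri j)" using d by simp
      have "- (B' * q * n) + - B + C - (- (int (Suc i) * j) + q * tri (int (Suc i)) * tri j - q * j\<^sup>2 * tri (int (Suc i)))
          = q * q * ((?i * ?T + ?T) * n) + d * (q * n)"
        unfolding tri B'_eq B C n_def by (simp add: algebra_simps power2_eq_square)
      then show "N dvd - (B' * q * n) + - B + C - (- (int (Suc i) * j) + q * tri (int (Suc i)) * tri j - q * j\<^sup>2 * tri (int (Suc i)))"
        using qq d by (metis dvd_add dvd_mult2)
    qed
  qed
  finally show ?case .
qed (simp add: E_def)

lemma qtri_cong_N: "N dvd i - j \<Longrightarrow> N dvd (q * tri i - q * tri j) * k"
  using qtri_cong[of i j] N_dvd dvd_trans by (meson dvd_mult2)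

lemma y_pow_x_pow: "y [^] j \<otimes> x [^] i =
  E (i + j * q * tri i) (j - i * q * tri j) (- (i * j) + q * tri i * tri j - q * j\<^sup>2 * tri i)"
proof -
  obtain n where n: "N dvd i - int n" by (rule nat_cong)
  have n': "N dvd (int n - i) * k" for k using n by (simp add: dvd_diff_commute)
  have t: "N dvd (q * tri (int n) - q * tri i) * k" for k
    using n by (intro qtri_cong_N) (simp add: dvd_diff_commute)
  have "y [^] j \<otimes> x [^] i = y [^] j \<otimes> x [^] int n" by (simp add: x_cong[OF n])
  also have "\<dots> = E (i + j * q * tri i) (j - i * q * tri j) (- (i * j) + q * tri i * tri j - q * j\<^sup>2 * tri i)"
    unfolding y_pow_x_nat_pow
  proof (rule E_cong)
    show "N dvd int n + j * q * tri (int n) - (i + j * q * tri i)"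
      using dvd_add[OF n'[of 1] t[of j]] by (simp add: algebra_simps)
    show "N dvd j - int n * q * tri j - (j - i * q * tri j)"
      using n'[of "- (q * tri j)"] by (simp add: algebra_simps)
    show "N dvd - (int n * j) + q * tri (int n) * tri j - q * j\<^sup>2 * tri (int n)
        - (- (i * j) + q * tri i * tri j - q * j\<^sup>2 * tri i)"
      using dvd_add[OF n'[of "- j"] t[of "tri j - j\<^sup>2"]] by (simp add: algebra_simps)
  qed
  finally show ?thesis .
qed

text \<open>\<open>z^k\<close> is moved past \<open>x^I\<close> and \<open>y^J\<close>, then
  \<open>y^j\<close> past the changed power of \<open>x\<close>. In the resulting exponents
  \<open>I * (1 - k * q)\<close> may be replaced by \<open>I\<close> wherever a factor
  \<open>q\<close> is already present.\<close>

theorem E_mult: "E i j k \<otimes> E I J K =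
  E (i + I - I * k * q + j * q * tri I)
    (j + J + J * k * q - q * I * tri j - q * I * j * J)
    (k + K - I * j + q * (I * j * k + tri I * tri j - j\<^sup>2 * tri I))"
proof -
  define I' where "I' = I * (1 - k * q)"
  define A B C where "A = I' + j * q * tri I'" and B: "B = j - I' * q * tri j"
    and C: "C = - (I' * j) + q * tri I' * tri j - q * j\<^sup>2 * tri I'"
  define J' where "J' = J * (1 + k * q)"
  have "E i j k \<otimes> E I J K = x [^] i \<otimes> y [^] j \<otimes> (z [^] k \<otimes> x [^] I) \<otimes> y [^] J \<otimes> z [^] K"
    by (simp add: E_def m_assoc)
  also have "z [^] k \<otimes> x [^] I = x [^] I' \<otimes> z [^] k" unfolding I'_def by (rule z_pow_x_pow)
  also have "x [^] i \<otimes> y [^] j \<otimes> (x [^] I' \<otimes> z [^] k) \<otimes> y [^] J \<otimes> z [^] K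
      = x [^] i \<otimes> (y [^] j \<otimes> x [^] I') \<otimes> (z [^] k \<otimes> y [^] J) \<otimes> z [^] K" by (simp add: m_assoc)
  also have "z [^] k \<otimes> y [^] J = y [^] J' \<otimes> z [^] k" unfolding J'_def by (rule z_pow_y_pow)
  also have "y [^] j \<otimes> x [^] I' = x [^] A \<otimes> y [^] B \<otimes> z [^] C"
    unfolding A_def B C E_def[symmetric] by (rule y_pow_x_pow)
  also have "x [^] i \<otimes> (x [^] A \<otimes> y [^] B \<otimes> z [^] C) \<otimes> (y [^] J' \<otimes> z [^] k) \<otimes> z [^] K
      = x [^] i \<otimes> x [^] A \<otimes> y [^] B \<otimes> (z [^] C \<otimes> y [^] J') \<otimes> (z [^] k \<otimes> z [^] K)" by (simp add: m_assoc)
  also have "z [^] C \<otimes> y [^] J' = y [^] (J' * (1 + C * q)) \<otimes> z [^] C" by (rule z_pow_y_pow)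
  also have "x [^] i \<otimes> x [^] A \<otimes> y [^] B \<otimes> (y [^] (J' * (1 + C * q)) \<otimes> z [^] C) \<otimes> (z [^] k \<otimes> z [^] K)
      = E (i + A) (B + J' * (1 + C * q)) (C + (k + K))"
    by (simp add: E_def int_pow_mult m_assoc)
  also have "\<dots> = E (i + I - I * k * q + j * q * tri I)
    (j + J + J * k * q - q * I * tri j - q * I * j * J)
    (k + K - I * j + q * (I * j * k + tri I * tri j - j\<^sup>2 * tri I))"
  proof -
    define d where "d = q * tri I' - q * tri I"
    have d: "N dvd d * t" for t
    proof -
      have "2 ^ m dvd I' - I" using q_dvd by (simp add: I'_def algebra_simps)
      then show ?thesis unfolding d_def by (intro dvd_mult2 qtri_cong)
    qed
    have qt: "q * tri I' = q * tri I + d" by (simp add: d_def)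
    have A_eq: "A = I' + (q * tri I') * j" and C_eq: "C = - (I' * j) + (q * tri I') * (tri j - j\<^sup>2)"
      by (simp_all add: A_def C algebra_simps)
    show ?thesis
    proof (rule E_cong)
      have "i + A - (i + I - I * k * q + j * q * tri I) = d * j"
        unfolding A_eq qt by (simp add: I'_def algebra_simps)
      then show "N dvd i + A - (i + I - I * k * q + j * q * tri I)" using d by simp
      have "C + (k + K) - (k + K - I * j + q * (I * j * k + tri I * tri j - j\<^sup>2 * tri I)) = d * (tri j - j\<^sup>2)"
        unfolding C_eq qt by (simp add: I'_def algebra_simps)
      then show "N dvd C + (k + K) - (k + K - I * j + q * (I * j * k + tri I * tri j - j\<^sup>2 * tri I))"
        using d by simp
      have "B + J' * (1 + C * q) - (j + J + J * k * q - q * I * tri j - q * I * j * J)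
          = q * q * (I * k * tri j - J * k * I * j + J' * (I * k * j) + J' * tri I * (tri j - j\<^sup>2))
            + d * (J' * q * (tri j - j\<^sup>2))"
        unfolding C_eq qt by (simp add: B I'_def J'_def algebra_simps)
      then show "N dvd B + J' * (1 + C * q) - (j + J + J * k * q - q * I * tri j - q * I * j * J)"
        using qq d by (metis dvd_add)
    qed
  qed
  finally show ?thesis .
qed

lemma E_one: "E 0 0 0 = \<one>"
  by (simp add: E_def)

lemma E_x: "E 1 0 0 = x" and E_y: "E 0 1 0 = y"
  by (simp_all add: E_def)

text \<open>Multiplying by inverses leaves \<open>z^(k-k')\<close> in front of a power of
  \<open>y\<close>. Moving it to the end disturbs the \<open>y\<close> exponent only by a multiple
  of \<open>k - k'\<close>, which \<open>unique\<close> shows to be 0 modulo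
  \<open>N\<close>.\<close>

lemma E_eqD:
  assumes "E i j k = E i' j' k'"
  shows "N dvd i - i' \<and> N dvd j - j' \<and> N dvd k - k'"
proof -
  have "x [^] (- i') \<otimes> E i j k \<otimes> z [^] (- k') \<otimes> y [^] (- j')
      = x [^] (- i') \<otimes> E i' j' k' \<otimes> z [^] (- k') \<otimes> y [^] (- j')" by (simp add: assms)
  also have "\<dots> = (x [^] (- i') \<otimes> x [^] i') \<otimes> (y [^] j' \<otimes> (z [^] k' \<otimes> z [^] (- k')) \<otimes> y [^] (- j'))"
    by (simp add: E_def m_assoc)
  also have "\<dots> = \<one>" by (simp flip: int_pow_mult)
  finally have "x [^] (- i') \<otimes> x [^] i \<otimes> y [^] j \<otimes> (z [^] k \<otimes> z [^] (- k') \<otimes> y [^] (- j')) = \<one>"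
    by (simp add: E_def m_assoc)
  also have "z [^] k \<otimes> z [^] (- k') = z [^] (k - k')" by (simp flip: int_pow_mult)
  also have "z [^] (k - k') \<otimes> y [^] (- j') = y [^] (- j' * (1 + (k - k') * q)) \<otimes> z [^] (k - k')"
    by (rule z_pow_y_pow)
  finally have "x [^] (- i' + i) \<otimes> y [^] (j + - j' * (1 + (k - k') * q)) \<otimes> z [^] (k - k') = \<one>"
    by (simp only: int_pow_mult x y) (simp add: m_assoc)
  from unique[OF this] have 1: "N dvd - i' + i" "N dvd j + - j' * (1 + (k - k') * q)" "N dvd k - k'"
    by (simp_all add: N_def)
  have "j - j' = (j + - j' * (1 + (k - k') * q)) + (k - k') * (j' * q)" by (simp add: algebra_simps)
  moreover have "N dvd (j + - j' * (1 + (k - k') * q)) + (k - k') * (j' * q)"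
    by (rule dvd_add[OF 1(2) dvd_mult2[OF 1(3)]])
  ultimately have "N dvd j - j'" by (simp only:)
  then show ?thesis using 1 by simp
qed

lemma E_eq_iff: "E i j k = E i' j' k' \<longleftrightarrow> N dvd i - i' \<and> N dvd j - j' \<and> N dvd k - k'"
  using E_eqD E_cong by blast

lemma E_exhaust:
  assumes "h \<in> carrier G"
  obtains i j k where "h = E i j k"
  using normal_form[OF assms] unfolding E_def by (metis int_pow_int)

end

section \<open>Commutators and powers in normal form\<close>

context macdonald_quotient
begin

lemma N_dvd_q: "2 ^ m dvd i \<Longrightarrow> N dvd q * i"
  unfolding N_def by (rule pow2_dvd_mult[OF q_dvd]) (assumption, arith)

text \<open>Commutators and \<open>2^m\<close>-th powers have this shape. For such a factor all
  \<open>q\<close> terms of \<open>E_mult\<close> vanish, and only the correction from moving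
  \<open>x\<close> past \<open>y^j\<close> survives.\<close>

lemma E_mult_right:
  "E i j k \<otimes> E (2 ^ m * r) (2 ^ m * s) K = E (i + 2 ^ m * r) (j + 2 ^ m * s) (k + K - 2 ^ m * r * j)"
proof -
  have 1: "N dvd q * (2 ^ m * t)" for t by (rule N_dvd_q) simp
  have 2: "N dvd q * tri (2 ^ m * r) * t" for t
    using qtri_cong[of "2 ^ m * r" 0] by simp
  show ?thesis
    unfolding E_mult E_eq_iff
    using dvd_add[OF 1[of "- (r * k)"] 2[of j]] dvd_add[OF 1[of "s * k"] 1[of "- (r * tri j + r * j * (2 ^ m * s))"]]
      dvd_add[OF 1[of "r * j * k"] 2[of "tri j - j\<^sup>2"]]
    by (simp add: algebra_simps)
qed

lemma E_mult_left:
  "E (2 ^ m * r) (2 ^ m * s) K \<otimes> E i j k =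
    E (i + 2 ^ m * r - i * K * q) (j + 2 ^ m * s + j * K * q) (k + K - 2 ^ m * s * i)"
proof -
  have 1: "N dvd q * (2 ^ m * t)" for t by (rule N_dvd_q) simp
  have 2: "N dvd q * tri (2 ^ m * s) * t" for t
    using qtri_cong[of "2 ^ m * s" 0] by simp
  show ?thesis
    unfolding E_mult E_eq_iff
    using 1[of "s * tri i"] dvd_add[OF 2[of "- i"] 1[of "- (i * s * j)"]]
      dvd_add[OF 1[of "i * s * K - s * (2 ^ m * s) * tri i"] 2[of "tri i"]]
    by (simp add: algebra_simps power2_eq_square)
qed

text \<open>Elements of this shape form an abelian subgroup with coordinatewise multiplication,
  since \<open>2^m * 2^m\<close> is 0 modulo \<open>N\<close>.\<close>

lemma E_mult_central: "E (2 ^ m * r) (2 ^ m * s) k \<otimes> E (2 ^ m * r') (2 ^ m * s') k' =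
    E (2 ^ m * (r + r')) (2 ^ m * (s + s')) (k + k')"
proof -
  have "N dvd 2 ^ m * (2 ^ m * t)" for t
    unfolding N_def by (rule pow2_dvd_mult[of m _ m]) simp_all
  then show ?thesis
    unfolding E_mult_right E_eq_iff by (simp add: algebra_simps)
qed

lemma E_pow_central: "E (2 ^ m * r) (2 ^ m * s) k [^] (n::int) = E (2 ^ m * (r * n)) (2 ^ m * (s * n)) (k * n)"
proof -
  have nat: "E (2 ^ m * r) (2 ^ m * s) k [^] n = E (2 ^ m * (r * int n)) (2 ^ m * (s * int n)) (k * int n)" for n :: nat
  proof (induction n)
    case (Suc n)
    have "E (2 ^ m * r) (2 ^ m * s) k [^] Suc n
        = E (2 ^ m * (r * int n + r)) (2 ^ m * (s * int n + s)) (k * int n + k)"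
      unfolding nat_pow_Suc Suc E_mult_central ..
    then show ?case by (simp add: algebra_simps)
  qed (simp add: E_one)
  have "E (2 ^ m * - r) (2 ^ m * - s) (- k) \<otimes> E (2 ^ m * r) (2 ^ m * s) k = \<one>" for r s k
    unfolding E_mult_central by (simp add: E_one)
  then have inv: "inv (E (2 ^ m * r) (2 ^ m * s) k) = E (2 ^ m * - r) (2 ^ m * - s) (- k)" for r s k
    by (intro inv_equality) simp_all
  show ?thesis
  proof (cases n rule: int_cases2)
    case (nonneg n)
    then show ?thesis by (simp add: nat int_pow_int)
  next
    case (nonpos n)
    then show ?thesis using inv[of "r * int n" "s * int n" "k * int n"]
      by (simp add: nat int_pow_int int_pow_neg)
  qed
qed

text \<open>The commutator is the solution \<open>c\<close> of \<open>v u c = u v\<close>. The two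
  products differ in their \<open>x\<close> and \<open>y\<close> exponents only by multiples of
  \<open>q\<close>, so \<open>c\<close> has the shape of \<open>E_mult_right\<close>, which solves
  the equation. The determinant in the \<open>z\<close> exponent is all that is needed of
  \<kappa>.\<close>

lemma commutator_E:
  defines "\<rho> \<equiv> \<lambda>a b e c d f. l * (a * f - c * e + b * tri c - d * tri a)"
    and "\<sigma> \<equiv> \<lambda>a b e c d f. l * (d * e - b * f + a * tri d - c * tri b + a * b * d - b * c * d)"
  shows "\<exists>\<kappa>. commutator G (E a b e) (E c d f) = E (2 ^ m * \<rho> a b e c d f) (2 ^ m * \<sigma> a b e c d f) \<kappa> \<and>
    2 ^ m dvd \<kappa> - (a * d - b * c)"
proof -
  let ?u = "E a b e" and ?v = "E c d f"
  define r where "r = \<rho> a b e c d f"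
  define s where "s = \<sigma> a b e c d f"
  define X1 X2 where "X1 = c * b * e + tri c * tri b - b\<^sup>2 * tri c" and "X2 = a * d * f + tri a * tri d - d\<^sup>2 * tri a"
  define j where "j = d + b + b * f * q - q * a * tri d - q * a * d * b"
  define \<kappa> where "\<kappa> = a * d - b * c + q * (X1 - X2) + 2 ^ m * r * j"
  have "?v \<otimes> ?u = E (c + a - a * f * q + d * q * tri a) j (f + e - a * d + q * X2)"
    by (simp add: E_mult j_def X2_def)
  then have "?v \<otimes> ?u \<otimes> E (2 ^ m * r) (2 ^ m * s) \<kappa> =
      E (c + a - a * f * q + d * q * tri a + 2 ^ m * r) (j + 2 ^ m * s) (f + e - a * d + q * X2 + \<kappa> - 2 ^ m * r * j)"
    by (simp only: E_mult_right)
  also have "\<dots> = ?u \<otimes> ?v"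
    unfolding E_mult
    by (rule arg_cong3[where f = E])
      (simp_all add: \<kappa>_def X1_def j_def r_def s_def \<rho>_def \<sigma>_def q_def algebra_simps)
  finally have eq: "?v \<otimes> ?u \<otimes> E (2 ^ m * r) (2 ^ m * s) \<kappa> = ?u \<otimes> ?v" .
  have "commutator G ?u ?v = inv ?u \<otimes> inv ?v \<otimes> (?u \<otimes> ?v)"
    by (simp add: commutator_def m_assoc)
  also have "\<dots> = inv ?u \<otimes> (inv ?v \<otimes> ?v) \<otimes> ?u \<otimes> E (2 ^ m * r) (2 ^ m * s) \<kappa>"
    unfolding eq[symmetric] by (simp only: m_assoc E_closed inv_closed m_closed)
  also have "\<dots> = E (2 ^ m * r) (2 ^ m * s) \<kappa>" by simp
  finally have "commutator G ?u ?v = E (2 ^ m * r) (2 ^ m * s) \<kappa>" .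
  moreover have "2 ^ m dvd \<kappa> - (a * d - b * c)"
    using q_dvd by (simp add: \<kappa>_def)
  ultimately show ?thesis unfolding r_def s_def by blast
qed

text \<open>Squaring doubles the error terms and adds only terms divisible by \<open>q\<close>, so repeated squaring needs
  no closed formula for general powers.  The last, sharper congruence serves the construction of
  an isomorphism.\<close>

lemma E_pow2:
  "\<exists>A B k. E a b e [^] ((2::nat) ^ s) = E A B k \<and>
    2 ^ (m + s - 1) dvd A - 2 ^ s * a \<and> 2 ^ (m + s - 1) dvd B - 2 ^ s * b \<and> (s = 0 \<longrightarrow> A = a \<and> B = b) \<and>
    2 ^ (m + s - 2) dvd k - (2 ^ s * e - a * b * tri (2 ^ s)) \<and>
    (m \<ge> 3 \<and> 2 ^ (m - 2) dvd a \<longrightarrow> 2 ^ (m + s - 1) dvd k - (2 ^ s * e - a * b * tri (2 ^ s)))"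
proof (induction s)
  case 0
  show ?case by (rule exI[of _ a], rule exI[of _ b], rule exI[of _ e]) simp
next
  case (Suc s)
  then obtain A B k where eq: "E a b e [^] ((2::nat) ^ s) = E A B k"
    and A: "2 ^ (m + s - 1) dvd A - 2 ^ s * a" and B: "2 ^ (m + s - 1) dvd B - 2 ^ s * b"
    and zero: "s = 0 \<Longrightarrow> A = a \<and> B = b"
    and k: "2 ^ (m + s - 2) dvd k - (2 ^ s * e - a * b * tri (2 ^ s))"
    and k': "m \<ge> 3 \<Longrightarrow> 2 ^ (m - 2) dvd a \<Longrightarrow> 2 ^ (m + s - 1) dvd k - (2 ^ s * e - a * b * tri (2 ^ s))"
    by blast
  define A' where "A' = 2 * A - A * k * q + B * q * tri A"
  define B' where "B' = 2 * B + B * k * q - q * A * tri B - q * A * B * B"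
  define k2 where "k2 = 2 * k - A * B + q * (A * B * k + tri A * tri B - B\<^sup>2 * tri A)"
  have As: "2 ^ s dvd A"
  proof -
    have "2 ^ s dvd A - 2 ^ s * a" by (rule pow2_dvd_weaken[OF A]) (use m in simp)
    then show ?thesis by (metis dvd_diffD1 dvd_triv_left dvd_add diff_add_cancel)
  qed
  have Bs: "2 ^ s dvd B"
  proof -
    have "2 ^ s dvd B - 2 ^ s * b" by (rule pow2_dvd_weaken[OF B]) (use m in simp)
    then show ?thesis by (metis dvd_diffD1 dvd_triv_left dvd_add diff_add_cancel)
  qed
  have "E a b e [^] ((2::nat) ^ Suc s) = E a b e [^] ((2::nat) ^ s) \<otimes> E a b e [^] ((2::nat) ^ s)"
    by (simp add: nat_pow_mult mult_2)
  also have "\<dots> = E A' B' k2"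
    unfolding eq E_mult A'_def B'_def k2_def by (rule arg_cong3[where f = E]) (simp_all add: algebra_simps)
  finally have 1: "E a b e [^] ((2::nat) ^ Suc s) = E A' B' k2" .
  have qs: "2 ^ (m + s) dvd q * (A * t)" "2 ^ (m + s) dvd q * (B * t)" for t
    by (rule pow2_dvd_mult[OF q_dvd dvd_mult2[OF As]] pow2_dvd_mult[OF q_dvd dvd_mult2[OF Bs]], simp)+
  have dbl: "2 ^ (m + s) dvd 2 * t" if "2 ^ (m + s - 1) dvd t" for t :: int
  proof -
    have "m + s = Suc (m + s - 1)" using m by simp
    then show ?thesis using mult_dvd_mono[OF dvd_refl[of 2] that] by (metis power_Suc)
  qed
  have 2: "2 ^ (m + s) dvd A' - 2 ^ Suc s * a"
    using dvd_add[OF dbl[OF A] dvd_diff[OF qs(2)[of "tri A"] qs(1)[of k]]]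
    by (simp add: A'_def algebra_simps)
  have 3: "2 ^ (m + s) dvd B' - 2 ^ Suc s * b"
    using dvd_add[OF dbl[OF B] dvd_diff[OF qs(2)[of k] qs(1)[of "tri B + B * B"]]]
    by (simp add: B'_def algebra_simps)
  have tri2: "tri (2 ^ Suc s) = 2 * tri (2 ^ s) + 2 ^ s * 2 ^ s"
    using tri_add[of "2 ^ s" "2 ^ s"] by simp
  have k2_eq: "k2 - (2 ^ Suc s * e - a * b * tri (2 ^ Suc s)) =
      2 * (k - (2 ^ s * e - a * b * tri (2 ^ s))) - A * (B - 2 ^ s * b) - 2 ^ s * (b * (A - 2 ^ s * a))
      + q * (A * (B * k)) + q * (tri A * tri B) - q * (B * (B * tri A))"
    unfolding k2_def tri2 by (simp add: algebra_simps power2_eq_square)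
  have 4: "2 ^ (m + s - 1) dvd k2 - (2 ^ Suc s * e - a * b * tri (2 ^ Suc s))"
    unfolding k2_eq
  proof (intro dvd_add dvd_diff)
    have "m + s - 1 = Suc (m + s - 2)" using m by simp
    then show "2 ^ (m + s - 1) dvd 2 * (k - (2 ^ s * e - a * b * tri (2 ^ s)))"
      using mult_dvd_mono[OF dvd_refl[of 2] k] by (metis power_Suc)
    show "2 ^ (m + s - 1) dvd A * (B - 2 ^ s * b)" using B by (rule dvd_mult)
    show "2 ^ (m + s - 1) dvd 2 ^ s * (b * (A - 2 ^ s * a))" using A by (intro dvd_mult)
    show "2 ^ (m + s - 1) dvd q * (A * (B * k))" "2 ^ (m + s - 1) dvd q * (B * (B * tri A))"
      using qs(1)[of "B * k"] qs(2)[of "B * tri A"] by (auto elim: pow2_dvd_weaken)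
    have "2 ^ ((s - 1) + (s - 1)) dvd tri A * tri B"
      by (rule pow2_dvd_mult[OF dvd_tri[OF As] dvd_tri[OF Bs]]) simp
    then show "2 ^ (m + s - 1) dvd q * (tri A * tri B)"
      by (rule pow2_dvd_mult[OF q_dvd]) simp
  qed
  have 5: "2 ^ (m + s) dvd k2 - (2 ^ Suc s * e - a * b * tri (2 ^ Suc s))"
    if m3: "m \<ge> 3" and a: "2 ^ (m - 2) dvd a"
    unfolding k2_eq
  proof (intro dvd_add dvd_diff)
    \<comment> \<open>The divisibility of \<open>a\<close> passes to \<open>A\<close> and supplies
      the factors 2 missing in \<open>A (B - 2^s b)\<close> and in
      \<open>tri A * tri B\<close>.\<close>
    have A2: "2 ^ (m + s - 2) dvd A"
    proof -
      have "2 ^ (m + s - 2) dvd 2 ^ s * a"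
        by (rule pow2_dvd_mult[of s _ "m - 2"]) (use a m in auto)
      moreover have "2 ^ (m + s - 2) dvd A - 2 ^ s * a"
        by (rule pow2_dvd_weaken[OF A]) simp
      ultimately show ?thesis by (metis dvd_add diff_add_cancel)
    qed
    show "2 ^ (m + s) dvd 2 * (k - (2 ^ s * e - a * b * tri (2 ^ s)))"
      by (rule dbl[OF k'[OF m3 a]])
    show "2 ^ (m + s) dvd A * (B - 2 ^ s * b)"
      by (rule pow2_dvd_mult[OF A2 B]) (use m3 in simp)
    show "2 ^ (m + s) dvd 2 ^ s * (b * (A - 2 ^ s * a))"
    \<comment> \<open>For \<open>s = 0\<close> the factor \<open>2^s\<close> brings nothing and the
      estimate would be short by one factor 2; there \<open>A = a\<close> exactly, which is why the
      induction carries that clause.\<close>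
    proof (cases "s = 0")
      case False
      have "2 ^ (m + s - 1) dvd b * (A - 2 ^ s * a)" using A by (rule dvd_mult)
      then show ?thesis by (rule pow2_dvd_mult[of s, rotated]) (use False in auto)
    qed (use zero in simp)
    show "2 ^ (m + s) dvd q * (A * (B * k))" "2 ^ (m + s) dvd q * (B * (B * tri A))"
      by (rule qs)+
    have "2 ^ (m + s - 2 - 1) dvd tri A * tri B"
      using dvd_tri[OF A2] by simp
    then show "2 ^ (m + s) dvd q * (tri A * tri B)"
      by (rule pow2_dvd_mult[OF q_dvd]) (use m3 in simp)
  qed
  show ?case
    by (rule exI[of _ A'], rule exI[of _ B'], rule exI[of _ k2]) (use 1 2 3 4 5 in simp)
qed

lemma tri_pow2: "tri (2 ^ m) = 2 ^ (m - 1) * (2 ^ m - 1)"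
proof (rule triI)
  have "(2::int) ^ m = 2 * 2 ^ (m - 1)" using m by (simp flip: power_Suc)
  then show "2 * (2 ^ (m - 1) * (2 ^ m - 1)) = (2::int) ^ m * (2 ^ m - 1)" by simp
qed

text \<open>At \<open>s = m\<close> the error modulus \<open>2^(m+s-1)\<close> is exactly
  \<open>N\<close>, so the first two exponents are exact.\<close>

lemma E_pow_2m:
  obtains k where "E a b e [^] ((2::int) ^ m) = E (2 ^ m * a) (2 ^ m * b) k"
    "2 ^ (2 * m - 2) dvd k - (2 ^ m * e - a * b * tri (2 ^ m))"
    "m \<ge> 3 \<Longrightarrow> 2 ^ (m - 2) dvd a \<Longrightarrow> N dvd k - (2 ^ m * e - a * b * tri (2 ^ m))"
proof -
  obtain A B k where "E a b e [^] ((2::nat) ^ m) = E A B k"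
    "2 ^ (m + m - 1) dvd A - 2 ^ m * a" "2 ^ (m + m - 1) dvd B - 2 ^ m * b"
    "2 ^ (m + m - 2) dvd k - (2 ^ m * e - a * b * tri (2 ^ m))"
    "m \<ge> 3 \<and> 2 ^ (m - 2) dvd a \<longrightarrow> 2 ^ (m + m - 1) dvd k - (2 ^ m * e - a * b * tri (2 ^ m))"
    using E_pow2[of a b e m] by blast
  moreover have "m + m = 2 * m" by simp
  moreover have "E a b e [^] ((2::int) ^ m) = E a b e [^] ((2::nat) ^ m)"
    by (metis int_pow_int of_nat_numeral of_nat_power)
  moreover have "E A B k = E (2 ^ m * a) (2 ^ m * b) k"
    using calculation by (intro E_cong) (simp_all add: N_def)
  ultimately show thesis using that[of k] by (simp add: N_def)
qed

text \<open>The congruences are the three coordinates of the relation. The first two have opposite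
  signs because \<open>z\<close> acts on \<open>x\<close> and on \<open>y\<close> by mutually
  inverse powers.\<close>

lemma relation_u_iff:
  assumes u_pow: "E a b e [^] ((2::int) ^ m) = E (2 ^ m * a) (2 ^ m * b) k"
    and w: "w = E (2 ^ m * r) (2 ^ m * s) \<kappa>"
  shows "E a b e \<otimes> w = w \<otimes> E a b e [^] (1 + 2 ^ m * l') \<longleftrightarrow>
    N dvd 2 ^ m * (a * (\<kappa> * l - l')) \<and> N dvd 2 ^ m * (b * (\<kappa> * l + l')) \<and>
    N dvd 2 ^ m * (a * s - r * b + a * b * l') - k * l'"
proof -
  have "E a b e [^] (1 + 2 ^ m * l') = E a b e \<otimes> (E a b e [^] ((2::int) ^ m)) [^] l'"
    by (simp add: int_pow_mult int_pow_pow)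
  also have "\<dots> = E a b e \<otimes> E (2 ^ m * (a * l')) (2 ^ m * (b * l')) (k * l')"
    unfolding u_pow E_pow_central ..
  finally have "w \<otimes> E a b e [^] (1 + 2 ^ m * l') =
      (w \<otimes> E a b e) \<otimes> E (2 ^ m * (a * l')) (2 ^ m * (b * l')) (k * l')"
    by (simp add: w m_assoc)
  also have "\<dots> = E (a + 2 ^ m * r - a * \<kappa> * q + 2 ^ m * (a * l')) (b + 2 ^ m * s + b * \<kappa> * q + 2 ^ m * (b * l'))
      (e + \<kappa> - 2 ^ m * s * a + k * l' - 2 ^ m * (a * l') * (b + 2 ^ m * s + b * \<kappa> * q))"
    unfolding w E_mult_left E_mult_right ..
  finally have fin: "w \<otimes> E a b e [^] (1 + 2 ^ m * l') = \<dots>" .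
  have 1: "E a b e \<otimes> w = w \<otimes> E a b e [^] (1 + 2 ^ m * l') \<longleftrightarrow>
      N dvd a + 2 ^ m * r - (a + 2 ^ m * r - a * \<kappa> * q + 2 ^ m * (a * l')) \<and>
      N dvd b + 2 ^ m * s - (b + 2 ^ m * s + b * \<kappa> * q + 2 ^ m * (b * l')) \<and>
      N dvd e + \<kappa> - 2 ^ m * r * b - (e + \<kappa> - 2 ^ m * s * a + k * l' - 2 ^ m * (a * l') * (b + 2 ^ m * s + b * \<kappa> * q))"
    unfolding fin unfolding w E_mult_right E_eq_iff ..
  have "a + 2 ^ m * r - (a + 2 ^ m * r - a * \<kappa> * q + 2 ^ m * (a * l')) = 2 ^ m * (a * (\<kappa> * l - l'))"
    by (simp add: q_def algebra_simps)
  moreover have "b + 2 ^ m * s - (b + 2 ^ m * s + b * \<kappa> * q + 2 ^ m * (b * l')) = - (2 ^ m * (b * (\<kappa> * l + l')))"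
    by (simp add: q_def algebra_simps)
  moreover have "e + \<kappa> - 2 ^ m * r * b - (e + \<kappa> - 2 ^ m * s * a + k * l' - 2 ^ m * (a * l') * (b + 2 ^ m * s + b * \<kappa> * q))
      = 2 ^ m * (a * s - r * b + a * b * l') - k * l' + 2 ^ m * (2 ^ m * (a * l' * (s + b * \<kappa> * l)))"
    by (simp add: q_def algebra_simps)
  moreover have "N dvd 2 ^ m * (2 ^ m * (a * l' * (s + b * \<kappa> * l)))"
    using pow2_dvd_mult[of m "2 ^ m" m "2 ^ m * (a * l' * (s + b * \<kappa> * l))" "2 * m - 1"] by (simp add: N_def)
  ultimately show ?thesis
    unfolding 1 by (simp only: dvd_minus_iff dvd_add_left_iff)
qed

lemma relation_v_iff:
  assumes v_pow: "E c d f [^] ((2::int) ^ m) = E (2 ^ m * c) (2 ^ m * d) k"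
    and w: "w = E (2 ^ m * r) (2 ^ m * s) \<kappa>"
  shows "w \<otimes> E c d f = E c d f [^] (1 + 2 ^ m * l') \<otimes> w \<longleftrightarrow>
    N dvd 2 ^ m * (c * (\<kappa> * l + l')) \<and> N dvd 2 ^ m * (d * (\<kappa> * l - l')) \<and>
    N dvd 2 ^ m * (r * d - c * s + c * d * l') - k * l'"
proof -
  have "E c d f [^] (1 + 2 ^ m * l') = E c d f \<otimes> (E c d f [^] ((2::int) ^ m)) [^] l'"
    by (simp add: int_pow_mult int_pow_pow)
  also have "\<dots> = E c d f \<otimes> E (2 ^ m * (c * l')) (2 ^ m * (d * l')) (k * l')"
    unfolding v_pow E_pow_central ..
  finally have "E c d f [^] (1 + 2 ^ m * l') \<otimes> w =
      E c d f \<otimes> (E (2 ^ m * (c * l')) (2 ^ m * (d * l')) (k * l') \<otimes> w)"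
    by (simp add: w m_assoc)
  also have "\<dots> = E (c + 2 ^ m * (c * l' + r)) (d + 2 ^ m * (d * l' + s)) (f + (k * l' + \<kappa>) - 2 ^ m * (c * l' + r) * d)"
    unfolding w E_mult_central unfolding E_mult_right ..
  finally have fin: "E c d f [^] (1 + 2 ^ m * l') \<otimes> w = \<dots>" .
  have 1: "w \<otimes> E c d f = E c d f [^] (1 + 2 ^ m * l') \<otimes> w \<longleftrightarrow>
      N dvd c + 2 ^ m * r - c * \<kappa> * q - (c + 2 ^ m * (c * l' + r)) \<and>
      N dvd d + 2 ^ m * s + d * \<kappa> * q - (d + 2 ^ m * (d * l' + s)) \<and>
      N dvd f + \<kappa> - 2 ^ m * s * c - (f + (k * l' + \<kappa>) - 2 ^ m * (c * l' + r) * d)"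
    unfolding fin unfolding w E_mult_left E_eq_iff ..
  have "c + 2 ^ m * r - c * \<kappa> * q - (c + 2 ^ m * (c * l' + r)) = - (2 ^ m * (c * (\<kappa> * l + l')))"
    by (simp add: q_def algebra_simps)
  moreover have "d + 2 ^ m * s + d * \<kappa> * q - (d + 2 ^ m * (d * l' + s)) = 2 ^ m * (d * (\<kappa> * l - l'))"
    by (simp add: q_def algebra_simps)
  moreover have "f + \<kappa> - 2 ^ m * s * c - (f + (k * l' + \<kappa>) - 2 ^ m * (c * l' + r) * d)
      = 2 ^ m * (r * d - c * s + c * d * l') - k * l'"
    by (simp add: algebra_simps)
  ultimately show ?thesis
    unfolding 1 by (simp only: dvd_minus_iff)
qed

end

section \<open>The isomorphism problem\<close>

lemma dvd_diffE:
  fixes i j d :: int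
  assumes "d dvd i - j"
  obtains t where "i = j + d * t"
proof -
  obtain t where "i - j = d * t" using assms by blast
  then have "i = j + d * t" by simp
  then show thesis by (rule that)
qed

lemma dvd_add_multD: "(d::int) dvd i + d * j \<Longrightarrow> d dvd i"
  by (simp add: dvd_add_left_iff)

lemma odd_dvd_cancel: "odd (a::int) \<Longrightarrow> 2 ^ k dvd a * i \<Longrightarrow> 2 ^ k dvd i"
  by (simp add: coprime_dvd_mult_right_iff)

text \<open>The arithmetic core, free of groups. The exponents \<open>e\<close> and \<open>f\<close>
  are unrestricted, and the point is that they drop out of the \<open>z\<close> coordinates.\<close>

lemma twisted_pair_numeric:
  fixes a b c d e f k k' \<kappa> r s l l' :: int
  assumes m: "m \<ge> 4" and l: "odd l" and l': "odd l'" and a: "odd a" and det: "odd (a * d - b * c)"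
    and \<kappa>: "2 ^ m dvd \<kappa> - (a * d - b * c)"
    and r: "r = l * (a * f - c * e + b * tri c - d * tri a)"
    and s: "s = l * (d * e - b * f + a * tri d - c * tri b + a * b * d - b * c * d)"
    and k: "2 ^ (2 * m - 2) dvd k - (2 ^ m * e - a * b * (2 ^ (m - 1) * (2 ^ m - 1)))"
    and k': "2 ^ (2 * m - 2) dvd k' - (2 ^ m * f - c * d * (2 ^ (m - 1) * (2 ^ m - 1)))"
    and u1: "2 ^ (2 * m - 1) dvd 2 ^ m * (a * (\<kappa> * l - l'))"
    and u2: "2 ^ (2 * m - 1) dvd 2 ^ m * (b * (\<kappa> * l + l'))"
    and u3: "2 ^ (2 * m - 1) dvd 2 ^ m * (a * s - r * b + a * b * l') - k * l'"
    and v1: "2 ^ (2 * m - 1) dvd 2 ^ m * (c * (\<kappa> * l + l'))"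
    and v3: "2 ^ (2 * m - 1) dvd 2 ^ m * (r * d - c * s + c * d * l') - k' * l'"
  shows "2 ^ (m - 2) dvd l' - l"
proof -
  \<comment> \<open>With \<open>M = 2^(m-3)\<close> the target modulus is \<open>2 M\<close>, while
    \<open>M\<close> is what remains for the triangular numbers.\<close>
  define n where "n = m - 3"
  have n: "m = n + 3" "n \<ge> 1" using m by (simp_all add: n_def)
  define M :: int where "M = 2 ^ n"
  have M_even: "even M" and M0: "M > 0" using n(2) by (simp_all add: M_def)
  have pw: "2 ^ m = 8 * M" "2 ^ (m - 1) = 4 * M" "2 ^ (m - 2) = 2 * M"
    by (simp_all add: n(1) M_def power_add)
  have e: "2 * m - 1 = n + n + 5" "2 * m - 2 = n + n + 4" using n by simp_all
  have pw2: "2 ^ (2 * m - 1) = 8 * M * (4 * M)" "2 ^ (2 * m - 2) = 8 * M * (2 * M)"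
    unfolding e M_def power_add by simp_all
  have cancel: "8 * M * i dvd 8 * M * j \<longleftrightarrow> i dvd j" for i j
    using M0 by simp
  have odd_dvd4: "4 * M dvd i" if "odd t" "4 * M dvd t * i" for t i
    using odd_dvd_cancel[of t "n + 2" i] that by (simp add: M_def power_add)
  have odd_dvd1: "M dvd i" if "odd t" "M dvd t * i" for t i
    using odd_dvd_cancel[of t n i] that by (simp add: M_def)
  have odd_dvd2: "2 * M dvd i" if "odd t" "2 * M dvd t * i" for t i
    using odd_dvd_cancel[of t "n + 1" i] that by (simp add: M_def power_add)
  have "4 * M dvd a * (\<kappa> * l - l')" using u1 unfolding pw pw2 cancel .
  then have "4 * M dvd \<kappa> * l - l'" by (rule odd_dvd4[OF a])
  then obtain t1 where t1: "\<kappa> * l = l' + 4 * M * t1" by (rule dvd_diffE)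
  \<comment> \<open>Modulo \<open>4 M\<close> the factor \<open>\<kappa> l + l'\<close> is
    \<open>2 l'\<close> with \<open>l'\<close> odd; the 2 costs one factor, hence
    \<open>2 M\<close>.\<close>
  have even_part: "2 * M dvd t" if "8 * M * (4 * M) dvd 8 * M * (t * (\<kappa> * l + l'))" for t
  proof -
    have "4 * M dvd t * (\<kappa> * l + l')" using that unfolding cancel .
    then have "4 * M dvd t * (\<kappa> * l + l') - 4 * M * (t1 * t)" by (intro dvd_diff) auto
    moreover have "t * (\<kappa> * l + l') - 4 * M * (t1 * t) = 2 * (l' * t)"
      unfolding t1 by (simp add: algebra_simps)
    ultimately have "2 * (2 * M) dvd 2 * (l' * t)" by simp
    then have "2 * M dvd l' * t" by (simp only: dvd_mult_cancel_left) simp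
    then show ?thesis by (rule odd_dvd2[OF l'])
  qed
  obtain b' where b': "b = 2 * M * b'" using even_part[of b] u2 unfolding pw pw2 by blast
  obtain c' where c': "c = 2 * M * c'" using even_part[of c] v1 unfolding pw pw2 by blast
  have d: "odd d" using det by (simp add: b')
  obtain t2 where t2: "\<kappa> = a * d - b * c + 8 * M * t2"
    using \<kappa> unfolding pw by (rule dvd_diffE)
  have l'_eq: "l' = a * d * l + M * (8 * t2 * l - 4 * t1 - 4 * M * b' * c' * l)"
    using t1 unfolding t2 b' c' by (simp add: algebra_simps)
  have es: "M dvd a * s - l' * e"
  proof -
    obtain t where t: "k = 8 * M * e - a * b * (4 * M * (8 * M - 1)) + 8 * M * (2 * M) * t"
      using k unfolding pw pw2 by (rule dvd_diffE)
    have eq: "8 * M * (a * s - r * b + a * b * l') - k * l' =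
        8 * M * ((a * s - l' * e) + M * (- 2 * r * b' + 2 * a * b' * l' + a * b' * (8 * M - 1) * l' - 2 * t * l'))"
      unfolding t b' by (simp add: algebra_simps)
    have "8 * M * (4 * M) dvd 8 * M * ((a * s - l' * e) + M * (- 2 * r * b' + 2 * a * b' * l' + a * b' * (8 * M - 1) * l' - 2 * t * l'))"
      using u3 unfolding pw pw2 eq .
    then have "4 * M dvd (a * s - l' * e) + M * (- 2 * r * b' + 2 * a * b' * l' + a * b' * (8 * M - 1) * l' - 2 * t * l')"
      unfolding cancel .
    then have "M dvd (a * s - l' * e) + M * (- 2 * r * b' + 2 * a * b' * l' + a * b' * (8 * M - 1) * l' - 2 * t * l')"
      by (rule dvd_mult_right)
    then show ?thesis by (rule dvd_add_multD)
  qed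
  \<comment> \<open>Modulo \<open>M\<close>, \<open>a s\<close> is
    \<open>a l (d e + a tri d)\<close>, and \<open>l'\<close> is \<open>a d l\<close>. So the terms
    with \<open>e\<close> cancel and a unit times \<open>tri d\<close> remains.\<close>
  have es_eq: "a * s - l' * e = l * a * a * tri d + M * (l * a * (- 2 * b' * f - 2 * c' * tri b + 2 * a * b' * d - 2 * b' * c * d)
      - e * (8 * t2 * l - 4 * t1 - 4 * M * b' * c' * l))"
    unfolding s by (subst l'_eq) (simp add: b' c' algebra_simps)
  have "M dvd (l * a * a) * tri d"
    using es unfolding es_eq by (rule dvd_add_multD)
  then have "M dvd tri d" by (rule odd_dvd1[rotated]) (use l a in simp)
  \<comment> \<open>Doubling the triangular number regains the factor 2 lost before, so the
    conclusion on \<open>d\<close> holds modulo \<open>2 M\<close>.\<close>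
  then have "2 * M dvd d * (d - 1)" unfolding two_tri[symmetric] by simp
  then have d1: "2 * M dvd d - 1" by (rule odd_dvd2[OF d])
  have er: "M dvd r * d - l' * f"
  proof -
    obtain t where t: "k' = 8 * M * f - c * d * (4 * M * (8 * M - 1)) + 8 * M * (2 * M) * t"
      using k' unfolding pw pw2 by (rule dvd_diffE)
    have eq: "8 * M * (r * d - c * s + c * d * l') - k' * l' =
        8 * M * ((r * d - l' * f) + M * (- 2 * s * c' + 2 * c' * d * l' + c' * d * (8 * M - 1) * l' - 2 * t * l'))"
      unfolding t c' by (simp add: algebra_simps)
    have "8 * M * (4 * M) dvd 8 * M * ((r * d - l' * f) + M * (- 2 * s * c' + 2 * c' * d * l' + c' * d * (8 * M - 1) * l' - 2 * t * l'))"
      using v3 unfolding pw pw2 eq .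
    then have "4 * M dvd (r * d - l' * f) + M * (- 2 * s * c' + 2 * c' * d * l' + c' * d * (8 * M - 1) * l' - 2 * t * l')"
      unfolding cancel .
    then have "M dvd (r * d - l' * f) + M * (- 2 * s * c' + 2 * c' * d * l' + c' * d * (8 * M - 1) * l' - 2 * t * l')"
      by (rule dvd_mult_right)
    then show ?thesis by (rule dvd_add_multD)
  qed
  have er_eq: "r * d - l' * f = (- (l * d * d)) * tri a + M * (l * d * (- 2 * c' * e + 2 * b' * tri c)
      - f * (8 * t2 * l - 4 * t1 - 4 * M * b' * c' * l))"
    unfolding r by (subst l'_eq) (simp add: b' c' algebra_simps)
  have "M dvd (- (l * d * d)) * tri a"
    using er unfolding er_eq by (rule dvd_add_multD)
  then have "M dvd tri a" by (rule odd_dvd1[rotated]) (use l d in simp)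
  then have "2 * M dvd a * (a - 1)" unfolding two_tri[symmetric] by simp
  then have a1: "2 * M dvd a - 1" by (rule odd_dvd2[OF a])
  have "l' - l = (a - 1) * (d * l) + (d - 1) * l + 2 * M * (4 * t2 * l - 2 * t1 - 2 * M * b' * c' * l)"
    by (subst l'_eq) (simp add: algebra_simps)
  then show ?thesis unfolding pw using a1 d1 by (metis dvd_add dvd_mult2 dvd_triv_left)
qed

context macdonald_quotient
begin

lemma macdonald_pair_cong_aux:
  assumes mp: "macdonald_pair G (E a b e) (E c d f) (1 + 2 ^ m * l') g' M"
    and m4: "m \<ge> 4" and l': "odd l'" and a: "odd a" and det: "odd (a * d - b * c)"
  shows "2 ^ (m - 2) dvd l' - l"
proof -
  interpret p: macdonald_pair G "E a b e" "E c d f" "1 + 2 ^ m * l'" g' M by (rule mp)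
  define r where "r = l * (a * f - c * e + b * tri c - d * tri a)"
  define s where "s = l * (d * e - b * f + a * tri d - c * tri b + a * b * d - b * c * d)"
  obtain \<kappa> where w: "p.z = E (2 ^ m * r) (2 ^ m * s) \<kappa>" and \<kappa>: "2 ^ m dvd \<kappa> - (a * d - b * c)"
    unfolding p.z_def r_def s_def using commutator_E[of a b e c d f] by blast
  obtain k where u: "E a b e [^] ((2::int) ^ m) = E (2 ^ m * a) (2 ^ m * b) k"
    and k: "2 ^ (2 * m - 2) dvd k - (2 ^ m * e - a * b * tri (2 ^ m))"
    by (rule E_pow_2m)
  obtain k' where v: "E c d f [^] ((2::int) ^ m) = E (2 ^ m * c) (2 ^ m * d) k'"
    and k': "2 ^ (2 * m - 2) dvd k' - (2 ^ m * f - c * d * tri (2 ^ m))"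
    by (rule E_pow_2m)
  have "E a b e \<otimes> p.z = p.z \<otimes> E a b e [^] (1 + 2 ^ m * l')" by (rule p.x_z)
  then have u': "N dvd 2 ^ m * (a * (\<kappa> * l - l'))" "N dvd 2 ^ m * (b * (\<kappa> * l + l'))"
      "N dvd 2 ^ m * (a * s - r * b + a * b * l') - k * l'"
    unfolding relation_u_iff[OF u w] by auto
  have "p.z \<otimes> E c d f = E c d f [^] (1 + 2 ^ m * l') \<otimes> p.z" by (rule p.z_y)
  then have v': "N dvd 2 ^ m * (c * (\<kappa> * l + l'))" "N dvd 2 ^ m * (r * d - c * s + c * d * l') - k' * l'"
    unfolding relation_v_iff[OF v w] by auto
  show ?thesis
    by (rule twisted_pair_numeric[OF m4 l l' a det \<kappa> r_def s_def k[unfolded tri_pow2] k'[unfolded tri_pow2]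
          u'[unfolded N_def] v'[unfolded N_def]])
qed

text \<open>As \<open>q\<close> is even, the exponents of \<open>x\<close> and \<open>y\<close>
  modulo 2 simply add: they are the coordinates of the quotient map onto the Klein
  four-group.\<close>

lemma E_nat_pow_parity:
  "\<exists>A B k. E a b e [^] (n::nat) = E A B k \<and> even (A - int n * a) \<and> even (B - int n * b)"
proof (induction n)
  case 0
  show ?case by (rule exI[of _ 0], rule exI[of _ 0], rule exI[of _ 0]) (simp add: E_one)
next
  case (Suc n)
  then obtain A B k where IH: "E a b e [^] n = E A B k" "even (A - int n * a)" "even (B - int n * b)" by blast
  have "even q" using m by (simp add: q_def)
  then show ?case
    unfolding nat_pow_Suc IH(1) E_mult using IH(2,3)
    by (intro exI conjI) (rule refl, auto)
qed

theorem macdonald_pair_cong: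
  assumes mp: "macdonald_pair G u v (1 + 2 ^ m * l') g' M"
    and m3: "m \<ge> 3" and l': "odd l'"
    and gen: "\<And>h. h \<in> carrier G \<Longrightarrow> \<exists>(i::nat) (j::nat) (k::nat). h = u [^] i \<otimes> v [^] j \<otimes> commutator G u v [^] k"
  shows "2 ^ (m - 2) dvd l' - l"
proof (cases "m = 3")
  case True
  \<comment> \<open>For \<open>m = 3\<close> the claim is modulo 2 and holds for any two odd
    numbers.\<close>
  then show ?thesis using l l' by simp
next
  case False
  with m3 have m4: "m \<ge> 4" by simp
  interpret p: macdonald_pair G u v "1 + 2 ^ m * l'" g' M by (rule mp)
  obtain a b e where u: "u = E a b e" using E_exhaust[OF p.x] by blast
  obtain c d f where v: "v = E c d f" using E_exhaust[OF p.y] by blast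
  have q_even: "even q" and N_even: "even N" using m by (simp_all add: q_def N_def)
  \<comment> \<open>Since \<open>u\<close> and \<open>v\<close> generate, the exponents of every
    element are modulo 2 a combination of \<open>(a, b)\<close> and \<open>(c, d)\<close>;
    commutators contribute nothing. Applied to \<open>x\<close> and \<open>y\<close> this makes the
    determinant odd.\<close>
  have coords: "\<exists>i j :: nat. even (A - (int i * a + int j * c)) \<and> even (B - (int i * b + int j * d))"
    if h: "h = E A B K" for h A B K
  proof -
    have "h \<in> carrier G" by (simp add: h)
    then obtain i j k :: nat where ijk: "h = u [^] i \<otimes> v [^] j \<otimes> commutator G u v [^] k"
      using gen by blast
    obtain A1 B1 K1 where 1: "u [^] i = E A1 B1 K1" "even (A1 - int i * a)" "even (B1 - int i * b)"
      unfolding u using E_nat_pow_parity by blast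
    obtain A2 B2 K2 where 2: "v [^] j = E A2 B2 K2" "even (A2 - int j * c)" "even (B2 - int j * d)"
      unfolding v using E_nat_pow_parity by blast
    obtain r s \<kappa> where w: "commutator G u v = E (2 ^ m * r) (2 ^ m * s) \<kappa>"
      unfolding u v using commutator_E by blast
    obtain A3 B3 K3 where 3: "commutator G u v [^] k = E A3 B3 K3" "even (A3 - int k * (2 ^ m * r))"
        "even (B3 - int k * (2 ^ m * s))"
      unfolding w using E_nat_pow_parity by blast
    have ev: "even A3" "even B3" using 3 m by simp_all
    obtain A4 B4 K4 where 4: "h = E A4 B4 K4" "even (A4 - (A1 + A2 + A3))" "even (B4 - (B1 + B2 + B3))"
    proof -
      have "h = E A1 B1 K1 \<otimes> E A2 B2 K2 \<otimes> E A3 B3 K3" by (simp add: ijk 1(1) 2(1) 3(1))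
      then show thesis unfolding E_mult by (rule that) (use q_even in auto)
    qed
    have "N dvd A - A4 \<and> N dvd B - B4" using 4(1) h E_eqD by metis
    then have "even (A - A4)" "even (B - B4)" using dvd_trans[OF N_even] by blast+
    then have "even (A - (int i * a + int j * c))" "even (B - (int i * b + int j * d))"
      using 1(2,3) 2(2,3) ev 4(2,3) by (simp_all add: even_add even_diff)
    then show ?thesis by blast
  qed
  obtain i j i' j' :: nat where "even (1 - (int i * a + int j * c))" "even (0 - (int i * b + int j * d))"
      "even (0 - (int i' * a + int j' * c))" "even (1 - (int i' * b + int j' * d))"
    using coords[OF E_x[symmetric]] coords[OF E_y[symmetric]] by blast
  then have det: "odd (a * d - b * c)" by auto
  then consider "odd a" | "odd c" by auto
  then show ?thesis
  proof cases
    case 1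
    show ?thesis by (rule macdonald_pair_cong_aux[OF mp[unfolded u v] m4 l' 1 det])
  next
    case 2
    \<comment> \<open>The defining relations are symmetric in the two generators, so an odd
      \<open>c\<close> reduces to the case of an odd \<open>a\<close>.\<close>
    have "macdonald_pair G v u (1 + 2 ^ m * l') g' M"
      by unfold_locales (use p.conj_x p.conj_y p.pow_x p.pow_y p.g in simp_all)
    moreover have "odd (c * b - d * a)" using det by (simp add: mult.commute)
    ultimately show ?thesis
      unfolding u v by (intro macdonald_pair_cong_aux[OF _ m4 l' 2])
  qed
qed

text \<open>If \<open>l\<close> and \<open>l'\<close> agree modulo \<open>2^(m-1)\<close>, the two
  exponents agree modulo \<open>N\<close> and the pair \<open>x\<close>, \<open>y\<close> serves for
  both. Otherwise the difference is an odd multiple of \<open>2^(m-2)\<close>, and the generators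
  must be twisted.\<close>

lemma twisted_pair_exists:
  assumes l': "odd l'" and cong: "2 ^ (m - 2) dvd l' - l"
  obtains u v where "u \<in> carrier G" "v \<in> carrier G"
    "conjugate G u (commutator G u v) = u [^] (1 + 2 ^ m * l')"
    "conjugate G v (commutator G v u) = v [^] (1 + 2 ^ m * l')"
    "u [^] N = \<one>" "v [^] N = \<one>"
    "\<And>H. subgroup H G \<Longrightarrow> u \<in> H \<Longrightarrow> v \<in> H \<Longrightarrow> x \<in> H \<and> y \<in> H"
proof (cases "2 ^ (m - 1) dvd l' - l")
  case True
  have "N dvd (1 + 2 ^ m * l) - (1 + 2 ^ m * l')"
  proof -
    have "2 ^ (m - 1) dvd l - l'" using True by (simp add: dvd_diff_commute)
    then have "N dvd 2 ^ m * (l - l')"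
      unfolding N_def by (rule pow2_dvd_mult[of m "2 ^ m", OF dvd_refl]) simp
    then show ?thesis by (simp add: algebra_simps)
  qed
  then show thesis
    using that[of x y] conj_x conj_y pow_x pow_y x_cong y_cong by (simp add: N_def)
next
  case False
  \<comment> \<open>For \<open>m = 2\<close> two odd numbers already agree modulo
    \<open>2^(m-1)\<close>, so the first case applies.\<close>
  have m3: "m \<ge> 3"
  proof (rule ccontr)
    assume "\<not> m \<ge> 3"
    then have "m = 2" using m by simp
    then show False using False l l' by simp
  qed
  define c :: int where "c = 2 ^ (m - 2)"
  define h :: int where "h = 2 ^ (m - 3)"
  have ch: "c = 2 * h" and mh: "2 ^ m = 8 * h" "2 ^ (m - 1) = 4 * h"
  proof -
    obtain n where "m = n + 3" using m3 by (metis add.commute le_Suc_ex)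
    then show "c = 2 * h" "2 ^ m = 8 * h" "2 ^ (m - 1) = 4 * h"
      by (simp_all add: c_def h_def power_add)
  qed
  have N_h: "N = 8 * h * (4 * h)"
  proof -
    have "N = 2 ^ m * 2 ^ (m - 1)"
      unfolding N_def power_add[symmetric] by (rule arg_cong[where f = "(^) 2"]) (use m in simp)
    then show ?thesis unfolding mh .
  qed
  have c_even: "even c" using m3 by (simp add: c_def)
  obtain t where t: "l' - l = c * t" using cong unfolding c_def by blast
  have "odd t"
  proof
    assume "even t"
    then obtain t' where "t = 2 * t'" by blast
    then have "l' - l = 4 * h * t'" using t by (simp add: ch)
    then show False using False mh by simp
  qed
  \<comment> \<open>Multiplying \<open>l\<close> by \<open>1 + c\<close> adds \<open>c l\<close>,
    which is \<open>c t\<close> modulo \<open>2 c\<close> because \<open>l\<close> and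
    \<open>t\<close> are both odd. So \<open>a l\<close> hits \<open>l'\<close> modulo
    \<open>2^(m-1)\<close>.\<close>
  define a where "a = 1 + c"
  have a_odd: "odd a" using c_even by (simp add: a_def)
  have al: "4 * h dvd a * l - l'"
  proof -
    have "a * l - l' = c * (l - t)" using t by (simp add: a_def algebra_simps)
    moreover have "even (l - t)" using l \<open>odd t\<close> by simp
    then obtain t' where "l - t = 2 * t'" by blast
    ultimately have "a * l - l' = 4 * h * t'" by (simp add: ch)
    then show ?thesis by simp
  qed
  let ?u = "E a 0 0" and ?v = "E c 1 0"
  define r where "r = - (l * tri a)"
  obtain \<kappa> where w: "commutator G ?u ?v = E (2 ^ m * r) (2 ^ m * 0) \<kappa>" and \<kappa>: "8 * h dvd \<kappa> - a"
    using commutator_E[of a 0 0 c 1 0] by (auto simp: r_def mh)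
  define w where "w = commutator G ?u ?v"
  have w': "w = E (2 ^ m * r) (2 ^ m * 0) \<kappa>" by (simp add: w_def w)
  have wc [simp]: "w \<in> carrier G" by (simp add: w_def)
  have \<kappa>l: "4 * h dvd \<kappa> * l - l'"
  proof -
    have "4 * h dvd \<kappa> - a" using \<kappa> by (auto elim: dvd_trans[rotated])
    then have "4 * h dvd (\<kappa> - a) * l + (a * l - l')" using al by (intro dvd_add dvd_mult2)
    then show ?thesis by (simp add: algebra_simps)
  qed
  obtain k where u: "?u [^] ((2::int) ^ m) = E (2 ^ m * a) (2 ^ m * 0) k" and k: "N dvd k"
  proof -
    have "?u [^] ((2::int) ^ m) = E (2 ^ m * a) (2 ^ m * 0) 0"
      by (simp add: E_def int_pow_pow mult.commute)
    then show thesis using that by simp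
  qed
  \<comment> \<open>Here \<open>2^(m-2)\<close> divides the \<open>x\<close> exponent, so
    \<open>E_pow_2m\<close> gives its congruence modulo the full \<open>N\<close>.\<close>
  obtain k' where v: "?v [^] ((2::int) ^ m) = E (2 ^ m * c) (2 ^ m * 1) k'"
    and k': "N dvd k' - (2 ^ m * 0 - c * 1 * tri (2 ^ m))"
    by (rule E_pow_2m[of c 1 0]) (use m3 in \<open>auto simp: c_def\<close>)
  have "N dvd k' - - (c * (4 * h * (8 * h - 1)))" using k' unfolding tri_pow2 unfolding mh by simp
  then obtain t' where t': "k' = - (c * (4 * h * (8 * h - 1))) + N * t'" by (rule dvd_diffE)
  have tri_a: "tri a = a * h"
    by (rule triI) (simp add: a_def ch)
  have relu: "?u \<otimes> w = w \<otimes> ?u [^] (1 + 2 ^ m * l')"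
    unfolding relation_u_iff[OF u w']
  proof (intro conjI)
    show "N dvd 2 ^ m * (a * (\<kappa> * l - l'))"
      unfolding N_h mh by (intro mult_dvd_mono dvd_refl dvd_mult \<kappa>l)
  qed (use k in simp_all)
  have relv: "w \<otimes> ?v = ?v [^] (1 + 2 ^ m * l') \<otimes> w"
    unfolding relation_v_iff[OF v w']
  proof (intro conjI)
    have "even (\<kappa> * l + l')"
    proof -
      have "even (\<kappa> * l - l')" by (rule dvd_trans[OF _ \<kappa>l]) simp
      then show ?thesis by simp
    qed
    then have "2 * h * 2 dvd c * (\<kappa> * l + l')" unfolding ch by (intro mult_dvd_mono) auto
    then have "4 * h dvd c * (\<kappa> * l + l')" by (simp add: mult.commute)
    then show "N dvd 2 ^ m * (c * (\<kappa> * l + l'))"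
      unfolding N_h mh by (rule mult_dvd_mono[OF dvd_refl])
    show "N dvd 2 ^ m * (1 * (\<kappa> * l - l'))"
      unfolding N_h mh using \<kappa>l by (intro mult_dvd_mono[OF dvd_refl]) simp
    obtain t2 where t2: "a * l = l' + 4 * h * t2" using al by (rule dvd_diffE)
    \<comment> \<open>With \<open>v = y\<close> the odd multiple \<open>- 8 h h a l\<close> coming
      from \<open>tri a\<close> would survive modulo \<open>N = 32 h h\<close>. The factor
      \<open>x^c\<close> in \<open>v\<close> contributes \<open>8 h h l'\<close>, and
      \<open>l' - a l\<close> is divisible by \<open>4 h\<close>.\<close>
    have "2 ^ m * (r * 1 - c * 0 + c * 1 * l') - k' * l'
        = 8 * h * h * (l' - a * l) + N * (2 * h * l') - N * (t' * l')"
      unfolding t' mh r_def tri_a N_h by (simp add: ch algebra_simps)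
    also have "\<dots> = N * (- h * t2 + 2 * h * l' - t' * l')"
      unfolding t2 N_h by (simp add: algebra_simps)
    finally show "N dvd 2 ^ m * (r * 1 - c * 0 + c * 1 * l') - k' * l'" by simp
  qed
  have inv_w: "commutator G ?v ?u = inv w"
    by (simp add: w_def commutator_def inv_mult_group m_assoc)
  show thesis
  proof (rule that[of ?u ?v])
    show "conjugate G ?u (commutator G ?u ?v) = ?u [^] (1 + 2 ^ m * l')"
      using relu unfolding w_def[symmetric] conjugate_def by (simp add: m_assoc) (simp add: m_assoc[symmetric])
    show "conjugate G ?v (commutator G ?v ?u) = ?v [^] (1 + 2 ^ m * l')"
      using relv unfolding inv_w conjugate_def by (simp add: m_assoc)
    have pw: "b [^] N = (b [^] ((2::int) ^ m)) [^] (4 * h)" if "b \<in> carrier G" for b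
      using that by (simp add: int_pow_pow N_h mh)
    have cN: "N dvd 2 ^ m * (i * (4 * h))" for i
      unfolding N_h mh by simp
    show "?u [^] N = \<one>"
      unfolding pw[OF E_closed] u E_pow_central E_one[symmetric] E_eq_iff using cN[of a] k by simp
    show "?v [^] N = \<one>"
    proof -
      have "k' * (4 * h) = N * (t' * (4 * h) - h * (8 * h - 1))"
        unfolding t' N_h by (simp add: ch algebra_simps)
      then have "N dvd k' * (4 * h)" by simp
      then show ?thesis
        unfolding pw[OF E_closed] v E_pow_central E_one[symmetric] E_eq_iff using cN[of c] cN[of 1] by simp
    qed
    fix H assume H: "subgroup H G" "?u \<in> H" "?v \<in> H"
    \<comment> \<open>\<open>a\<close> is odd, so a power of \<open>u\<close> is \<open>x\<close>;
      removing \<open>x^c\<close> from \<open>v\<close> then recovers \<open>y\<close>.\<close>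
    obtain i where i: "2 ^ (2 * m - 1) dvd a * i - 1" by (rule odd_inverse_mod_pow2[OF a_odd])
    have "?u [^] i = x [^] (1::int)"
      using x_cong[of "a * i" 1] i by (simp add: E_def int_pow_pow N_def)
    moreover have "?u [^] i \<in> H" using subgroup_int_pow_closed[OF H(1,2)] .
    ultimately have xH: "x \<in> H" by simp
    then have "x [^] (- c) \<otimes> ?v \<in> H"
      using subgroup_int_pow_closed[OF H(1)] H(3) subgroup.m_closed[OF H(1)] by blast
    moreover have "x [^] (- c) \<otimes> ?v = (x [^] (- c) \<otimes> x [^] c) \<otimes> y" by (simp add: E_def m_assoc)
    then have "x [^] (- c) \<otimes> ?v = y" by (simp flip: int_pow_mult)
    ultimately show "x \<in> H \<and> y \<in> H" using xH by simp
  qed simp_all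
qed

lemma finite_carrier: "finite (carrier G)"
proof -
  have "carrier G \<subseteq> (\<lambda>(i, j, k). E i j k) ` ({0..<N} \<times> {0..<N} \<times> {0..<N})"
  proof
    fix h assume "h \<in> carrier G"
    then obtain i j k where "h = E i j k" using E_exhaust by blast
    also have "\<dots> = E (i mod N) (j mod N) (k mod N)"
      unfolding E_eq_iff by (simp add: mod_eq_dvd_iff[symmetric])
    finally show "h \<in> (\<lambda>(i, j, k). E i j k) ` ({0..<N} \<times> {0..<N} \<times> {0..<N})"
      by (intro image_eqI[of _ _ "(i mod N, j mod N, k mod N)"]) (simp_all add: N_def)
  qed
  then show ?thesis by (rule finite_subset) simp
qed

end

section \<open>Isomorphisms and the number of isomorphism classes\<close>

lemma H2_surj:
  assumes m: "m \<ge> 2" and l: "odd l" and l': "odd l'" and cong: "2 ^ (m - 2) dvd l' - l"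
  shows "\<exists>f \<in> hom (H2 (1 + 2 ^ m * l')) (H2 (1 + 2 ^ m * l)).
    f ` carrier (H2 (1 + 2 ^ m * l')) = carrier (H2 (1 + 2 ^ m * l))"
proof -
  let ?a = "1 + 2 ^ m * l" and ?a' = "1 + 2 ^ m * l'"
  interpret Q: macdonald_quotient "H2 ?a" "H2_x ?a" "H2_y ?a" m l
    by (rule H2_macdonald_quotient[OF m l refl])
  obtain u v where uv: "u \<in> carrier (H2 ?a)" "v \<in> carrier (H2 ?a)"
    "conjugate (H2 ?a) u (commutator (H2 ?a) u v) = u [^]\<^bsub>H2 ?a\<^esub> ?a'"
    "conjugate (H2 ?a) v (commutator (H2 ?a) v u) = v [^]\<^bsub>H2 ?a\<^esub> ?a'"
    "u [^]\<^bsub>H2 ?a\<^esub> Q.N = \<one>\<^bsub>H2 ?a\<^esub>" "v [^]\<^bsub>H2 ?a\<^esub> Q.N = \<one>\<^bsub>H2 ?a\<^esub>"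
    and gen: "\<And>H. subgroup H (H2 ?a) \<Longrightarrow> u \<in> H \<Longrightarrow> v \<in> H \<Longrightarrow> H2_x ?a \<in> H \<and> H2_y ?a \<in> H"
    by (rule Q.twisted_pair_exists[OF l' cong]) blast
  obtain f where f: "f \<in> hom (H2 ?a') (H2 ?a)" "f (H2_x ?a') = u" "f (H2_y ?a') = v"
    by (rule H2_hom[OF m l' refl group_H2 uv(1-4) uv(5,6)[unfolded Q.N_def]])
  interpret f: group_hom "H2 ?a'" "H2 ?a" f
    using f(1) group_H2 by (simp add: group_hom_def group_hom_axioms_def)
  interpret Q': macdonald_quotient "H2 ?a'" "H2_x ?a'" "H2_y ?a'" m l'
    by (rule H2_macdonald_quotient[OF m l' refl])
  have sub: "subgroup (f ` carrier (H2 ?a')) (H2 ?a)" by (rule f.img_is_subgroup)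
  have "H2_x ?a \<in> f ` carrier (H2 ?a') \<and> H2_y ?a \<in> f ` carrier (H2 ?a')"
    using gen[OF sub] f(2,3) Q'.x Q'.y by blast
  then have "h \<in> f ` carrier (H2 ?a')" if "h \<in> carrier (H2 ?a)" for h
    using Q.normal_form[OF that] subgroup.m_closed[OF sub] Q.subgroup_int_pow_closed[OF sub]
      subgroup.m_inv_closed[OF sub]
    unfolding Q.z_def commutator_def by (metis int_pow_int)
  then have "f ` carrier (H2 ?a') = carrier (H2 ?a)" using f.hom_closed by blast
  then show ?thesis using f(1) by blast
qed

lemma finite_H2: "m \<ge> 2 \<Longrightarrow> odd l \<Longrightarrow> finite (carrier (H2 (1 + 2 ^ m * l)))"
  using macdonald_quotient.finite_carrier[OF H2_macdonald_quotient] by blast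

text \<open>The congruence is symmetric, so there are surjections both ways between finite groups.
  The orders are therefore equal and either surjection is bijective.\<close>

lemma H2_iso_if:
  assumes m: "m \<ge> 2" and l: "odd l" and l': "odd l'" and cong: "2 ^ (m - 2) dvd l' - l"
  shows "H2 (1 + 2 ^ m * l') \<cong> H2 (1 + 2 ^ m * l)"
proof -
  let ?G = "H2 (1 + 2 ^ m * l)" and ?G' = "H2 (1 + 2 ^ m * l')"
  obtain f where f: "f \<in> hom ?G' ?G" "f ` carrier ?G' = carrier ?G"
    using H2_surj[OF m l l' cong] by blast
  obtain f' where f': "f' \<in> hom ?G ?G'" "f' ` carrier ?G = carrier ?G'"
    using H2_surj[OF m l' l] cong by (metis dvd_diff_commute)
  have "card (carrier ?G) = card (carrier ?G')"
    using card_image_le[OF finite_H2[OF m l'], of f] card_image_le[OF finite_H2[OF m l], of f'] f(2) f'(2)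
    by simp
  then have "inj_on f (carrier ?G')"
    using f(2) by (intro eq_card_imp_inj_on finite_H2[OF m l']) simp
  then have "f \<in> iso ?G' ?G" using f by (simp add: iso_def bij_betw_def)
  then show ?thesis unfolding is_iso_def by blast
qed

lemma H2_iso_only_if:
  assumes m: "m \<ge> 3" and l: "odd l" and l': "odd l'" and iso: "H2 (1 + 2 ^ m * l') \<cong> H2 (1 + 2 ^ m * l)"
  shows "2 ^ (m - 2) dvd l' - l"
proof -
  let ?a = "1 + 2 ^ m * l" and ?a' = "1 + 2 ^ m * l'"
  have m2: "m \<ge> 2" using m by simp
  interpret Q: macdonald_quotient "H2 ?a" "H2_x ?a" "H2_y ?a" m l
    by (rule H2_macdonald_quotient[OF m2 l refl])
  interpret Q': macdonald_quotient "H2 ?a'" "H2_x ?a'" "H2_y ?a'" m l'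
    by (rule H2_macdonald_quotient[OF m2 l' refl])
  obtain f where f: "f \<in> iso (H2 ?a') (H2 ?a)" using iso unfolding is_iso_def by blast
  interpret f: group_hom "H2 ?a'" "H2 ?a" f
    using f group_H2 by (simp add: group_hom_def group_hom_axioms_def iso_def)
  have surj: "f ` carrier (H2 ?a') = carrier (H2 ?a)" using f by (simp add: iso_def bij_betw_def)
  let ?u = "f (H2_x ?a')" and ?v = "f (H2_y ?a')"
  have "macdonald_pair (H2 ?a) ?u ?v ?a' (1 - 2 ^ m * l') (2 ^ (2 * m - 1))"
  proof unfold_locales
    show "conjugate (H2 ?a) ?u (commutator (H2 ?a) ?u ?v) = ?u [^]\<^bsub>H2 ?a\<^esub> ?a'"
      using arg_cong[OF Q'.conj_x, of f] by (simp add: f.hom_conjugate f.hom_commutator f.hom_int_pow)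
    show "conjugate (H2 ?a) ?v (commutator (H2 ?a) ?v ?u) = ?v [^]\<^bsub>H2 ?a\<^esub> ?a'"
      using arg_cong[OF Q'.conj_y, of f] by (simp add: f.hom_conjugate f.hom_commutator f.hom_int_pow)
    show "?u [^]\<^bsub>H2 ?a\<^esub> ((2::int) ^ (2 * m - 1)) = \<one>\<^bsub>H2 ?a\<^esub>"
      using arg_cong[OF Q'.pow_x, of f] by (simp add: f.hom_int_pow)
    show "?v [^]\<^bsub>H2 ?a\<^esub> ((2::int) ^ (2 * m - 1)) = \<one>\<^bsub>H2 ?a\<^esub>"
      using arg_cong[OF Q'.pow_y, of f] by (simp add: f.hom_int_pow)
  qed (use Q'.g in simp_all)
  moreover have "\<exists>(i::nat) (j::nat) (k::nat). h = ?u [^]\<^bsub>H2 ?a\<^esub> i \<otimes>\<^bsub>H2 ?a\<^esub> ?v [^]\<^bsub>H2 ?a\<^esub> j \<otimes>\<^bsub>H2 ?a\<^esub>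
      commutator (H2 ?a) ?u ?v [^]\<^bsub>H2 ?a\<^esub> k" if h: "h \<in> carrier (H2 ?a)" for h
  proof -
    obtain h' where h': "h' \<in> carrier (H2 ?a')" "h = f h'" using h surj by blast
    obtain i j k :: nat where "h' = H2_x ?a' [^]\<^bsub>H2 ?a'\<^esub> i \<otimes>\<^bsub>H2 ?a'\<^esub> H2_y ?a' [^]\<^bsub>H2 ?a'\<^esub> j \<otimes>\<^bsub>H2 ?a'\<^esub> Q'.z [^]\<^bsub>H2 ?a'\<^esub> k"
      using Q'.normal_form[OF h'(1)] by blast
    then have "h = ?u [^]\<^bsub>H2 ?a\<^esub> i \<otimes>\<^bsub>H2 ?a\<^esub> ?v [^]\<^bsub>H2 ?a\<^esub> j \<otimes>\<^bsub>H2 ?a\<^esub> commutator (H2 ?a) ?u ?v [^]\<^bsub>H2 ?a\<^esub> k"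
      by (simp add: h'(2) f.hom_nat_pow Q'.z_def f.hom_commutator)
    then show ?thesis by blast
  qed
  ultimately show ?thesis by (rule Q.macdonald_pair_cong[OF _ m l'])
qed

lemma alpha_cong_iff:
  assumes "m \<ge> 2"
  shows "[1 + 2 ^ m * l' = 1 + 2 ^ m * l] (mod 2 ^ (2 * m - 2)) \<longleftrightarrow> 2 ^ (m - 2) dvd l' - (l::int)"
proof -
  have "2 * m - 2 = m + (m - 2)" using assms by simp
  then have "(2::int) ^ (2 * m - 2) = 2 ^ m * 2 ^ (m - 2)" by (simp only: power_add)
  moreover have "(1 + 2 ^ m * l') - (1 + 2 ^ m * l) = 2 ^ m * (l' - l)" by (simp add: algebra_simps)
  ultimately show ?thesis by (simp add: cong_iff_dvd_diff)
qed

lemma H2_iso_iff: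
  assumes m: "m \<ge> 3" and l: "odd l" and l': "odd l'"
  shows "H2 (1 + 2 ^ m * l') \<cong> H2 (1 + 2 ^ m * l) \<longleftrightarrow> 2 ^ (m - 2) dvd l' - l"
  using H2_iso_if[OF _ l l'] H2_iso_only_if[OF m l l'] m by auto

text \<open>By \<open>H2_iso_iff\<close> a class is determined by the odd residue of
  \<open>l\<close> modulo \<open>n = 2^(m-2)\<close>. As \<open>n\<close> is even for
  \<open>m \<ge> 3\<close>, the odd residues are exactly the totatives of \<open>n\<close>.\<close>

lemma card_iso_classes_H2:
  assumes m: "m \<ge> 3"
  shows "card (iso_classes {H2 (1 + 2 ^ m * l) | l::int. odd l}) = totient (2 ^ (m - 2))"
proof -
  define \<G> where "\<G> = {H2 (1 + 2 ^ m * l) | l::int. odd l}"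
  define R where "R = {(G, H). G \<in> \<G> \<and> H \<in> \<G> \<and> G \<cong> H}"
  define n :: nat where "n = 2 ^ (m - 2)"
  have "(1::nat) < 2 ^ (m - 2)" by (rule one_less_power) (use m in auto)
  then have n: "n > 1" "int n = 2 ^ (m - 2)" by (simp_all add: n_def)
  define h where "h k = H2 (1 + 2 ^ m * int k)" for k
  have h: "h k \<in> \<G>" if "k \<in> totatives n" for k
  proof -
    have "odd k" using that m by (auto simp: totatives_def n_def)
    then show ?thesis unfolding \<G>_def h_def by auto
  qed
  have R_iff: "(H2 (1 + 2 ^ m * l'), H2 (1 + 2 ^ m * l)) \<in> R \<longleftrightarrow> int n dvd l' - l" if "odd l" "odd l'" for l l'
    using that H2_iso_iff[OF m that] n(2) by (auto simp: R_def \<G>_def)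
  have class_eq: "R `` {H2 (1 + 2 ^ m * l)} = R `` {H2 (1 + 2 ^ m * l')}" if "odd l" "odd l'" "int n dvd l' - l" for l l'
  proof -
    have "int n dvd l - i \<longleftrightarrow> int n dvd l' - i" for i
    proof -
      have "l' - i = (l' - l) + (l - i)" by simp
      then show ?thesis using that(3) by (metis dvd_add_right_iff)
    qed
    then have "(H2 (1 + 2 ^ m * l), H) \<in> R \<longleftrightarrow> (H2 (1 + 2 ^ m * l'), H) \<in> R" for H
    proof (cases "H \<in> \<G>")
      case True
      then obtain i where "odd i" "H = H2 (1 + 2 ^ m * i)" unfolding \<G>_def by blast
      then show ?thesis using R_iff that \<open>\<And>i. int n dvd l - i \<longleftrightarrow> int n dvd l' - i\<close> by simp
    qed (simp add: R_def)
    then show ?thesis by blast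
  qed
  have "\<G> // R = (\<lambda>k. R `` {h k}) ` totatives n"
  proof (intro equalityI subsetI)
    fix A assume "A \<in> \<G> // R"
    then obtain G where "G \<in> \<G>" and A: "A = R `` {G}" by (auto elim: quotientE)
    then obtain l where l: "odd l" "G = H2 (1 + 2 ^ m * l)" unfolding \<G>_def by blast
    \<comment> \<open>The least residue of \<open>l\<close> is the representative; it stays odd
      because \<open>n\<close> is even, hence is positive and coprime to \<open>n\<close>.\<close>
    define k where "k = nat (l mod int n)"
    have k: "int k = l mod int n" using n by (simp add: k_def)
    have "even (int n)" using m by (simp add: n(2))
    then have "odd (int k)" unfolding k using l(1) by (simp add: dvd_mod_iff)
    then have "odd k" by simp
    then have "coprime k n" by (simp add: n_def)
    moreover have "k > 0" using \<open>odd k\<close> by (rule odd_pos)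
    moreover have "int k < int n" unfolding k using n by simp
    ultimately have "k \<in> totatives n" by (simp add: totatives_def)
    moreover have "int n dvd int k - l" unfolding k by (simp add: mod_eq_dvd_iff[symmetric])
    then have "A = R `` {h k}"
      unfolding A l(2) h_def using class_eq[OF l(1) \<open>odd (int k)\<close>] by blast
    ultimately show "A \<in> (\<lambda>k. R `` {h k}) ` totatives n" by blast
  next
    fix A assume "A \<in> (\<lambda>k. R `` {h k}) ` totatives n"
    then show "A \<in> \<G> // R" using h by (auto intro: quotientI)
  qed
  moreover have "inj_on (\<lambda>k. R `` {h k}) (totatives n)"
  proof (rule inj_onI)
    fix k k' assume k: "k \<in> totatives n" "k' \<in> totatives n" and eq: "R `` {h k} = R `` {h k'}"
    have o: "odd (int k)" "odd (int k')" using k m by (auto simp: totatives_def n_def)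
    have "(h k', h k') \<in> R" unfolding h_def using R_iff[OF o(2) o(2)] by simp
    then have "(h k, h k') \<in> R" using eq by blast
    then have "int n dvd int k - int k'" unfolding h_def using R_iff[OF o(2,1)] by simp
    then have "[int k = int k'] (mod int n)" by (simp add: cong_iff_dvd_diff)
    then have "[k = k'] (mod n)" by (simp add: cong_int_iff)
    moreover have "k < n" "k' < n" using k n(1) totatives_less by auto
    ultimately show "k = k'" by (simp add: cong_less_modulus_unique_nat)
  qed
  ultimately have "card (\<G> // R) = card (totatives n)" by (simp add: card_image)
  then show ?thesis
    unfolding iso_classes_def \<G>_def[symmetric] R_def[symmetric] totient_def n_def by simp
qed

text \<open>For \<open>m = 1\<close> the generators have order dividing \<open>2^(3m-1) = 4\<close>,
  and every \<open>1 + 2 l\<close> with \<open>l\<close> odd is 3 modulo 4.\<close>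

lemma H2_level_one: "odd l \<Longrightarrow> H2 (1 + 2 * l) = H2 3"
proof -
  assume l: "odd l"
  have level: "level (1 + 2 * l) = 1" "level 3 = 1"
    using level_eq[OF l, of 1] level_eq[of 1 1] by simp_all
  have "J2 (1 + 2 * l) = J2 3"
  proof (rule J2_cong)
    have "even (l - 1)" using l by simp
    then have "2 * 2 dvd 2 * (l - 1)" by (intro mult_dvd_mono) auto
    then show "2 ^ (3 * level (1 + 2 * l) - 1) dvd 1 + 2 * l - 3" unfolding level by simp
  qed (simp only: level)
  then show ?thesis by (simp add: H2_def)
qed

theorem theoremE:
  shows "(\<forall>l::int. odd l \<longrightarrow> H2 (1 + 2 * l) \<cong> H2 3)
    \<and> (\<forall>l::int. odd l \<longrightarrow> H2 (1 + 4 * l) \<cong> H2 5)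
    \<and> (\<forall>l::int. odd l \<longrightarrow> H2 (1 + 8 * l) \<cong> H2 9)
    \<and> (\<forall>(m::nat) (l::int) (l'::int) (\<alpha>::int) (\<alpha>'::int).
         m > 2 \<longrightarrow> odd l \<longrightarrow> odd l' \<longrightarrow> \<alpha> = 1 + 2 ^ m * l \<longrightarrow> \<alpha>' = 1 + 2 ^ m * l' \<longrightarrow>
         (H2 \<alpha>' \<cong> H2 \<alpha> \<longleftrightarrow> [\<alpha>' = \<alpha>] (mod 2 ^ (2 * m - 2))))
    \<and> (\<forall>m::nat. m > 2 \<longrightarrow>
         card (iso_classes {H2 (1 + 2 ^ m * l) | l::int. odd l}) = totient (2 ^ (m - 2)))"
proof (intro conjI allI impI)
  show "H2 (1 + 2 * l) \<cong> H2 3" if "odd l" for l :: int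
    unfolding H2_level_one[OF that] by (rule iso_refl)
  \<comment> \<open>For \<open>m = 2\<close> and \<open>m = 3\<close> the required congruence is
    modulo 1 and modulo 2, so it holds for all odd \<open>l\<close>.\<close>
  show "H2 (1 + 4 * l) \<cong> H2 5" if "odd l" for l :: int
    using H2_iso_if[of 2 1 l] that by simp
  show "H2 (1 + 8 * l) \<cong> H2 9" if "odd l" for l :: int
    using H2_iso_if[of 3 1 l] that by simp
  show "H2 \<alpha>' \<cong> H2 \<alpha> \<longleftrightarrow> [\<alpha>' = \<alpha>] (mod 2 ^ (2 * m - 2))"
    if "m > 2" "odd l" "odd l'" "\<alpha> = 1 + 2 ^ m * l" "\<alpha>' = 1 + 2 ^ m * l'" for m l l' and \<alpha> \<alpha>' :: int
    using that H2_iso_iff[of m l l'] alpha_cong_iff[of m l' l] by simp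
  show "card (iso_classes {H2 (1 + 2 ^ m * l) | l::int. odd l}) = totient (2 ^ (m - 2))" if "m > 2" for m
    using that by (intro card_iso_classes_H2) simp
qed

end
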